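(* Let $\Omega\subset\mathbb{R}^N$ be a convex compact set. For every $f\in\mathbf{X}_0^\sharp(\Omega)$: (1) there exists a Kantorovich potential $u\in Lip(\Omega)$ which attains the maximum in $$\mathcal{W}^1(f)=\max\{\langle f,u\rangle\ :\ u\in Lip(\Omega),\ \|\nabla u\|_{L^\infty(\Omega)}\le1\};$$ (2) there exists an optimal measure $\lambda\in\mathcal{M}(\Omega;\mathbb{R}^N)$ which solves the problem $$\min\{\|\lambda\|\ :\ \lambda\in\mathcal{M}(\Omega;\mathbb{R}^N),\ -\operatorname{div}\lambda=f\ \text{in}\ \mathcal{D}'(\mathbb{R}^N)\};$$ (3) the two extremal values are equal, i.e. $$\mathcal{W}^1(f)=\min\{\|\lambda\|\ :\ \lambda\in\mathcal{M}(\Omega;\mathbb{R}^N),\ -\operatorname{div}\lambda=f\ \text{in}\ \mathcal{D}'(\mathbb{R}^N)\}.$$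
   Context: $\Omega$ is a convex compact subset of $\mathbb{R}^N$. $\mathcal{M}(\Omega;\mathbb{R}^N)$ is the space of finite $\mathbb{R}^N$-valued Radon measures on $\Omega$ (viewed as measures on $\mathbb{R}^N$ supported in $\Omega$), and $\|\lambda\|$ is the total variation with respect to the Euclidean norm. $Lip(\Omega)$ is the space of Lipschitz functions on $\Omega$; the constraint $\|\nabla u\|_{L^\infty(\Omega)}\le1$ means that $u$ is 1-Lipschitz on $\Omega$. $\mathbf{X}_0(\Omega)$ is the space of distributions $f\in\mathcal{D}'(\mathbb{R}^N)$ for which there is a constant $C$ with $\langle f,\varphi\rangle\le C(\|\varphi\|_{L^\infty(\Omega)}+\|\nabla\varphi\|_{L^\infty(\Omega)})$ for all $\varphi\in\mathcal{D}(\mathbb{R}^N)$, and such that $\langle f,1\rangle=0$, meaning that $\langle f,\varphi\rangle=0$ whenever $\varphi\in\mathcal{D}(\mathbb{R}^N)$ is constant on $\Omega$. $\mathbf{X}_0^\sharp(\Omega)$ is the set of $f\in\mathbf{X}_0(\Omega)$ such that for every $\varepsilon>0$ there is $C_\varepsilon>0$ with $|\langle f,\varphi\rangle|\le C_\varepsilon\|\varphi\|_{L^\infty(\Omega)}+\varepsilon\|\nabla\varphi\|_{L^\infty(\Omega)}$ for all $\varphi\in\mathcal{D}(\mathbb{R}^N)$. An element $f\in\mathbf{X}_0^\sharp(\Omega)$ acts on $u\in Lip(\Omega)$ by $\langle f,u\rangle=\lim_n\langle f,u_n\rangle$ for any sequence $u_n\in\mathcal{D}(\mathbb{R}^N)$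 converging to $u$ uniformly on $\Omega$ with $\sup_n\|\nabla u_n\|_{L^\infty(\Omega)}<\infty$. Finally $\mathcal{W}^1(f):=\sup\{\langle f,u\rangle: u\in\mathcal{C}^1_0(\mathbb{R}^N),\ \|\nabla u\|_\infty\le1\}$, where $\mathcal{C}^1_0(\mathbb{R}^N)$ are the compactly supported $\mathcal{C}^1$ functions. *)

theory Defs
  imports "HOL-Analysis.Analysis"
begin

section \<open>Test functions and distributions\<close>

definition partial :: "'n \<Rightarrow> (real ^ 'n \<Rightarrow> real) \<Rightarrow> real ^ 'n \<Rightarrow> real" where
  "partial i u x = frechet_derivative u (at x) (axis i 1)"

definition grad :: "(real ^ 'n \<Rightarrow> real) \<Rightarrow> real ^ 'n \<Rightarrow> real ^ 'n" where
  "grad u x = (\<chi> i. partial i u x)"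

primrec C_k :: "nat \<Rightarrow> (real ^ 'n \<Rightarrow> real) \<Rightarrow> bool" where
  "C_k 0 u \<longleftrightarrow> continuous_on UNIV u"
| "C_k (Suc k) u \<longleftrightarrow> (\<forall>x. u differentiable (at x)) \<and> (\<forall>i. C_k k (partial i u))"

definition supp :: "(real ^ 'n \<Rightarrow> real) \<Rightarrow> (real ^ 'n) set" where
  "supp u = closure (support_on UNIV u)"

definition test_funs :: "(real ^ 'n \<Rightarrow> real) set" where
  "test_funs = {\<phi>. (\<forall>k. C_k k \<phi>) \<and> compact (supp \<phi>)}"

definition C1_compact_supp :: "(real ^ 'n \<Rightarrow> real) set" where
  "C1_compact_supp = {u. C_k 1 u \<and> compact (supp u)}"

text \<open>On nonempty compact \<open>\<Omega>\<close> and for continuous \<open>g\<close> the set below is bounded and this is the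
  maximum norm. For empty \<open>\<Omega>\<close> the value is unspecified, but then \<open>X\<^sub>0\<close> below is \<open>{0}\<close> on
  test functions whatever the value.\<close>

definition sup_norm :: "(real ^ 'n) set \<Rightarrow> (real ^ 'n \<Rightarrow> 'b::real_normed_vector) \<Rightarrow> real" where
  "sup_norm \<Omega> g = (SUP x\<in>\<Omega>. norm (g x))"

text \<open>Distributions are functionals on \<^const>\<open>test_funs\<close>; their values on other functions are
  never used. Continuity is the usual seminorm estimate on every compact set. The derivatives of
  order at most \<open>m\<close> are listed by the finitely many words of length at most \<open>m\<close> over the
  coordinate indices, so mixed derivatives occur repeatedly, which affects only the constant.\<close>

definition distribution :: "((real ^ 'n \<Rightarrow> real) \<Rightarrow> real) \<Rightarrow> bool" where
  "distribution f \<longleftrightarrow>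
     (\<forall>\<phi>\<in>test_funs. \<forall>\<psi>\<in>test_funs. f (\<lambda>x. \<phi> x + \<psi> x) = f \<phi> + f \<psi>) \<and>
     (\<forall>c. \<forall>\<phi>\<in>test_funs. f (\<lambda>x. c * \<phi> x) = c * f \<phi>) \<and>
     (\<forall>K. compact K \<longrightarrow>
        (\<exists>C m. \<forall>\<phi>\<in>test_funs. supp \<phi> \<subseteq> K \<longrightarrow>
           \<bar>f \<phi>\<bar> \<le> C * (\<Sum>is | length is \<le> m. sup_norm UNIV (foldr partial is \<phi>))))"

section \<open>The spaces of distributions, the duality with Lipschitz functions, and the norm\<close>

definition X0 :: "(real ^ 'n) set \<Rightarrow> ((real ^ 'n \<Rightarrow> real) \<Rightarrow> real) set" where
  "X0 \<Omega> = {f. distribution f \<and>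
     (\<exists>C. \<forall>\<phi>\<in>test_funs. f \<phi> \<le> C * (sup_norm \<Omega> \<phi> + sup_norm \<Omega> (grad \<phi>))) \<and>
     (\<forall>\<phi>\<in>test_funs. \<phi> constant_on \<Omega> \<longrightarrow> f \<phi> = 0)}"

definition X0_sharp :: "(real ^ 'n) set \<Rightarrow> ((real ^ 'n \<Rightarrow> real) \<Rightarrow> real) set" where
  "X0_sharp \<Omega> = {f \<in> X0 \<Omega>. \<forall>\<epsilon>>0. \<exists>C>0. \<forall>\<phi>\<in>test_funs.
     \<bar>f \<phi>\<bar> \<le> C * sup_norm \<Omega> \<phi> + \<epsilon> * sup_norm \<Omega> (grad \<phi>)}"

definition approximates ::
    "(real ^ 'n) set \<Rightarrow> (nat \<Rightarrow> real ^ 'n \<Rightarrow> real) \<Rightarrow> (real ^ 'n \<Rightarrow> real) \<Rightarrow> bool" where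
  "approximates \<Omega> v u \<longleftrightarrow>
     range v \<subseteq> test_funs \<and>
     uniform_limit \<Omega> v u sequentially \<and>
     bdd_above (range (\<lambda>n. sup_norm \<Omega> (grad (v n))))"

text \<open>The action of \<open>f\<close> in \<open>X0_sharp \<Omega>\<close> on a function \<open>u\<close> that is Lipschitz on \<open>\<Omega>\<close>; only the
  values of \<open>u\<close> on \<open>\<Omega>\<close> matter.\<close>

definition pairing ::
    "(real ^ 'n) set \<Rightarrow> ((real ^ 'n \<Rightarrow> real) \<Rightarrow> real) \<Rightarrow> (real ^ 'n \<Rightarrow> real) \<Rightarrow> real" where
  "pairing \<Omega> f u = (THE l. \<forall>v. approximates \<Omega> v u \<longrightarrow> (\<lambda>n. f (v n)) \<longlonglongrightarrow> l)"

definition W1 :: "(real ^ 'n) set \<Rightarrow> ((real ^ 'n \<Rightarrow> real) \<Rightarrow> real) \<Rightarrow> ereal" where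
  "W1 \<Omega> f = (SUP u \<in> {u \<in> C1_compact_supp. \<forall>x. norm (grad u x) \<le> 1}. ereal (pairing \<Omega> f u))"

section \<open>Vector measures\<close>

text \<open>Countably additive set functions on the Borel sets of the whole space, with values in the
  space and supported in \<open>\<Omega>\<close>. Such a function is automatically finite and Radon.\<close>

definition vector_measures :: "(real ^ 'n) set \<Rightarrow> ((real ^ 'n) set \<Rightarrow> real ^ 'n) set" where
  "vector_measures \<Omega> = {l.
     (\<forall>A. range A \<subseteq> sets borel \<and> disjoint_family A \<longrightarrow>
        (\<lambda>n::nat. l (A n)) sums l (\<Union>n. A n)) \<and>
     (\<forall>A\<in>sets borel. A \<inter> \<Omega> = {} \<longrightarrow> l A = 0)}"

definition total_variation :: "((real ^ 'n) set \<Rightarrow> real ^ 'n) \<Rightarrow> ereal" where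
  "total_variation l =
     (SUP P \<in> {P. finite P \<and> P \<subseteq> sets borel \<and> disjoint P}. \<Sum>A\<in>P. ereal (norm (l A)))"

text \<open>The positive part in the Jordan decomposition of a finite signed Borel measure \<open>s\<close>; the
  negative part is the positive part of \<open>- s\<close>. Since \<^const>\<open>ennreal\<close> truncates at \<open>0\<close> and
  \<open>s {} = 0\<close>, the supremum is that of the values \<open>s B\<close>.\<close>

definition pos_part :: "((real ^ 'n) set \<Rightarrow> real) \<Rightarrow> (real ^ 'n) measure" where
  "pos_part s = measure_of UNIV (sets borel)
     (\<lambda>A. SUP B \<in> {B \<in> sets borel. B \<subseteq> A}. ennreal (s B))"

definition signed_integral ::
    "((real ^ 'n) set \<Rightarrow> real) \<Rightarrow> (real ^ 'n \<Rightarrow> real) \<Rightarrow> real" where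
  "signed_integral s g = (LINT x|pos_part s. g x) - (LINT x|pos_part (\<lambda>A. - s A). g x)"

definition vector_integral ::
    "((real ^ 'n) set \<Rightarrow> real ^ 'n) \<Rightarrow> (real ^ 'n \<Rightarrow> real ^ 'n) \<Rightarrow> real" where
  "vector_integral l g = (\<Sum>i\<in>UNIV. signed_integral (\<lambda>A. l A $ i) (\<lambda>x. g x $ i))"

text \<open>The equation \<open>- div l = f\<close> in the sense of distributions.\<close>

definition neg_div_eq ::
    "((real ^ 'n) set \<Rightarrow> real ^ 'n) \<Rightarrow> ((real ^ 'n \<Rightarrow> real) \<Rightarrow> real) \<Rightarrow> bool" where
  "neg_div_eq l f \<longleftrightarrow> (\<forall>\<phi>\<in>test_funs. vector_integral l (grad \<phi>) = f \<phi>)"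

end

(*
By Arzela-Ascoli and the continuity of the pairing on uniformly bounded 1-Lipschitz functions, the
supremum W over all 1-Lipschitz functions is attained; it equals W1 because a 1-Lipschitz function on
\<Omega> extends, up to a constant, to a compactly supported 1-Lipschitz function, which mollification
approximates by test functions with gradients bounded by 1. Convexity of \<Omega> gives
f \<phi> \<le> W sup |grad \<phi>| over \<Omega>. The linear functional grad \<phi> \<bullet> \<theta> \<mapsto> f \<phi> on functions of
(x, \<theta>) in \<Omega> \<times> cball 0 1 is then dominated by W times the maximum of the positive part. Its
Hahn-Banach extension is positive, hence a measure \<mu> of mass at most W by the Riesz theorem, and the
optimal vector measure is \<lambda>(A) = \<integral> 1_A(x) \<theta> d\<mu>(x, \<theta>).
*)
theory Submission
  imports Defs "HOL-Complex_Analysis.Great_Picard"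
begin

section \<open>The Hahn-Banach theorem\<close>

text \<open>The two-constant estimate of \<open>X0_sharp\<close> is used as a modulus of continuity:
  under a common gradient bound, a small \<open>\<epsilon>\<close> absorbs the gradient term and the
  large constant is paid for by uniform closeness. This makes the pairing well defined and lets it
  pass to Arzela-Ascoli limits. Convexity turns a bound for \<open>grad \<phi>\<close> on
  \<open>\<Omega>\<close> into a Lipschitz bound with the same constant for the Euclidean distance,
  and makes the projection onto \<open>\<Omega>\<close> continuous. The direction
  \<open>\<theta>\<close> linearises the norm: \<open>norm v\<close> is the maximum of
  \<open>v \<bullet> \<theta>\<close> over the unit ball. The same bound
  \<open>norm \<theta> \<le> 1\<close> later keeps the total variation of the vector measure below
  the mass of the scalar one. An obstacle is that \<open>vector_integral\<close> is assembled from
  Jordan parts of the coordinates, whereas the sharp bounds concern the Euclidean norms of the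
  values \<open>l A\<close>. Coordinatewise estimates would lose a dimensional factor. Hence each
  integral is compared with the sums of \<open>g (x j) \<bullet> l (A j)\<close> over a fine
  partition: the dimension then appears only in an error that vanishes with the mesh.\<close>

definition sublinear :: "('v::real_vector \<Rightarrow> real) \<Rightarrow> bool" where
  "sublinear p \<longleftrightarrow> (\<forall>x y. p (x + y) \<le> p x + p y) \<and> (\<forall>c\<ge>0. \<forall>x. p (c *\<^sub>R x) = c * p x)"

lemma sublinear_zero: "sublinear p \<Longrightarrow> p 0 = 0"
  unfolding sublinear_def by (metis mult_zero_left order_refl scaleR_zero_left)

lemma sublinear_lower: "sublinear p \<Longrightarrow> - p (- x) \<le> p x"
proof -
  assume p: "sublinear p"
  then have "p (x + - x) \<le> p x + p (- x)" unfolding sublinear_def by blast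
  then show ?thesis using sublinear_zero[OF p] by simp
qed

text \<open>The infimum forgets the index, so each inequality may hold with a different index on its
  left side, and single members need not be sublinear. This serves three constructions: lowering a
  functional in one direction, the lower bound of a chain, and lowering \<open>p\<close> along a
  graph.\<close>

lemma sublinear_Inf:
  fixes q :: "'i \<Rightarrow> 'v::real_vector \<Rightarrow> real"
  assumes ne: "I \<noteq> {}"
    and lower: "\<And>i x. i \<in> I \<Longrightarrow> b x \<le> q i x"
    and add: "\<And>i j x y. i \<in> I \<Longrightarrow> j \<in> I \<Longrightarrow> \<exists>k\<in>I. q k (x + y) \<le> q i x + q j y"
    and scale: "\<And>i c x. i \<in> I \<Longrightarrow> c > 0 \<Longrightarrow> \<exists>k\<in>I. q k (c *\<^sub>R x) \<le> c * q i x"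
    and zero: "\<And>i. i \<in> I \<Longrightarrow> 0 \<le> q i 0" "\<exists>i\<in>I. q i 0 = 0"
  shows "sublinear (\<lambda>x. INF i\<in>I. q i x)"
proof -
  have bdd: "bdd_below ((\<lambda>i. q i x) ` I)" for x
    using lower by (intro bdd_belowI2)
  have low: "(INF i\<in>I. q i x) \<le> q i x" if "i \<in> I" for i x
    using bdd that by (rule cINF_lower)
  have subadd: "(INF i\<in>I. q i (x + y)) \<le> (INF i\<in>I. q i x) + (INF i\<in>I. q i y)" for x y
  proof -
    have "(INF i\<in>I. q i (x + y)) - q j y \<le> (INF i\<in>I. q i x)" if j: "j \<in> I" for j
    proof (rule cINF_greatest[OF ne])
      fix i assume "i \<in> I"
      then obtain k where "k \<in> I" "q k (x + y) \<le> q i x + q j y" using add j by blast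
      then show "(INF i\<in>I. q i (x + y)) - q j y \<le> q i x" using low[of k "x + y"] by linarith
    qed
    then have "(INF i\<in>I. q i (x + y)) - (INF i\<in>I. q i x) \<le> (INF i\<in>I. q i y)"
      by (intro cINF_greatest[OF ne]) (auto simp: algebra_simps)
    then show ?thesis by simp
  qed
  have scal: "(INF i\<in>I. q i (c *\<^sub>R x)) \<le> c * (INF i\<in>I. q i x)" if c: "c > 0" for c x
  proof -
    have "(INF i\<in>I. q i (c *\<^sub>R x)) / c \<le> (INF i\<in>I. q i x)"
    proof (rule cINF_greatest[OF ne])
      fix i assume "i \<in> I"
      then obtain k where "k \<in> I" "q k (c *\<^sub>R x) \<le> c * q i x" using scale c by blast
      then show "(INF i\<in>I. q i (c *\<^sub>R x)) / c \<le> q i x"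
        using low[of k "c *\<^sub>R x"] c by (simp add: field_simps)
    qed
    then show ?thesis using c by (simp add: field_simps)
  qed
  have hom: "(INF i\<in>I. q i (c *\<^sub>R x)) = c * (INF i\<in>I. q i x)" if c: "c > 0" for c x
  proof (rule antisym[OF scal[OF c]])
    have "(INF i\<in>I. q i x) \<le> inverse c * (INF i\<in>I. q i (c *\<^sub>R x))"
      using scal[of "inverse c" "c *\<^sub>R x"] c by simp
    then show "c * (INF i\<in>I. q i x) \<le> (INF i\<in>I. q i (c *\<^sub>R x))"
      using c by (simp add: field_simps)
  qed
  have "(INF i\<in>I. q i 0) = 0"
  proof (rule antisym)
    show "(INF i\<in>I. q i 0) \<le> 0" using zero(2) low[of _ 0] by force
    show "0 \<le> (INF i\<in>I. q i 0)" using zero(1) by (intro cINF_greatest[OF ne])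
  qed
  then have "(INF i\<in>I. q i (c *\<^sub>R x)) = c * (INF i\<in>I. q i x)" if "c \<ge> 0" for c x
    using hom that by (cases "c = 0") auto
  with subadd show ?thesis unfolding sublinear_def by blast
qed

text \<open>If \<open>q\<close> failed to be additive in some direction \<open>y\<close>, it could
  be lowered along that direction; minimality forbids this, and additivity together with positive
  homogeneity gives linearity.\<close>

lemma minimal_sublinear_linear:
  assumes q: "sublinear q" and min: "\<And>r. sublinear r \<Longrightarrow> r \<le> q \<Longrightarrow> r = q"
  shows "linear q"
proof -
  have sub: "q (x + y) \<le> q x + q y" for x y using q by (auto simp: sublinear_def)
  have hom: "q (c *\<^sub>R x) = c * q x" if "c \<ge> 0" for c x using q that by (auto simp: sublinear_def)
  have add: "q (x + y) = q x + q y" for x y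
  proof -
    \<comment> \<open>The choice \<open>t = 0\<close> gives \<open>r \<le> q\<close>, hence
      \<open>r = q\<close> by minimality. The choice \<open>t = 1\<close> then yields
      \<open>q x \<le> q (x + y) - q y\<close>, the missing half of additivity.\<close>
    define r where "r = (\<lambda>x. INF t\<in>{0::real..}. q (x + t *\<^sub>R y) - t * q y)"
    have low: "- q (- x) \<le> q (x + t *\<^sub>R y) - t * q y" if "t \<in> {0..}" for x t
      using sub[of "x + t *\<^sub>R y" "- x"] hom[of t y] that by simp
    have "sublinear r"
      unfolding r_def
    proof (rule sublinear_Inf)
      show "- q (- x) \<le> q (x + t *\<^sub>R y) - t * q y" if "t \<in> {0..}" for x t
        using low that .
      show "\<exists>k\<in>{0..}. q (a + b + k *\<^sub>R y) - k * q y \<le> q (a + i *\<^sub>R y) - i * q y + (q (b + j *\<^sub>R y) - j * q y)"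
        if "i \<in> {0..}" "j \<in> {0..}" for i j a b
        using that sub[of "a + i *\<^sub>R y" "b + j *\<^sub>R y"]
        by (intro bexI[of _ "i + j"]) (auto simp: algebra_simps)
      show "\<exists>k\<in>{0..}. q (c *\<^sub>R a + k *\<^sub>R y) - k * q y \<le> c * (q (a + i *\<^sub>R y) - i * q y)"
        if "i \<in> {0..}" "c > 0" for i c a
        using that hom[of c "a + i *\<^sub>R y"]
        by (intro bexI[of _ "c * i"]) (auto simp: algebra_simps)
      show "0 \<le> q (0 + i *\<^sub>R y) - i * q y" if "i \<in> {0..}" for i
        using that hom[of i y] by simp
      show "\<exists>i\<in>{0..}. q (0 + i *\<^sub>R y) - i * q y = 0"
        using hom[of 0 y] by (intro bexI[of _ 0]) auto
    qed auto
    moreover have bdd: "bdd_below ((\<lambda>t. q (z + t *\<^sub>R y) - t * q y) ` {0..})" for z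
      using low by (rule bdd_belowI2)
    have r_le: "r z \<le> q (z + t *\<^sub>R y) - t * q y" if "t \<ge> 0" for z t
      unfolding r_def by (rule cINF_lower[OF bdd]) (use that in auto)
    have "r \<le> q" using r_le[of 0] by (simp add: le_fun_def)
    ultimately have "r = q" by (rule min)
    then have "q x \<le> q (x + y) - q y" using r_le[of 1 x] by simp
    with sub show ?thesis by (simp add: antisym)
  qed
  have "q (- x) = - q x" for x using add[of x "- x"] sublinear_zero[OF q] by simp
  then have "q (c *\<^sub>R x) = c * q x" for c x
    using hom[of c x] hom[of "- c" x] by (cases "c \<ge> 0") (auto simp flip: minus_equation_iff)
  with add show ?thesis by (intro linearI) auto
qed

text \<open>Zorn's lemma yields a minimal sublinear functional below \<open>p\<close>. A chain is
  bounded below by its pointwise infimum, which is finite because every member stays above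
  \<open>- p (- x)\<close>.\<close>

lemma sublinear_dominates_linear:
  fixes p :: "'v::real_vector \<Rightarrow> real"
  assumes p: "sublinear p"
  shows "\<exists>L. linear L \<and> L \<le> p"
proof -
  let ?A = "{q. sublinear q \<and> q \<le> p}"
  have "\<exists>m\<in>?A. \<forall>a\<in>?A. m \<ge> a \<longrightarrow> a = m"
  proof (rule predicate_Zorn)
    show "partial_order_on ?A (relation_of (\<ge>) ?A)"
      by (intro partial_order_on_relation_ofI) auto
  next
    fix C assume C: "C \<in> Chains (relation_of (\<ge>) ?A)"
    then have sub: "C \<subseteq> ?A" and tot: "\<And>a b. a \<in> C \<Longrightarrow> b \<in> C \<Longrightarrow> a \<le> b \<or> b \<le> a"
      by (auto simp: Chains_def relation_of_def)
    show "\<exists>u\<in>?A. \<forall>a\<in>C. a \<ge> u"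
    proof (cases "C = {}")
      case True then show ?thesis using p by auto
    next
      case False
      have low: "- p (- x) \<le> q x" if "q \<in> C" for q x
      proof -
        have "sublinear q" "q (- x) \<le> p (- x)" using that sub by (auto simp: le_fun_def)
        then show ?thesis using sublinear_lower[of q x] by linarith
      qed
      have "sublinear (\<lambda>x. INF q\<in>C. q x)"
      proof (rule sublinear_Inf[OF False])
        show "- p (- x) \<le> q x" if "q \<in> C" for q x using low that .
        show "\<exists>k\<in>C. k (x + y) \<le> i x + j y" if ij: "i \<in> C" "j \<in> C" for i j x y
        proof -
          obtain k where k: "k \<in> C" "k \<le> i" "k \<le> j" using tot[OF ij] ij by blast
          then have "k (x + y) \<le> k x + k y" "k x \<le> i x" "k y \<le> j y"
            using sub by (auto simp: sublinear_def le_fun_def)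
          then show ?thesis using k(1) by (intro bexI[of _ k]) linarith+
        qed
        show "\<exists>k\<in>C. k (c *\<^sub>R x) \<le> c * i x" if "i \<in> C" "c > 0" for i c x
          using that sub by (intro bexI[of _ i]) (auto simp: sublinear_def)
        show "0 \<le> i 0" if "i \<in> C" for i using that sub sublinear_zero[of i] by auto
        show "\<exists>i\<in>C. i 0 = 0" using False sub sublinear_zero by blast
      qed
      moreover have le: "(\<lambda>x. INF q\<in>C. q x) \<le> a" if "a \<in> C" for a
        using low that by (auto simp: le_fun_def intro!: cINF_lower bdd_belowI2[of C])
      moreover have "(\<lambda>x. INF q\<in>C. q x) \<le> p"
        using le False sub by (blast intro: order_trans)
      ultimately show ?thesis by blast
    qed
  qed
  then obtain m where m: "sublinear m" "m \<le> p" and min: "\<And>a. sublinear a \<Longrightarrow> a \<le> p \<Longrightarrow> a \<le> m \<Longrightarrow> a = m"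
    by blast
  have "linear m"
    by (rule minimal_sublinear_linear[OF m(1)]) (use min m(2) order_trans in blast)
  with m show ?thesis by blast
qed

text \<open>The functional on a subspace is given by its graph, which avoids a separate
  well-definedness argument.\<close>

theorem Hahn_Banach:
  fixes p :: "'v::real_vector \<Rightarrow> real"
  assumes p: "sublinear p" and R: "subspace R" and dom: "\<And>s r. (s, r) \<in> R \<Longrightarrow> r \<le> p s"
  shows "\<exists>L. linear L \<and> L \<le> p \<and> (\<forall>s r. (s, r) \<in> R \<longrightarrow> L s = r)"
proof -
  have sub: "p (x + y) \<le> p x + p y" for x y using p by (auto simp: sublinear_def)
  have hom: "p (c *\<^sub>R x) = c * p x" if "c \<ge> 0" for c x using p that by (auto simp: sublinear_def)
  \<comment> \<open>A linear functional below \<open>p'\<close> is below \<open>p\<close> (take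
    \<open>z = 0\<close>) and satisfies \<open>L s \<le> r\<close> on the graph (take
    \<open>z = (s, r)\<close> at \<open>x = s\<close>). Since the graph is closed under negation,
    the second inequality is an equality.\<close>
  define p' where "p' = (\<lambda>x. INF z\<in>R. p (x - fst z) + snd z)"
  have low: "- p (- x) \<le> p (x - fst z) + snd z" if "z \<in> R" for x z
  proof -
    have "- z \<in> R" using R that by (rule subspace_neg)
    then have "- snd z \<le> p (- fst z)" by (intro dom) (simp add: uminus_prod_def)
    also have "\<dots> \<le> p (- x) + p (x - fst z)" using sub[of "- x" "x - fst z"] by simp
    finally show ?thesis by simp
  qed
  have "sublinear p'"
    unfolding p'_def
  proof (rule sublinear_Inf)
    show "R \<noteq> {}" using subspace_0[OF R] by auto
    show "- p (- x) \<le> p (x - fst z) + snd z" if "z \<in> R" for z x using low that .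
    show "\<exists>k\<in>R. p (x + y - fst k) + snd k \<le> p (x - fst i) + snd i + (p (y - fst j) + snd j)"
      if "i \<in> R" "j \<in> R" for i j x y
      using sub[of "x - fst i" "y - fst j"] subspace_add[OF R that]
      by (intro bexI[of _ "i + j"]) (auto simp: algebra_simps)
    show "\<exists>k\<in>R. p (c *\<^sub>R x - fst k) + snd k \<le> c * (p (x - fst i) + snd i)"
      if "i \<in> R" "c > 0" for i c x
      using hom[of c "x - fst i"] subspace_scale[OF R that(1), of c] that(2)
      by (intro bexI[of _ "c *\<^sub>R i"]) (auto simp: algebra_simps)
    show "0 \<le> p (0 - fst i) + snd i" if "i \<in> R" for i
      using low[OF that, of 0] sublinear_zero[OF p] by simp
    show "\<exists>i\<in>R. p (0 - fst i) + snd i = 0"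
      using subspace_0[OF R] sublinear_zero[OF p] by (intro bexI[of _ 0]) auto
  qed
  then obtain L where L: "linear L" "L \<le> p'" using sublinear_dominates_linear by blast
  have p'_le: "p' x \<le> p (x - fst z) + snd z" if "z \<in> R" for x z
    unfolding p'_def using that low by (intro cINF_lower bdd_belowI2[of R])
  have "L \<le> p"
  proof (rule le_funI)
    fix x
    have "L x \<le> p' x" using L(2) by (simp add: le_fun_def)
    also have "\<dots> \<le> p x" using p'_le[OF subspace_0[OF R], of x] by simp
    finally show "L x \<le> p x" .
  qed
  moreover have le: "L s \<le> r" if "(s, r) \<in> R" for s r
  proof -
    have "L s \<le> p' s" using L(2) by (simp add: le_fun_def)
    also have "\<dots> \<le> r" using p'_le[OF that, of s] sublinear_zero[OF p] by simp
    finally show ?thesis .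
  qed
  have "L s = r" if "(s, r) \<in> R" for s r
  proof (rule antisym[OF le[OF that]])
    have "(- s, - r) \<in> R" using subspace_neg[OF R that] by (simp add: uminus_prod_def)
    then show "r \<le> L s" using le[of "- s" "- r"] linear_neg[OF L(1)] by simp
  qed
  ultimately show ?thesis using L(1) by blast
qed

section \<open>The Riesz representation theorem for positive functionals\<close>

lemma bcontfunI:
  fixes f :: "'a::topological_space \<Rightarrow> 'b::real_normed_vector"
  assumes "continuous_on UNIV f" and "\<And>x. norm (f x) \<le> B"
  shows "f \<in> bcontfun"
  using assms by (auto simp: bcontfun_def bounded_iff)

lemma bcontfun_norm_bound:
  fixes f :: "'a::topological_space \<Rightarrow> 'b::real_normed_vector"
  assumes "f \<in> bcontfun"
  obtains B where "B > 0" "\<And>x. norm (f x) \<le> B"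
  using assms by (auto simp: bcontfun_def bounded_pos)

lemma bcontfun_cont: "f \<in> bcontfun \<Longrightarrow> continuous_on UNIV f"
  by (simp add: bcontfun_def)

lemma bcontfun_mult:
  fixes f g :: "'a::topological_space \<Rightarrow> real"
  assumes "f \<in> bcontfun" and "g \<in> bcontfun"
  shows "(\<lambda>x. f x * g x) \<in> bcontfun"
proof -
  obtain B C where "B > 0" "\<And>x. \<bar>f x\<bar> \<le> B" "C > 0" "\<And>x. \<bar>g x\<bar> \<le> C"
    using assms by (metis bcontfun_norm_bound real_norm_def)
  then show ?thesis using assms[THEN bcontfun_cont]
    by (intro bcontfunI[of _ "B * C"]) (auto intro!: continuous_intros mult_mono simp: abs_mult less_imp_le)
qed

lemma bcontfun_add:
  fixes f g :: "'a::topological_space \<Rightarrow> real"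
  assumes "f \<in> bcontfun" and "g \<in> bcontfun"
  shows "(\<lambda>x. f x + g x) \<in> bcontfun"
  using assms by (rule plus_cont)

lemma bcontfun_diff:
  fixes f g :: "'a::topological_space \<Rightarrow> real"
  assumes "f \<in> bcontfun" and "g \<in> bcontfun"
  shows "(\<lambda>x. f x - g x) \<in> bcontfun"
  using assms by (rule minus_cont)

lemma bcontfun_sum:
  fixes f :: "'i \<Rightarrow> 'a::topological_space \<Rightarrow> real"
  assumes "\<And>i. i \<in> I \<Longrightarrow> f i \<in> bcontfun"
  shows "(\<lambda>x. \<Sum>i\<in>I. f i x) \<in> bcontfun"
  using assms by (induction I rule: infinite_finite_induct) (auto intro: const_bcontfun bcontfun_add)

lemma suminf_ennreal_single: "(\<Sum>n. if n = 0 then c else 0 :: ennreal) = c"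
  using sums_single[of 0 "\<lambda>_. c"] by (simp add: sums_iff eq_commute)

text \<open>Functions live on the whole space, but \<open>P_pos\<close> inspects them only on
  \<open>K\<close>. Thus \<open>P\<close> depends only on values on \<open>K\<close>, and the
  measure constructed from it is concentrated there.\<close>

locale positive_functional =
  fixes K :: "'a::metric_space set" and P :: "('a \<Rightarrow> real) \<Rightarrow> real"
  assumes compact_K: "compact K"
    and P_add: "f \<in> bcontfun \<Longrightarrow> g \<in> bcontfun \<Longrightarrow> P (\<lambda>x. f x + g x) = P f + P g"
    and P_scale: "f \<in> bcontfun \<Longrightarrow> P (\<lambda>x. c * f x) = c * P f"
    and P_pos: "f \<in> bcontfun \<Longrightarrow> (\<And>x. x \<in> K \<Longrightarrow> 0 \<le> f x) \<Longrightarrow> 0 \<le> P f"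
begin

lemma P_diff: "f \<in> bcontfun \<Longrightarrow> g \<in> bcontfun \<Longrightarrow> P (\<lambda>x. f x - g x) = P f - P g"
  using P_add[of f "\<lambda>x. (-1) * g x"] P_scale[of g "-1"]
  by (simp add: bcontfun_mult const_bcontfun uminus_cont)

lemma P_mono:
  assumes "f \<in> bcontfun" "g \<in> bcontfun" "\<And>x. x \<in> K \<Longrightarrow> f x \<le> g x"
  shows "P f \<le> P g"
  using P_pos[of "\<lambda>x. g x - f x"] P_diff[of g f] assms by (simp add: bcontfun_diff)

lemma P_zero: "P (\<lambda>x. 0) = 0"
  using P_scale[of "\<lambda>x. 0" 0] by (simp add: const_bcontfun)

lemma P_const: "P (\<lambda>x. c) = c * P (\<lambda>x. 1)"
  using P_scale[of "\<lambda>x. 1" c] by (simp add: const_bcontfun)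

lemma P_sum:
  assumes "\<And>i. i \<in> I \<Longrightarrow> f i \<in> bcontfun"
  shows "P (\<lambda>x. \<Sum>i\<in>I. f i x) = (\<Sum>i\<in>I. P (f i))"
  using assms by (induction I rule: infinite_finite_induct) (auto simp: P_zero P_add bcontfun_sum)

section \<open>The Daniell outer measure of a positive functional\<close>

definition covers :: "(nat \<Rightarrow> 'a \<Rightarrow> real) \<Rightarrow> 'a set \<Rightarrow> bool" where
  "covers g A \<longleftrightarrow> (\<forall>n. g n \<in> bcontfun \<and> (\<forall>x. 0 \<le> g n x)) \<and> (\<forall>x\<in>A \<inter> K. 1 \<le> (\<Sum>n. ennreal (g n x)))"

text \<open>Indicators are dominated by countable sums of continuous functions instead of sets being
  approximated by open sets. Countable subadditivity then only requires merging sequences.\<close>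

definition outer :: "'a set \<Rightarrow> ennreal" where
  "outer A = (INF g\<in>{g. covers g A}. \<Sum>n. ennreal (P (g n)))"

lemma outer_le: "covers g A \<Longrightarrow> outer A \<le> (\<Sum>n. ennreal (P (g n)))"
  unfolding outer_def by (intro INF_lower) simp

lemma outer_close:
  assumes "outer A < c"
  shows "\<exists>g. covers g A \<and> (\<Sum>n. ennreal (P (g n))) < c"
  using assms unfolding outer_def INF_less_iff by auto

lemma outer_le_single:
  assumes "f \<in> bcontfun" "\<And>x. 0 \<le> f x" "\<And>x. x \<in> A \<inter> K \<Longrightarrow> 1 \<le> f x"
  shows "outer A \<le> ennreal (P f)"
proof -
  let ?g = "\<lambda>n::nat. if n = 0 then f else (\<lambda>x. 0)"
  have "ennreal (?g n x) = (if n = 0 then ennreal (f x) else 0)" for n x by simp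
  moreover have "ennreal (P (?g n)) = (if n = 0 then ennreal (P f) else 0)" for n by (simp add: P_zero)
  ultimately have "covers ?g A" "(\<Sum>n. ennreal (P (?g n))) = ennreal (P f)"
    using assms suminf_ennreal_single unfolding covers_def by (auto simp: const_bcontfun)
  then show ?thesis using outer_le by metis
qed

lemma outer_mono: "A \<subseteq> B \<Longrightarrow> outer A \<le> outer B"
  unfolding outer_def covers_def by (intro INF_superset_mono) auto

lemma outer_disjoint: "A \<inter> K = {} \<Longrightarrow> outer A = 0"
  using outer_le_single[of "\<lambda>x. 0" A] by (simp add: const_bcontfun P_zero)

text \<open>Near-optimal covers of the \<open>A n\<close>, with errors \<open>e / 2^(n+1)\<close>,
  are merged into one sequence by \<open>prod_decode\<close>; double sums in \<open>ennreal\<close>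
  may be rearranged freely.\<close>

lemma outer_countably_subadditive: "outer (\<Union>i. A i) \<le> (\<Sum>n. outer (A n))" for A :: "nat \<Rightarrow> 'a set"
proof (rule ennreal_le_epsilon)
  fix e :: real assume e: "0 < e" "(\<Sum>n. outer (A n)) < top"
  then have "outer (A n) < outer (A n) + e * (1/2)^Suc n" for n
    by (auto simp add: less_top dest!: ennreal_suminf_lessD)
  then have "\<exists>g. covers g (A n) \<and> (\<Sum>k. ennreal (P (g k))) < outer (A n) + e * (1/2)^Suc n" for n
    by (rule outer_close)
  then obtain B where B: "\<And>n. covers (B n) (A n)"
    and Ble: "\<And>n. (\<Sum>k. ennreal (P (B n k))) < outer (A n) + e * (1/2)^Suc n"
    by metis
  define C where "C = case_prod B o prod_decode"
  have "covers C (\<Union>i. A i)"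
    unfolding covers_def
  proof (intro conjI allI ballI)
    fix n show "C n \<in> bcontfun" "0 \<le> C n x" for x
      using B unfolding C_def covers_def by (auto simp: split_def)
  next
    fix x assume "x \<in> (\<Union>i. A i) \<inter> K"
    then obtain i where i: "x \<in> A i \<inter> K" by blast
    have "1 \<le> (\<Sum>k. ennreal (B i k x))" using B[of i] i by (auto simp: covers_def)
    also have "\<dots> \<le> (\<Sum>n. \<Sum>k. ennreal (B n k x))"
      using sum_le_suminf[of "\<lambda>n. \<Sum>k. ennreal (B n k x)" "{i}"] by simp
    also have "\<dots> = (\<Sum>n. ennreal (C n x))"
      using suminf_ennreal_2dimen[of "\<lambda>n. \<Sum>k. ennreal (B n k x)" "\<lambda>(n, k). ennreal (B n k x)"]
      by (simp add: C_def split_def)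
    finally show "1 \<le> (\<Sum>n. ennreal (C n x))" .
  qed
  then have "outer (\<Union>i. A i) \<le> (\<Sum>n. ennreal (P (C n)))" by (rule outer_le)
  also have "\<dots> = (\<Sum>n. \<Sum>k. ennreal (P (B n k)))"
    using suminf_ennreal_2dimen[of "\<lambda>n. \<Sum>k. ennreal (P (B n k))" "\<lambda>(n, k). ennreal (P (B n k))"]
    by (simp add: C_def split_def)
  also have "\<dots> \<le> (\<Sum>n. outer (A n) + e * (1/2) ^ Suc n)"
    using Ble by (intro suminf_le) (auto intro: less_imp_le)
  also have "\<dots> = (\<Sum>n. outer (A n)) + (\<Sum>n. ennreal e * ennreal ((1/2) ^ Suc n))"
    using \<open>0 < e\<close> by (subst suminf_add[symmetric])
      (auto simp del: ennreal_suminf_cmult simp add: ennreal_mult[symmetric])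
  also have "\<dots> = (\<Sum>n. outer (A n)) + e"
    unfolding ennreal_suminf_cmult
    by (subst suminf_ennreal_eq[OF zero_le_power power_half_series]) auto
  finally show "outer (\<Union>i. A i) \<le> (\<Sum>n. outer (A n)) + e" .
qed

lemma outer_measure_space_outer: "outer_measure_space (Pow UNIV) outer"
  unfolding outer_measure_space_def positive_def increasing_def countably_subadditive_def
  using outer_disjoint outer_mono outer_countably_subadditive by auto

lemma outer_subadditive: "outer (A \<union> B) \<le> outer A + outer B"
proof -
  have "subadditive (Pow UNIV) outer"
    using outer_measure_space_outer unfolding outer_measure_space_def
    by (intro ring_of_sets.countably_subadditive_subadditive[OF
          algebra.axioms(1)[OF algebra_Pow]]) auto
  then have "outer (A \<union> (B - A)) \<le> outer A + outer (B - A)"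
    unfolding subadditive_def by blast
  also have "\<dots> \<le> outer A + outer B" by (intro add_left_mono outer_mono) auto
  finally show ?thesis by simp
qed

text \<open>An open set splits a cover \<open>g\<close> of \<open>A\<close>: with continuous \<open>h\<^sub>k\<close> increasing to the indicator of
  \<open>U\<close>, the functions \<open>g\<^sub>n (h\<^sub>k\<^sub>+\<^sub>1 - h\<^sub>k)\<close> cover \<open>A \<inter> U\<close>, and \<open>g\<^sub>n (1 - h\<^sub>k)\<close> cover \<open>A - U\<close> for any choice
  of \<open>k\<close> depending on \<open>n\<close>.\<close>

lemma outer_split_open:
  assumes U: "open U"
  shows "outer (A \<inter> U) + outer (A - U) \<le> outer A"
proof (cases "U = UNIV")
  \<comment> \<open>This case is separate because \<open>infdist\<close> to the empty set is 0, so
    the functions \<open>h k\<close> below would vanish identically.\<close>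
  case True then show ?thesis using outer_disjoint[of "{}"] by simp
next
  case False
  define h where "h = (\<lambda>(k::nat) x. min 1 (real k * infdist x (- U)))"
  have h_b: "h k \<in> bcontfun" for k
    unfolding h_def by (intro bcontfunI[of _ 1]) (auto intro!: continuous_intros simp: infdist_nonneg)
  have h_ge: "0 \<le> h k x" and h_le: "h k x \<le> 1" for k x by (auto simp: h_def infdist_nonneg)
  have h_mono: "h k x \<le> h (Suc k) x" for k x
    unfolding h_def by (intro min.mono order_refl mult_right_mono) (auto simp: infdist_nonneg)
  have h_out: "h k x = 0" if "x \<notin> U" for k x using that by (simp add: h_def)
  have h_lim: "(\<lambda>k. h k x) \<longlonglongrightarrow> 1" if "x \<in> U" for x
  proof -
    have "infdist x (- U) > 0"
      using that U False by (intro infdist_pos_not_in_closed) auto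
    then obtain k0 :: nat where k0: "1 < real k0 * infdist x (- U)"
      using reals_Archimedean3 by blast
    have "h k x = 1" if "k \<ge> k0" for k
    proof -
      have "real k0 * infdist x (- U) \<le> real k * infdist x (- U)"
        using that by (intro mult_right_mono) (auto simp: infdist_nonneg)
      then show ?thesis using k0 by (simp add: h_def)
    qed
    then show ?thesis by (intro tendsto_eventually) (auto simp: eventually_sequentially)
  qed
  show ?thesis
  proof (rule ennreal_le_epsilon)
    fix e :: real assume e: "0 < e" and fin: "outer A < top"
    then have "outer A < outer A + ennreal (e / 2)" by (auto simp: less_top)
    then obtain g where g: "covers g A" and gle: "(\<Sum>n. ennreal (P (g n))) < outer A + ennreal (e/2)"
      using outer_close by blast
    have g_b: "g n \<in> bcontfun" and g_ge: "0 \<le> g n x" for n x using g by (auto simp: covers_def)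
    have gh_b: "(\<lambda>x. g n x * h k x) \<in> bcontfun" for n k by (rule bcontfun_mult[OF g_b h_b])
    have gh_le: "P (\<lambda>x. g n x * h k x) \<le> P (g n)" for n k
      by (intro P_mono gh_b g_b) (simp add: g_ge h_le h_ge mult_left_le)
    have gh_inc: "incseq (\<lambda>k. P (\<lambda>x. g n x * h k x))" for n
      by (intro incseq_SucI P_mono gh_b mult_left_mono h_mono g_ge)
    have "\<exists>L. (\<lambda>k. P (\<lambda>x. g n x * h k x)) \<longlonglongrightarrow> L" for n
      using incseq_convergent[OF gh_inc, of n "P (g n)"] gh_le by metis
    then obtain q where q: "\<And>n. (\<lambda>k. P (\<lambda>x. g n x * h k x)) \<longlonglongrightarrow> q n" by metis
    have q_ge: "0 \<le> q n" for n
      by (rule LIMSEQ_le_const[OF q]) (auto intro!: P_pos gh_b mult_nonneg_nonneg g_ge h_ge)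
    \<comment> \<open>The cover of \<open>A - U\<close> may stop at a stage depending on
      \<open>n\<close>. Its errors sum to \<open>e / 2\<close>; the other half of \<open>e\<close>
      was spent on choosing \<open>g\<close>.\<close>
    have "\<exists>k. q n - P (\<lambda>x. g n x * h k x) < e / 2 * (1/2)^Suc n" for n
    proof -
      have "\<forall>\<^sub>F k in sequentially. dist (P (\<lambda>x. g n x * h k x)) (q n) < e / 2 * (1/2)^Suc n"
        by (rule tendstoD[OF q]) (use e in simp)
      then obtain k where "dist (P (\<lambda>x. g n x * h k x)) (q n) < e / 2 * (1/2)^Suc n"
        using eventually_happens'[OF sequentially_bot] by blast
      then show ?thesis unfolding dist_real_def by (intro exI[of _ k]) linarith
    qed
    then obtain k where k: "\<And>n. q n - P (\<lambda>x. g n x * h (k n) x) < e / 2 * (1/2)^Suc n" by metis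
    define B where "B = (\<lambda>n j x. g n x * h (Suc j) x - g n x * h j x)"
    have B_b: "B n j \<in> bcontfun" for n j unfolding B_def by (intro bcontfun_diff gh_b)
    have B_ge: "0 \<le> B n j x" for n j x
      unfolding B_def using mult_left_mono[OF h_mono g_ge] by simp
    define C where "C = case_prod B o prod_decode"
    have "covers C (A \<inter> U)"
      unfolding covers_def
    proof (intro conjI allI ballI)
      fix n show "C n \<in> bcontfun" "0 \<le> C n x" for x
        using B_b B_ge unfolding C_def by (auto simp: split_def)
    next
      fix x assume x: "x \<in> A \<inter> U \<inter> K"
      have "(\<lambda>j. B n j x) sums (g n x * 1 - g n x * h 0 x)" for n
        unfolding B_def using x by (intro telescope_sums tendsto_mult tendsto_const h_lim) auto
      then have "(\<lambda>j. B n j x) sums g n x" for n by (simp add: h_def)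
      then have "(\<Sum>j. ennreal (B n j x)) = ennreal (g n x)" for n
        by (intro suminf_ennreal_eq B_ge)
      moreover have "(\<Sum>n. ennreal (C n x)) = (\<Sum>n. \<Sum>j. ennreal (B n j x))"
        using suminf_ennreal_2dimen[of "\<lambda>n. \<Sum>k. ennreal (B n k x)" "\<lambda>(n, k). ennreal (B n k x)"]
        by (simp add: C_def split_def)
      ultimately show "1 \<le> (\<Sum>n. ennreal (C n x))" using g x by (auto simp: covers_def)
    qed
    then have "outer (A \<inter> U) \<le> (\<Sum>n. ennreal (P (C n)))" by (rule outer_le)
    also have "\<dots> = (\<Sum>n. \<Sum>j. ennreal (P (B n j)))"
      using suminf_ennreal_2dimen[of "\<lambda>n. \<Sum>k. ennreal (P (B n k))" "\<lambda>(n, k). ennreal (P (B n k))"]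
      by (simp add: C_def split_def)
    also have "\<dots> = (\<Sum>n. ennreal (q n))"
    proof (rule suminf_cong)
      fix n
      \<comment> \<open>The numbers \<open>P (B n j)\<close> telescope to \<open>q n\<close> by
        definition of \<open>q\<close>, so \<open>P\<close> never has to be exchanged with a
        pointwise limit. The first term drops out because \<open>h 0 = 0\<close>.\<close>
      have "(\<lambda>j. P (B n j)) sums (q n - P (\<lambda>x. g n x * h 0 x))"
        unfolding B_def by (subst P_diff[OF gh_b gh_b]) (intro telescope_sums q)
      then have "(\<lambda>j. P (B n j)) sums q n" by (simp add: h_def P_zero)
      then show "(\<Sum>j. ennreal (P (B n j))) = ennreal (q n)"
        by (intro suminf_ennreal_eq P_pos B_b B_ge)
    qed
    finally have in_le: "outer (A \<inter> U) \<le> (\<Sum>n. ennreal (q n))" .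
    let ?D = "\<lambda>n x. g n x - g n x * h (k n) x"
    have D_b: "?D n \<in> bcontfun" for n by (intro bcontfun_diff g_b gh_b)
    have D_ge: "0 \<le> ?D n x" for n x
      using mult_left_mono[OF h_le[of "k n" x] g_ge[of n x]] by simp
    have "covers ?D (A - U)"
      using g D_b D_ge unfolding covers_def by (auto simp: h_out)
    then have "outer (A - U) \<le> (\<Sum>n. ennreal (P (?D n)))" by (rule outer_le)
    with in_le have "outer (A \<inter> U) + outer (A - U) \<le> (\<Sum>n. ennreal (q n)) + (\<Sum>n. ennreal (P (?D n)))"
      by (rule add_mono)
    also have "\<dots> = (\<Sum>n. ennreal (q n) + ennreal (P (?D n)))" by (subst suminf_add) auto
    also have "\<dots> \<le> (\<Sum>n. ennreal (P (g n)) + ennreal (e / 2 * (1/2)^Suc n))"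
    proof (rule suminf_le)
      fix n
      have "q n + P (?D n) \<le> P (g n) + e / 2 * (1/2)^Suc n"
        using k[of n] by (simp add: P_diff[OF g_b gh_b])
      moreover have "0 \<le> P (g n)" "0 \<le> P (?D n)" by (auto intro!: P_pos g_b g_ge D_b D_ge)
      ultimately show "ennreal (q n) + ennreal (P (?D n)) \<le> ennreal (P (g n)) + ennreal (e / 2 * (1/2)^Suc n)"
        using q_ge[of n] e by (simp add: ennreal_leI del: ennreal_plus flip: ennreal_plus)
    qed auto
    also have "\<dots> = (\<Sum>n. ennreal (P (g n))) + (\<Sum>n. ennreal (e/2) * ennreal ((1/2) ^ Suc n))"
      using \<open>0 < e\<close> by (subst suminf_add[symmetric])
        (auto simp del: ennreal_suminf_cmult simp add: ennreal_mult[symmetric])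
    also have "\<dots> = (\<Sum>n. ennreal (P (g n))) + ennreal (e/2)"
      unfolding ennreal_suminf_cmult
      by (subst suminf_ennreal_eq[OF zero_le_power power_half_series]) auto
    also have "\<dots> \<le> outer A + ennreal (e/2) + ennreal (e/2)"
      using gle by (intro add_right_mono) auto
    also have "\<dots> = outer A + ennreal e"
      using e by (simp add: add.assoc flip: ennreal_plus)
    finally show "outer (A \<inter> U) + outer (A - U) \<le> outer A + ennreal e" .
  qed
qed

section \<open>The Borel measure and the identification of its integral\<close>

definition riesz_measure :: "'a measure" where
  "riesz_measure = measure_of UNIV (sets borel) outer"

text \<open>Open sets satisfy Caratheodory's criterion by \<open>outer_split_open\<close>, so the
  sigma algebra of the measurable sets contains all Borel sets.\<close>

lemma borel_measure_space_outer: "measure_space UNIV (sets borel) outer"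
proof -
  interpret Pow: sigma_algebra "UNIV :: 'a set" "Pow UNIV" by (rule sigma_algebra_Pow)
  have ms: "measure_space UNIV (lambda_system UNIV (Pow UNIV) outer) outer"
    by (rule Pow.caratheodory_lemma[OF outer_measure_space_outer])
  then interpret L: sigma_algebra UNIV "lambda_system UNIV (Pow UNIV) outer"
    by (simp add: measure_space_def)
  have "{S. open S} \<subseteq> lambda_system UNIV (Pow UNIV) outer"
  proof (safe, simp only: Pow.lambda_system_eq, safe)
    fix U x :: "'a set" assume "open U"
    moreover have "outer x \<le> outer (x \<inter> U) + outer (x - U)"
      using outer_subadditive[of "x \<inter> U" "x - U"] by (simp add: Int_Diff_Un)
    ultimately show "outer (x \<inter> U) + outer (x - U) = outer x"
      using outer_split_open by (intro antisym) auto
  qed simp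
  then have "sets (borel :: 'a measure) \<subseteq> lambda_system UNIV (Pow UNIV) outer"
    using L.sigma_sets_subset[of "{S. open S}"] by (simp add: borel_def)
  then show ?thesis
    using ms sets.sigma_algebra_axioms[of borel] by (intro measure_down[OF ms]) auto
qed

lemma sets_riesz_measure [simp, measurable_cong]: "sets riesz_measure = sets borel"
  by (simp add: riesz_measure_def sigma_algebra.sigma_sets_eq[OF sets.sigma_algebra_axioms[of borel, simplified]])

lemma space_riesz_measure [simp]: "space riesz_measure = UNIV"
  by (simp add: riesz_measure_def)

lemma emeasure_riesz_measure: "A \<in> sets borel \<Longrightarrow> emeasure riesz_measure A = outer A"
  unfolding riesz_measure_def using borel_measure_space_outer
  by (intro emeasure_measure_of_sigma) (auto simp: measure_space_def)

lemma emeasure_riesz_measure_outside: "emeasure riesz_measure (- K) = 0"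
  using compact_K by (subst emeasure_riesz_measure) (auto intro!: outer_disjoint dest: compact_imp_closed)

text \<open>Dini's theorem turns a pointwise covering of \<open>K\<close> by infinitely many functions into an almost
  covering by finitely many.\<close>

lemma emeasure_riesz_measure_UNIV: "emeasure riesz_measure UNIV = ennreal (P (\<lambda>x. 1))"
proof (subst emeasure_riesz_measure, simp, rule antisym)
  show "outer UNIV \<le> ennreal (P (\<lambda>x. 1))" by (rule outer_le_single) (auto simp: const_bcontfun)
  have P1: "0 \<le> P (\<lambda>x. 1)" by (rule P_pos) (auto simp: const_bcontfun)
  show "ennreal (P (\<lambda>x. 1)) \<le> outer UNIV"
    unfolding outer_def
  proof (rule INF_greatest, rule ennreal_le_epsilon)
    fix g and e :: real assume "g \<in> {g. covers g UNIV}" and e: "0 < e"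
    then have g: "covers g UNIV" by simp
    have g_b: "g n \<in> bcontfun" and g_ge: "0 \<le> g n x" for n x using g by (auto simp: covers_def)
    have c: "continuous_on UNIV (\<lambda>x. \<Sum>n<N. g n x)" for N
      using g_b bcontfun_cont by (intro continuous_on_sum) auto
    \<comment> \<open>Lowering the covering level from 1 to \<open>1 - d\<close> costs
      \<open>d * P (\<lambda>x. 1)\<close>, which is at most \<open>e\<close>; the summand 1 in the
      denominator guards against zero mass.\<close>
    define d where "d = e / (P (\<lambda>x. 1) + 1)"
    have d: "d > 0" "d * P (\<lambda>x. 1) \<le> e" using e P1 by (auto simp: d_def field_simps)
    define V where "V = (\<lambda>N. {x. (\<Sum>n<N. g n x) > 1 - d})"
    have V_mono: "V N \<subseteq> V M" if "N \<le> M" for N M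
    proof -
      have "(\<Sum>n<N. g n x) \<le> (\<Sum>n<M. g n x)" for x
        using that g_ge by (intro sum_mono2) auto
      then show ?thesis unfolding V_def by (auto intro: less_le_trans)
    qed
    have "open (V N)" for N
      unfolding V_def using c by (intro open_Collect_less) auto
    moreover have "K \<subseteq> (\<Union>N\<in>UNIV. V N)"
    proof
      fix x assume "x \<in> K"
      then have "1 \<le> (\<Sum>n. ennreal (g n x))" using g by (auto simp: covers_def)
      moreover have "ennreal (1 - d) < 1" using d by (simp add: ennreal_lessI flip: ennreal_1)
      ultimately have "ennreal (1 - d) < (SUP N. \<Sum>n<N. ennreal (g n x))"
        unfolding suminf_eq_SUP by (rule less_le_trans[rotated])
      then obtain N where "ennreal (1 - d) < (\<Sum>n<N. ennreal (g n x))" by (auto simp: less_SUP_iff)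
      then have "ennreal (1 - d) < ennreal (\<Sum>n<N. g n x)" by (simp add: g_ge)
      then have "1 - d < (\<Sum>n<N. g n x)"
        using ennreal_leI[of "\<Sum>n<N. g n x" "1 - d"] by (meson leD not_le)
      then show "x \<in> (\<Union>N\<in>UNIV. V N)" by (auto simp: V_def)
    qed
    ultimately obtain C where C: "finite C" "K \<subseteq> (\<Union>N\<in>C. V N)"
      using compactE_image[OF compact_K, of UNIV V] by metis
    obtain M where "\<forall>N\<in>C. N \<le> M" using C(1) finite_nat_set_iff_bounded_le by blast
    then have KM: "K \<subseteq> V M" using C(2) V_mono by blast
    have "P (\<lambda>x. 1 - d) \<le> P (\<lambda>x. \<Sum>n<M. g n x)"
      using KM g_b by (intro P_mono const_bcontfun bcontfun_sum) (auto simp: V_def)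
    also have "\<dots> = (\<Sum>n<M. P (g n))" using g_b by (intro P_sum)
    finally have "P (\<lambda>x. 1) \<le> (\<Sum>n<M. P (g n)) + e"
      using d(2) by (subst (asm) P_const) (simp add: algebra_simps)
    then have "ennreal (P (\<lambda>x. 1)) \<le> ennreal (\<Sum>n<M. P (g n)) + ennreal e"
      using e P_pos[OF g_b g_ge] by (subst ennreal_plus[symmetric]) (auto intro!: sum_nonneg ennreal_leI)
    also have "ennreal (\<Sum>n<M. P (g n)) = (\<Sum>n<M. ennreal (P (g n)))"
      using P_pos[OF g_b g_ge] by simp
    also have "\<dots> \<le> (\<Sum>n. ennreal (P (g n)))" by (intro sum_le_suminf) auto
    finally show "ennreal (P (\<lambda>x. 1)) \<le> (\<Sum>n. ennreal (P (g n))) + ennreal e" by simp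
  qed
qed

lemma finite_riesz_measure: "finite_measure riesz_measure"
  by (rule finite_measureI) (simp add: emeasure_riesz_measure_UNIV)

text \<open>The interval from 0 to \<open>t\<close> is cut at the multiples of \<open>d\<close>;
  each summand is the part lying in one slice. This is a layer-cake decomposition with continuous
  layers.\<close>

lemma slice_sum: "(\<Sum>j<J. min (max (t - real j * d) 0) d) = min t (real J * d)" if "0 \<le> t" "0 < d"
proof (induction J)
  case (Suc J)
  then show ?case using that by (auto simp: min_def max_def algebra_simps)
qed (use that in auto)

text \<open>Each continuous slice of \<open>f\<close> is compared with the set where it is full.
  That set bounds the next slice from above, so summation loses only one slice of height
  \<open>d\<close>. The bound suffices in one direction, because the total mass is known
  exactly.\<close>

lemma nn_integral_riesz_measure_le:
  assumes f: "f \<in> bcontfun" and f_ge: "\<And>x. 0 \<le> f x"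
  shows "(\<integral>\<^sup>+x. ennreal (f x) \<partial>riesz_measure) \<le> ennreal (P f)"
proof (rule ennreal_le_epsilon)
  fix e :: real assume e: "0 < e"
  have P1: "0 \<le> P (\<lambda>x. 1)" by (rule P_pos) (auto simp: const_bcontfun)
  define d where "d = e / (P (\<lambda>x. 1) + 1)"
  have d: "d > 0" "d * P (\<lambda>x. 1) \<le> e" using e P1 by (auto simp: d_def field_simps)
  obtain M where M: "\<And>x. f x \<le> M" using f by (metis abs_le_D1 bcontfun_norm_bound real_norm_def)
  obtain J :: nat where "M < real J * d" using reals_Archimedean3[OF d(1)] by blast
  then have J: "f x \<le> real J * d" for x using M[of x] by linarith
  define s where "s = (\<lambda>j x. min (max (f x - real j * d) 0) d)"
  have s_b: "s j \<in> bcontfun" for j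
    unfolding s_def using bcontfun_cont[OF f] d
    by (intro bcontfunI[of _ d]) (auto intro!: continuous_intros)
  \<comment> \<open>Slice \<open>J\<close> is zero. Including it lets slice 0 be split off while the
    sum over \<open>Suc j\<close> still has \<open>J\<close> terms.\<close>
  have s_sum: "(\<Sum>j<J. s j x) = f x" and s_sum': "(\<Sum>j<Suc J. s j x) = f x" for x
  proof -
    show "(\<Sum>j<J. s j x) = f x" unfolding s_def slice_sum[OF f_ge d(1)] using J[of x] by simp
    show "(\<Sum>j<Suc J. s j x) = f x"
      unfolding s_def slice_sum[OF f_ge d(1)] using J[of x] d by (simp add: algebra_simps)
  qed
  \<comment> \<open>On \<open>S j\<close> slice \<open>j\<close> has its full height
    \<open>d\<close>, so \<open>s j / d\<close> covers \<open>S j\<close>; off \<open>S j\<close>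
    slice \<open>Suc j\<close> vanishes.\<close>
  define S where "S = (\<lambda>j. {x. real (Suc j) * d \<le> f x})"
  have S_meas: "S j \<in> sets borel" for j
    unfolding S_def using bcontfun_cont[OF f] by (intro borel_closed closed_Collect_le) auto
  have S_le: "ennreal d * outer (S j) \<le> ennreal (P (s j))" for j
  proof -
    have "outer (S j) \<le> ennreal (P (\<lambda>x. 1 / d * s j x))"
    proof (rule outer_le_single)
      show "(\<lambda>x. 1 / d * s j x) \<in> bcontfun" by (intro bcontfun_mult const_bcontfun s_b)
    qed (use d in \<open>auto simp: s_def S_def field_simps\<close>)
    also have "\<dots> = ennreal (P (s j) / d)" using P_scale[OF s_b, of "1 / d" j] by simp
    finally have "ennreal d * outer (S j) \<le> ennreal d * ennreal (P (s j) / d)" by (rule mult_left_mono) simp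
    then show ?thesis using d by (simp flip: ennreal_mult')
  qed
  have "f x \<le> d + (\<Sum>j<J. d * indicator (S j) x)" for x
  proof -
    have "s (Suc j) x \<le> d * indicator (S j) x" for j
      using d by (auto simp: s_def S_def indicator_def algebra_simps)
    then have "(\<Sum>j<J. s (Suc j) x) \<le> (\<Sum>j<J. d * indicator (S j) x)" by (intro sum_mono)
    moreover have "s 0 x \<le> d" by (simp add: s_def)
    moreover have "f x = s 0 x + (\<Sum>j<J. s (Suc j) x)"
      using s_sum'[of x] by (simp only: sum.lessThan_Suc_shift)
    ultimately show ?thesis by linarith
  qed
  then have "(\<integral>\<^sup>+x. ennreal (f x) \<partial>riesz_measure)
      \<le> (\<integral>\<^sup>+x. ennreal (d + (\<Sum>j<J. d * indicator (S j) x)) \<partial>riesz_measure)"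
    by (intro nn_integral_mono ennreal_leI)
  also have "\<dots> = (\<integral>\<^sup>+x. ennreal d + (\<Sum>j<J. ennreal d * indicator (S j) x) \<partial>riesz_measure)"
  proof (rule nn_integral_cong)
    fix x
    have "ennreal (d * indicator (S j) x) = ennreal d * indicator (S j) x" for j
      using d(1) by (simp add: indicator_def)
    then show "ennreal (d + (\<Sum>j<J. d * indicator (S j) x)) = ennreal d + (\<Sum>j<J. ennreal d * indicator (S j) x)"
      using d(1) by (subst ennreal_plus) (simp_all add: sum_nonneg flip: sum_ennreal del: sum_mult_indicator)
  qed
  also have "\<dots> = ennreal d * emeasure riesz_measure UNIV + (\<Sum>j<J. ennreal d * outer (S j))"
    using S_meas by (subst nn_integral_add)
      (simp_all add: nn_integral_sum nn_integral_cmult_indicator emeasure_riesz_measure del: sum_mult_indicator)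
  also have "\<dots> \<le> ennreal e + (\<Sum>j<J. ennreal (P (s j)))"
  proof (intro add_mono sum_mono S_le)
    show "ennreal d * emeasure riesz_measure UNIV \<le> ennreal e"
      using d P1 by (simp add: emeasure_riesz_measure_UNIV ennreal_leI flip: ennreal_mult')
  qed
  also have "(\<Sum>j<J. ennreal (P (s j))) = ennreal (\<Sum>j<J. P (s j))"
    using d by (intro sum_ennreal P_pos s_b) (auto simp: s_def)
  also have "(\<Sum>j<J. P (s j)) = P f"
    using P_sum[of "{..<J}" s] s_b by (simp add: s_sum)
  finally show "(\<integral>\<^sup>+x. ennreal (f x) \<partial>riesz_measure) \<le> ennreal (P f) + ennreal e"
    by (simp add: add.commute)
qed

text \<open>The inequality for nonnegative functions is applied to \<open>M + f\<close> and to
  \<open>M - f\<close>. The constants cancel because the total mass is exactly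
  \<open>P (\<lambda>x. 1)\<close>, leaving both inequalities for \<open>f\<close>.\<close>

theorem integral_riesz_measure:
  assumes f: "f \<in> bcontfun"
  shows "integrable riesz_measure f" and "(LINT x|riesz_measure. f x) = P f"
proof -
  interpret finite_measure riesz_measure by (rule finite_riesz_measure)
  have int: "integrable riesz_measure g" if g: "g \<in> bcontfun" for g :: "'a \<Rightarrow> real"
  proof -
    obtain B where "\<And>x. norm (g x) \<le> B" using g bcontfun_norm_bound by blast
    moreover have "g \<in> borel_measurable riesz_measure"
      using borel_measurable_continuous_onI[OF bcontfun_cont[OF g]] by simp
    ultimately show ?thesis by (intro integrable_const_bound[of g B] AE_I2)
  qed
  show "integrable riesz_measure f" by (rule int[OF f])
  have le: "(LINT x|riesz_measure. g x) \<le> P g" if g: "g \<in> bcontfun" "\<And>x. 0 \<le> g x" for g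
  proof -
    have "ennreal (LINT x|riesz_measure. g x) = (\<integral>\<^sup>+x. ennreal (g x) \<partial>riesz_measure)"
      using g by (intro nn_integral_eq_integral[symmetric] int) auto
    also have "\<dots> \<le> ennreal (P g)" by (rule nn_integral_riesz_measure_le[OF g])
    finally show ?thesis using P_pos[OF g] by (simp add: ennreal_le_iff)
  qed
  have mass: "measure riesz_measure UNIV = P (\<lambda>x. 1)"
    using P_pos[of "\<lambda>x. 1"] by (simp add: measure_def emeasure_riesz_measure_UNIV const_bcontfun)
  obtain M where M: "\<And>x. \<bar>f x\<bar> \<le> M" using f by (metis bcontfun_norm_bound real_norm_def)
  have "(LINT x|riesz_measure. M + f x) \<le> P (\<lambda>x. M + f x)"
    using M by (intro le bcontfun_add const_bcontfun f) (smt (verit))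
  then have "(LINT x|riesz_measure. f x) \<le> P f"
    using int[OF f] by (simp add: P_add[OF const_bcontfun f] P_const[of M] mass)
  moreover have "(LINT x|riesz_measure. M - f x) \<le> P (\<lambda>x. M - f x)"
    using M by (intro le bcontfun_diff const_bcontfun f) (smt (verit))
  then have "P f \<le> (LINT x|riesz_measure. f x)"
    using int[OF f] by (simp add: P_diff[OF const_bcontfun f] P_const[of M] mass)
  ultimately show "(LINT x|riesz_measure. f x) = P f" by (rule antisym)
qed

end

section \<open>Mollification of Lipschitz functions\<close>

lemma C_k_Suc_differentiable: "C_k (Suc k) u \<Longrightarrow> u differentiable (at x)"
  by simp

lemma C_k_continuous: "C_k k u \<Longrightarrow> continuous_on UNIV u"
  by (cases k) (auto intro!: differentiable_imp_continuous_on simp: differentiable_on_def)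

lemma partial_eq_grad: "partial i u = (\<lambda>x. grad u x $ i)"
  by (simp add: grad_def)

lemma has_derivative_grad:
  assumes "u differentiable (at x)"
  shows "(u has_derivative (\<lambda>h. grad u x \<bullet> h)) (at x)"
proof -
  have d: "(u has_derivative frechet_derivative u (at x)) (at x)"
    using assms by (simp add: frechet_derivative_works)
  then have lin: "linear (frechet_derivative u (at x))" by (rule has_derivative_linear)
  have "frechet_derivative u (at x) h = grad u x \<bullet> h" for h
  proof -
    have "frechet_derivative u (at x) h = frechet_derivative u (at x) (\<Sum>i\<in>UNIV. (h $ i) *\<^sub>R axis i 1)"
      using basis_expansion[of h] by (simp add: scalar_mult_eq_scaleR)
    also have "\<dots> = grad u x \<bullet> h"
      by (simp add: linear_sum[OF lin] linear_scale[OF lin] inner_vec_def grad_def partial_def mult.commute)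
    finally show ?thesis .
  qed
  with d show ?thesis by (metis (no_types, lifting) ext)
qed

lemma partial_eqI: "(u has_derivative D) (at x) \<Longrightarrow> partial i u x = D (axis i 1)"
  unfolding partial_def by (metis frechet_derivative_at)

lemma grad_eqI: "(u has_derivative (\<lambda>h. v \<bullet> h)) (at x) \<Longrightarrow> grad u x = v"
  by (simp add: vec_eq_iff grad_def partial_eqI inner_axis)

lemma grad_add:
  assumes "u differentiable (at x)" "v differentiable (at x)"
  shows "grad (\<lambda>x. u x + v x) x = grad u x + grad v x"
  using has_derivative_add[OF assms[THEN has_derivative_grad]]
  by (intro grad_eqI) (simp add: inner_add_left)

lemma grad_scale:
  assumes "u differentiable (at x)"
  shows "grad (\<lambda>x. c * u x) x = c *\<^sub>R grad u x"
  using has_derivative_mult_right[OF has_derivative_grad[OF assms], of c]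
  by (intro grad_eqI) simp

lemma C_k_add: "C_k k u \<Longrightarrow> C_k k v \<Longrightarrow> C_k k (\<lambda>x. u x + v x)"
proof (induction k arbitrary: u v)
  case (Suc k)
  then have "partial i (\<lambda>x. u x + v x) = (\<lambda>x. partial i u x + partial i v x)" for i
    by (simp add: partial_eq_grad grad_add)
  with Suc show ?case by auto
qed (auto intro: continuous_intros)

lemma C_k_scale: "C_k k u \<Longrightarrow> C_k k (\<lambda>x. c * u x)"
proof (induction k arbitrary: u)
  case (Suc k)
  then have "partial i (\<lambda>x. c * u x) = (\<lambda>x. c * partial i u x)" for i
    by (simp add: partial_eq_grad grad_scale)
  with Suc show ?case by auto
qed (auto intro: continuous_intros)

text \<open>Smoothness follows without formulas for higher derivatives once a function lies in a
  class of differentiable functions that is stable under \<open>partial\<close>. Constants, bump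
  functions and convolutions are all treated this way.\<close>

lemma C_k_closed_family:
  assumes "\<And>u x. u \<in> F \<Longrightarrow> u differentiable (at x)" and "\<And>u i. u \<in> F \<Longrightarrow> partial i u \<in> F"
  shows "u \<in> F \<Longrightarrow> C_k k u"
proof (induction k arbitrary: u)
  case 0
  then show ?case using assms(1)
    by (auto intro!: differentiable_imp_continuous_on simp: differentiable_on_def)
qed (use assms in auto)

lemma continuous_on_grad: "C_k (Suc 0) u \<Longrightarrow> continuous_on UNIV (grad u)"
  unfolding grad_def by (intro continuous_on_vec_lambda) simp

lemma compact_supp_iff: "compact (supp u) \<longleftrightarrow> bounded {x. u x \<noteq> 0}"
proof -
  have "support_on UNIV u = {x. u x \<noteq> 0}" by (auto simp: support_on_def)
  then show ?thesis unfolding supp_def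
    by (simp add: compact_eq_bounded_closed) (meson bounded_closure bounded_subset closure_subset)
qed

lemma test_funs_add: "\<phi> \<in> test_funs \<Longrightarrow> \<psi> \<in> test_funs \<Longrightarrow> (\<lambda>x. \<phi> x + \<psi> x) \<in> test_funs"
  unfolding test_funs_def compact_supp_iff
  by (auto intro: C_k_add bounded_subset[OF bounded_Un[THEN iffD2], of "{x. \<phi> x \<noteq> 0}" "{x. \<psi> x \<noteq> 0}"])

lemma test_funs_scale: "\<phi> \<in> test_funs \<Longrightarrow> (\<lambda>x. c * \<phi> x) \<in> test_funs"
  unfolding test_funs_def compact_supp_iff
  by (auto intro: C_k_scale bounded_subset[of "{x. \<phi> x \<noteq> 0}"])

lemma C_k_const: "C_k k (\<lambda>x. c)"
proof (rule C_k_closed_family[of "range (\<lambda>c x. c)"])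
  show "partial i u \<in> range (\<lambda>c x. c)" if "u \<in> range (\<lambda>c x. c)" for u :: "real^'n \<Rightarrow> real" and i
    using that by (auto simp: partial_def image_iff intro!: exI[of _ 0])
qed auto

lemma test_funs_zero: "(\<lambda>x. 0) \<in> test_funs"
  by (simp add: test_funs_def C_k_const compact_supp_iff)

lemma test_funs_C_k: "\<phi> \<in> test_funs \<Longrightarrow> C_k k \<phi>"
  by (simp add: test_funs_def)

lemma test_funs_differentiable: "\<phi> \<in> test_funs \<Longrightarrow> \<phi> differentiable (at x)"
  using test_funs_C_k[of \<phi> 1] by simp

lemma test_funs_grad_continuous: "\<phi> \<in> test_funs \<Longrightarrow> continuous_on S (grad \<phi>)"
  using test_funs_C_k[of \<phi> 1] continuous_on_grad[of \<phi>] by (auto intro: continuous_on_subset)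

lemma lipschitz_grad_bound:
  fixes u :: "real ^ 'n \<Rightarrow> real"
  assumes lip: "C-lipschitz_on UNIV u" and d: "u differentiable (at x)"
  shows "norm (grad u x) \<le> C"
proof (rule ccontr)
  assume less: "\<not> ?thesis"
  \<comment> \<open>The difference quotient is taken in the direction of the gradient itself: its
    limit is \<open>h \<bullet> h\<close>, while the Lipschitz bound keeps it below
    \<open>C * norm h\<close>.\<close>
  define h where "h = grad u x"
  have hC: "C < norm h" and C: "0 \<le> C" using less lip by (auto simp: h_def lipschitz_on_def)
  have "((\<lambda>t. x + t *\<^sub>R h) has_derivative (\<lambda>t. t *\<^sub>R h)) (at 0)"
    by (auto intro!: derivative_eq_intros)
  moreover have "(u has_derivative (\<lambda>k. h \<bullet> k)) (at (x + 0 *\<^sub>R h))"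
    using has_derivative_grad[OF d] by (simp add: h_def)
  ultimately have "((\<lambda>t. u (x + t *\<^sub>R h)) has_derivative (\<lambda>t. h \<bullet> (t *\<^sub>R h))) (at 0)"
    by (rule has_derivative_compose)
  then have "((\<lambda>t. u (x + t *\<^sub>R h)) has_field_derivative (h \<bullet> h)) (at 0)"
    unfolding has_field_derivative_def by (rule has_derivative_eq_rhs) (simp add: fun_eq_iff)
  then have "((\<lambda>t. (u (x + t *\<^sub>R h) - u x) / t) \<longlongrightarrow> h \<bullet> h) (at 0)"
    by (simp add: has_field_derivative_iff)
  moreover have "\<forall>\<^sub>F t in at 0. (u (x + t *\<^sub>R h) - u x) / t \<le> C * norm h"
  proof (rule always_eventually, rule allI)
    fix t :: real
    have "\<bar>u (x + t *\<^sub>R h) - u x\<bar> \<le> C * (\<bar>t\<bar> * norm h)"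
      using lipschitz_onD[OF lip, of "x + t *\<^sub>R h" x] by (simp add: dist_norm)
    then have "\<bar>(u (x + t *\<^sub>R h) - u x) / t\<bar> \<le> C * norm h"
      using C by (cases "t = 0") (auto simp: abs_divide field_simps)
    then show "(u (x + t *\<^sub>R h) - u x) / t \<le> C * norm h" by linarith
  qed
  ultimately have "h \<bullet> h \<le> C * norm h" by (intro tendsto_upperbound) auto
  then have "norm h * norm h \<le> C * norm h" by (simp add: power2_norm_eq_inner[symmetric] power2_eq_square)
  then show False using hC C by (auto simp: mult_le_cancel_right)
qed

section \<open>Smooth bump functions\<close>

definition flat :: "nat \<Rightarrow> real \<Rightarrow> real" where
  "flat m t = (if t > 0 then exp (- 1 / t) / t ^ m else 0)"

lemma flat_right_limit: "(flat m \<longlongrightarrow> 0) (at_right 0)"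
proof -
  have "((\<lambda>t. inverse t ^ m / exp (inverse t)) \<longlongrightarrow> (0::real)) (at_right 0)"
    by (rule filterlim_compose[OF tendsto_power_div_exp_0 filterlim_inverse_at_top_right])
  moreover have "\<forall>\<^sub>F t in at_right 0. inverse t ^ m / exp (inverse t) = flat m t"
    unfolding eventually_at_right_field
    by (intro exI[of _ 1]) (auto simp: flat_def exp_minus field_simps)
  ultimately show ?thesis by (rule Lim_transform_eventually)
qed

text \<open>The powers of \<open>t\<close> in the denominator are built into \<open>flat\<close> so
  that the family is closed under differentiation up to linear combinations.\<close>

lemma DERIV_flat: "(flat m has_field_derivative flat (m + 2) t - real m * flat (Suc m) t) (at t)"
proof -
  consider "t > 0" | "t < 0" | "t = 0" by linarith
  then show ?thesis
  proof cases
    case 1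
    have "((\<lambda>t. exp (- 1 / t) / t ^ m) has_field_derivative flat (m + 2) t - real m * flat (Suc m) t) (at t)"
    proof (rule DERIV_cong)
      have "((\<lambda>t. exp (- 1 / t)) has_field_derivative exp (- 1 / t) * (1 / t\<^sup>2)) (at t)"
        using 1 by (auto intro!: derivative_eq_intros simp: power2_eq_square)
      then show "((\<lambda>t. exp (- 1 / t) / t ^ m) has_field_derivative
          (exp (- 1 / t) * (1 / t\<^sup>2) * t ^ m - exp (- 1 / t) * (real m * t ^ (m - Suc 0))) / (t ^ m * t ^ m)) (at t)"
        using 1 by (intro DERIV_divide DERIV_pow) auto
      show "(exp (- 1 / t) * (1 / t\<^sup>2) * t ^ m - exp (- 1 / t) * (real m * t ^ (m - Suc 0))) / (t ^ m * t ^ m)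
          = flat (m + 2) t - real m * flat (Suc m) t"
        using 1 by (cases m) (auto simp: flat_def field_simps power2_eq_square)
    qed
    then show ?thesis
      by (rule DERIV_cong_ev[OF refl _ refl, THEN iffD1, rotated])
        (use 1 in \<open>auto simp: flat_def intro!: eventually_mono[OF eventually_nhds_in_open[of "{0<..}"]]\<close>)
  next
    case 2
    have "((\<lambda>t. 0) has_field_derivative flat (m + 2) t - real m * flat (Suc m) t) (at t)"
      using 2 by (simp add: flat_def)
    then show ?thesis
      by (rule DERIV_cong_ev[OF refl _ refl, THEN iffD1, rotated])
        (use 2 in \<open>auto simp: flat_def intro!: eventually_mono[OF eventually_nhds_in_open[of "{..<0}"]]\<close>)
  next
    case 3
    \<comment> \<open>At the origin the difference quotient from the right is
      \<open>flat (Suc m)\<close>, which tends to 0; from the left it is identically 0.\<close>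
    have "((\<lambda>s. flat m s / s) \<longlongrightarrow> 0) (at 0)"
    proof (subst filterlim_at_split, intro conjI)
      show "((\<lambda>s. flat m s / s) \<longlongrightarrow> 0) (at_left 0)"
        by (intro tendsto_eventually) (auto simp: eventually_at_left_field flat_def intro!: exI[of _ "-1"])
      have "\<forall>\<^sub>F s in at_right 0. flat (Suc m) s = flat m s / s"
        unfolding eventually_at_right_field by (intro exI[of _ 1]) (auto simp: flat_def)
      with flat_right_limit show "((\<lambda>s. flat m s / s) \<longlongrightarrow> 0) (at_right 0)"
        by (rule Lim_transform_eventually)
    qed
    then show ?thesis using 3 by (simp add: has_field_derivative_iff flat_def)
  qed
qed

text \<open>The chain rule applied to \<open>r - x \<bullet> x\<close> produces coordinates as
  factors. Closing under sums and products therefore gives a class stable under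
  \<open>partial\<close>, as \<open>C_k_closed_family\<close> requires.\<close>

inductive_set flat_algebra :: "real \<Rightarrow> (real ^ 'n \<Rightarrow> real) set" for r where
  const: "(\<lambda>x. c) \<in> flat_algebra r"
| coord: "(\<lambda>x. x $ i) \<in> flat_algebra r"
| flat: "(\<lambda>x. flat m (r - x \<bullet> x)) \<in> flat_algebra r"
| add: "u \<in> flat_algebra r \<Longrightarrow> v \<in> flat_algebra r \<Longrightarrow> (\<lambda>x. u x + v x) \<in> flat_algebra r"
| mult: "u \<in> flat_algebra r \<Longrightarrow> v \<in> flat_algebra r \<Longrightarrow> (\<lambda>x. u x * v x) \<in> flat_algebra r"

lemma flat_algebra_derivative:
  fixes u :: "real ^ 'n \<Rightarrow> real"
  assumes "u \<in> flat_algebra r"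
  shows "\<exists>D. (\<forall>x. (u has_derivative D x) (at x)) \<and> (\<forall>i. (\<lambda>x. D x (axis i 1)) \<in> flat_algebra r)"
  using assms
proof induction
  case (const c)
  show ?case by (rule exI[of _ "\<lambda>x h. 0"]) (auto intro: flat_algebra.const)
next
  case (coord i)
  have "((\<lambda>x. x $ i) has_derivative (\<lambda>h. h $ i)) (at x)" for x :: "real ^ 'n"
    by (rule bounded_linear_imp_has_derivative) (rule bounded_linear_vec_nth)
  then show ?case
    by (intro exI[of _ "\<lambda>x h. h $ i"]) (auto intro: flat_algebra.const)
next
  case (flat m)
  \<comment> \<open>The derivative is written with sums and products only, so that its value on
    \<open>axis i 1\<close> has the shape of the introduction rules of
    \<open>flat_algebra\<close>.\<close>
  let ?D = "\<lambda>(x :: real ^ 'n) h. (flat (m + 2) (r - x \<bullet> x) + (- real m) * flat (Suc m) (r - x \<bullet> x)) * (- 2 * (x \<bullet> h))"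
  have "((\<lambda>x. flat m (r - x \<bullet> x)) has_derivative ?D x) (at x)" for x :: "real ^ 'n"
  proof -
    have "((\<lambda>x. r - x \<bullet> x) has_derivative (\<lambda>h. - 2 * (x \<bullet> h))) (at x)"
      by (auto intro!: derivative_eq_intros simp: inner_commute)
    from has_derivative_compose[OF this DERIV_flat[of m, unfolded has_field_derivative_def]]
    show ?thesis by simp
  qed
  moreover have "(\<lambda>x. ?D x (axis i 1)) \<in> flat_algebra r" for i
    by (simp only: inner_axis inner_real_def mult_1_right)
      (intro flat_algebra.intros)
  ultimately show ?case by (intro exI[of _ ?D] conjI allI)
next
  case (add u v)
  then obtain D E where D: "\<And>x. (u has_derivative D x) (at x)" "\<And>i. (\<lambda>x. D x (axis i 1)) \<in> flat_algebra r"
    and E: "\<And>x. (v has_derivative E x) (at x)" "\<And>i. (\<lambda>x. E x (axis i 1)) \<in> flat_algebra r"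
    by blast
  then show ?case
    by (intro exI[of _ "\<lambda>x h. D x h + E x h"]) (auto intro: has_derivative_add flat_algebra.add)
next
  case (mult u v)
  then obtain D E where D: "\<And>x. (u has_derivative D x) (at x)" "\<And>i. (\<lambda>x. D x (axis i 1)) \<in> flat_algebra r"
    and E: "\<And>x. (v has_derivative E x) (at x)" "\<And>i. (\<lambda>x. E x (axis i 1)) \<in> flat_algebra r"
    by blast
  then show ?case using mult.hyps
    by (intro exI[of _ "\<lambda>x h. u x * E x h + D x h * v x"] conjI allI
        flat_algebra.add flat_algebra.mult has_derivative_mult)
qed

lemma C_k_flat: "C_k k (\<lambda>x. flat m (r - x \<bullet> x))"
proof (rule C_k_closed_family[OF _ _ flat_algebra.flat])
  fix u :: "real ^ 'n \<Rightarrow> real" assume "u \<in> flat_algebra r"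
  then obtain D where D: "\<And>x. (u has_derivative D x) (at x)" "\<And>i. (\<lambda>x. D x (axis i 1)) \<in> flat_algebra r"
    using flat_algebra_derivative by blast
  then show "u differentiable (at x)" for x by (auto simp: differentiable_def)
  have "partial i u = (\<lambda>x. D x (axis i 1))" for i using partial_eqI[OF D(1)] by blast
  with D(2) show "partial i u \<in> flat_algebra r" for i by simp
qed

section \<open>Convolution and mollifiers\<close>

definition convolve :: "(real ^ 'n \<Rightarrow> real) \<Rightarrow> (real ^ 'n \<Rightarrow> real) \<Rightarrow> real ^ 'n \<Rightarrow> real" where
  "convolve \<psi> u x = (LINT y|lborel. \<psi> (x - y) * u y)"

lemma integral_lborel_compact_support:
  fixes w :: "'a::euclidean_space \<Rightarrow> real"
  assumes w: "continuous_on UNIV w" and out: "\<And>y. y \<notin> S \<Longrightarrow> w y = 0" and S: "compact S"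
  shows "integrable lborel w" and "(LINT y|lborel. w y) = integral S w"
proof -
  have eq: "(\<lambda>y. indicator S y *\<^sub>R w y) = w" using out by (auto simp: indicator_def fun_eq_iff)
  have "integrable lborel (\<lambda>y. indicator S y *\<^sub>R w y)"
    using S w by (intro borel_integrable_compact) (auto intro: continuous_on_subset)
  then show "integrable lborel w" "(LINT y|lborel. w y) = integral S w"
    using set_borel_integral_eq_integral(2)[of S w]
    unfolding set_integrable_def set_lebesgue_integral_def eq by simp_all
qed

text \<open>The variable \<open>x\<close> occurs only in \<open>\<psi>\<close>, so differentiation
  under the integral asks no more of \<open>u\<close> than continuity. As \<open>u\<close> vanishes
  off a fixed box, the integral runs over that box and Leibniz' rule applies.\<close>

lemma convolve_derivative:
  fixes \<psi> u :: "real ^ 'n \<Rightarrow> real"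
  assumes \<psi>: "C_k (Suc 0) \<psi>" and u: "continuous_on UNIV u" and out: "\<And>y. y \<notin> cbox a b \<Longrightarrow> u y = 0"
  shows "convolve \<psi> u differentiable (at x)" and "partial i (convolve \<psi> u) x = convolve (partial i \<psi>) u x"
proof -
  have c: "continuous_on UNIV (grad \<psi>)" "continuous_on UNIV \<psi>"
    using \<psi> continuous_on_grad C_k_continuous by blast+
  have cshift: "continuous_on UNIV (\<lambda>y. w (x - y) * u y)" if "continuous_on UNIV w" for w :: "real ^ 'n \<Rightarrow> real" and x
    using u by (intro continuous_intros continuous_on_compose2[OF that]) auto
  have conv: "convolve w u x = integral (cbox a b) (\<lambda>y. w (x - y) * u y)" if "continuous_on UNIV w" for w x
    unfolding convolve_def using out by (intro integral_lborel_compact_support cshift that) auto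
  \<comment> \<open>The derivative in \<open>x\<close> is bundled as a bounded linear map, the form
    in which Leibniz' rule integrates it; evaluation at \<open>axis i 1\<close> recovers the partial
    derivative.\<close>
  define F where "F = (\<lambda>x t. u t *\<^sub>R blinfun_inner_left (grad \<psi> (x - t)))"
  have cF: "continuous_on (UNIV \<times> cbox a b) (\<lambda>(x, t). F x t)"
    unfolding F_def split_def
    by (intro continuous_intros bounded_linear.continuous_on[OF bounded_linear_blinfun_inner_left]
        continuous_on_compose2[OF c(1)] continuous_on_compose2[OF u]) auto
  have "((\<lambda>x. integral (cbox a b) (\<lambda>t. \<psi> (x - t) * u t)) has_derivative
      blinfun_apply (integral (cbox a b) (F x))) (at x within UNIV)"
  proof (rule leibniz_rule[OF _ _ cF])
    fix x t :: "real ^ 'n"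
    have "((\<lambda>x. x - t) has_derivative (\<lambda>h. h)) (at x)" by (auto intro!: derivative_eq_intros)
    from has_derivative_compose[OF this has_derivative_grad[OF C_k_Suc_differentiable[OF \<psi>]]]
    have "((\<lambda>x. \<psi> (x - t) * u t) has_derivative (\<lambda>h. (grad \<psi> (x - t) \<bullet> h) * u t)) (at x)"
      by (rule has_derivative_mult_left)
    then show "((\<lambda>x. \<psi> (x - t) * u t) has_derivative blinfun_apply (F x t)) (at x within UNIV)"
      by (rule has_derivative_eq_rhs) (simp add: F_def blinfun.scaleR_left inner_commute mult.commute fun_eq_iff)
  next
    show "(\<lambda>t. \<psi> (x - t) * u t) integrable_on cbox a b" for x
      by (intro integrable_continuous continuous_on_subset[OF cshift[OF c(2)]]) auto
  qed auto
  moreover have "convolve \<psi> u = (\<lambda>x. integral (cbox a b) (\<lambda>t. \<psi> (x - t) * u t))"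
    using conv[OF c(2)] by blast
  ultimately have D: "(convolve \<psi> u has_derivative blinfun_apply (integral (cbox a b) (F x))) (at x)"
    by simp
  then show "convolve \<psi> u differentiable (at x)" by (auto simp: differentiable_def)
  have cp: "continuous_on UNIV (partial i \<psi>)"
    unfolding partial_eq_grad by (intro continuous_intros c)
  have "F x integrable_on cbox a b"
    by (intro integrable_continuous continuous_on_compose2[OF cF, of _ "\<lambda>t. (x, t)", simplified] continuous_intros) auto
  then have "blinfun_apply (integral (cbox a b) (F x)) (axis i 1) = integral (cbox a b) (\<lambda>t. partial i \<psi> (x - t) * u t)"
    by (simp add: blinfun_apply_integral) (simp add: F_def blinfun.scaleR_left inner_axis' partial_eq_grad mult.commute)
  also have "\<dots> = convolve (partial i \<psi>) u x" by (simp add: conv[OF cp])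
  finally show "partial i (convolve \<psi> u) x = convolve (partial i \<psi>) u x" by (simp add: partial_eqI[OF D])
qed

lemma C_k_convolve:
  fixes \<psi> u :: "real ^ 'n \<Rightarrow> real"
  assumes "\<And>k. C_k k \<psi>" and u: "continuous_on UNIV u" and out: "\<And>y. y \<notin> cbox a b \<Longrightarrow> u y = 0"
  shows "C_k k (convolve \<psi> u)"
proof (rule C_k_closed_family[of "(\<lambda>\<psi>. convolve \<psi> u) ` {\<psi>. \<forall>k. C_k k \<psi>}"])
  show "convolve \<psi> u \<in> (\<lambda>\<psi>. convolve \<psi> u) ` {\<psi>. \<forall>k. C_k k \<psi>}" using assms by blast
next
  fix v assume "v \<in> (\<lambda>\<psi>. convolve \<psi> u) ` {\<psi>. \<forall>k. C_k k \<psi>}"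
  then obtain \<eta> where v: "v = convolve \<eta> u" and \<eta>: "\<And>k. C_k k \<eta>" by auto
  show "v differentiable (at x)" for x unfolding v by (rule convolve_derivative[OF \<eta> u out])
  have "partial i v = convolve (partial i \<eta>) u" for i
    unfolding v using convolve_derivative(2)[OF \<eta> u out] by blast
  moreover have "C_k k (partial i \<eta>)" for k i using \<eta>[of "Suc k"] by simp
  ultimately show "partial i v \<in> (\<lambda>\<psi>. convolve \<psi> u) ` {\<psi>. \<forall>k. C_k k \<psi>}" for i by blast
qed

text \<open>Lebesgue measure is invariant under \<open>z \<mapsto> x - z\<close>. After the
  substitution \<open>x\<close> occurs only in \<open>u\<close>, so Lipschitz estimates of
  \<open>u\<close> pass directly to the convolution.\<close>

lemma convolve_commute:
  fixes \<psi> u :: "real ^ 'n \<Rightarrow> real"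
  assumes "continuous_on UNIV \<psi>" "continuous_on UNIV u"
  shows "convolve \<psi> u x = (LINT z|lborel. \<psi> z * u (x - z))"
proof -
  have "lborel = distr lborel borel (\<lambda>z. x + (-1) *\<^sub>R z)"
    using lborel_affine[of "-1" x] by (simp add: density_1)
  then have "convolve \<psi> u x = (LINT y|distr lborel borel (\<lambda>z. x - z). \<psi> (x - y) * u y)"
    unfolding convolve_def by simp
  also have "\<dots> = (LINT z|lborel. \<psi> (x - (x - z)) * u (x - z))"
    using assms by (intro integral_distr borel_measurable_continuous_onI)
      (auto intro!: continuous_intros borel_measurable_continuous_onI intro: continuous_on_compose2)
  finally show ?thesis by simp
qed

text \<open>The bump \<open>flat 0 (\<epsilon>\<^sup>2 - x \<bullet> x)\<close> is positive exactly
  on the open ball of radius \<open>\<epsilon>\<close>. Its integral is therefore positive, and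
  dividing by it normalises the bump.\<close>

lemma mollifier_exists:
  assumes "\<epsilon> > 0"
  obtains \<psi> :: "real ^ 'n \<Rightarrow> real"
  where "\<And>k. C_k k \<psi>" "\<And>x. 0 \<le> \<psi> x" "\<And>x. \<epsilon> < norm x \<Longrightarrow> \<psi> x = 0" "(LINT x|lborel. \<psi> x) = 1"
proof -
  define b where "b = (\<lambda>x :: real ^ 'n. flat 0 (\<epsilon>\<^sup>2 - x \<bullet> x))"
  have C: "C_k k b" for k unfolding b_def by (rule C_k_flat)
  have ge: "0 \<le> b x" for x by (simp add: b_def flat_def)
  have pos: "0 < b x \<longleftrightarrow> norm x < \<epsilon>" for x
  proof -
    have "x \<bullet> x < \<epsilon>\<^sup>2 \<longleftrightarrow> norm x < \<epsilon>"
      using assms by (simp add: norm_lt_square)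
    then show ?thesis by (simp add: b_def flat_def)
  qed
  have out: "b x = 0" if "x \<notin> cball 0 \<epsilon>" for x using that pos[of x] ge[of x] by (simp add: not_less)
  have int: "integrable lborel b"
    by (rule integral_lborel_compact_support(1)[OF C_k_continuous[OF C] out compact_cball])
  have Z: "0 < (LINT x|lborel. b x)"
  proof (rule ccontr)
    assume "\<not> ?thesis"
    moreover have "0 \<le> (LINT x|lborel. b x)" using ge by (intro integral_nonneg_AE) auto
    ultimately have "(LINT x|lborel. b x) = 0" by linarith
    then have "AE x in lborel. b x = 0"
      using integral_nonneg_eq_0_iff_AE[OF int] ge by simp
    then have "AE x in lborel. x \<notin> ball (0 :: real ^ 'n) \<epsilon>"
      by eventually_elim (use pos in force)
    then have "emeasure lborel (ball (0 :: real ^ 'n) \<epsilon>) = 0"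
      by (subst (asm) AE_iff_measurable[OF _ refl]) (auto simp: ball_def)
    then show False using content_ball_pos[OF assms, of "0 :: real ^ 'n"] by (simp add: measure_def)
  qed
  show ?thesis
  proof (rule that)
    let ?Z = "LINT x|lborel. b x"
    show "C_k k (\<lambda>x. inverse ?Z * b x)" for k by (rule C_k_scale[OF C])
    show "0 \<le> inverse ?Z * b x" for x using ge Z by simp
    show "inverse ?Z * b x = 0" if "\<epsilon> < norm x" for x using that out[of x] by simp
    show "(LINT x|lborel. inverse ?Z * b x) = 1" using Z by simp
  qed
qed

text \<open>The value \<open>v x\<close> is a weighted average of \<open>U\<close> over
  \<open>cball x \<epsilon>\<close>. Averaging preserves the Lipschitz constant and moves values by
  at most \<open>\<epsilon>\<close>. The last clause, that a locally constant value survives, is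
  what makes plateau functions available.\<close>

lemma lipschitz_smooth_approximation:
  fixes U :: "real ^ 'n \<Rightarrow> real"
  assumes lip: "1-lipschitz_on UNIV U" and bdd: "bounded {x. U x \<noteq> 0}" and "\<epsilon> > 0"
  shows "\<exists>v\<in>test_funs. (\<forall>x. norm (grad v x) \<le> 1) \<and> (\<forall>x. \<bar>v x - U x\<bar> \<le> \<epsilon>) \<and>
    (\<forall>x c. (\<forall>y\<in>cball x \<epsilon>. U y = c) \<longrightarrow> v x = c)"
proof -
  obtain \<psi> :: "real ^ 'n \<Rightarrow> real" where C: "\<And>k. C_k k \<psi>" and ge: "\<And>x. 0 \<le> \<psi> x"
    and out: "\<And>x. \<epsilon> < norm x \<Longrightarrow> \<psi> x = 0" and one: "(LINT x|lborel. \<psi> x) = 1"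
    using mollifier_exists[OF \<open>\<epsilon> > 0\<close>, where 'n='n] by metis
  obtain a b where ab: "{x. U x \<noteq> 0} \<subseteq> cbox a b" using bounded_subset_cbox_symmetric[OF bdd] by blast
  have U: "continuous_on UNIV U" using lip by (rule lipschitz_on_continuous_on)
  have \<psi>: "continuous_on UNIV \<psi>" by (rule C_k_continuous[OF C])
  define v where "v = convolve \<psi> U"
  have v: "v x = (LINT z|lborel. \<psi> z * U (x - z))" for x
    unfolding v_def by (rule convolve_commute[OF \<psi> U])
  have int: "integrable lborel (\<lambda>z. \<psi> z * w z)" if "continuous_on UNIV w" for w
    by (rule integral_lborel_compact_support(1)[where S = "cball 0 \<epsilon>"])
      (use out that \<psi> in \<open>auto intro!: continuous_intros\<close>)
  have cU: "continuous_on UNIV (\<lambda>z. U (x - z))" for x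
    by (intro continuous_on_compose2[OF U] continuous_intros) auto
  have average: "\<bar>LINT z|lborel. \<psi> z * w z\<bar> \<le> c"
    if "continuous_on UNIV w" "\<And>z. norm z \<le> \<epsilon> \<Longrightarrow> \<bar>w z\<bar> \<le> c" for w c
  proof -
    have "\<bar>LINT z|lborel. \<psi> z * w z\<bar> \<le> (LINT z|lborel. \<bar>\<psi> z * w z\<bar>)" by (rule integral_abs_bound)
    also have "\<dots> \<le> (LINT z|lborel. \<psi> z * c)"
    proof (rule integral_mono)
      show "integrable lborel (\<lambda>z. \<bar>\<psi> z * w z\<bar>)" by (intro integrable_abs int that)
      show "integrable lborel (\<lambda>z. \<psi> z * c)" by (intro int continuous_intros)
      show "\<bar>\<psi> z * w z\<bar> \<le> \<psi> z * c" for z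
        using that(2)[of z] out[of z] ge[of z] by (cases "norm z \<le> \<epsilon>") (auto simp: abs_mult mult_left_mono)
    qed
    also have "\<dots> = c" using one by simp
    finally show ?thesis .
  qed
  have diff: "(LINT z|lborel. \<psi> z * w z) - (LINT z|lborel. \<psi> z * w' z) = (LINT z|lborel. \<psi> z * (w z - w' z))"
    if "continuous_on UNIV w" "continuous_on UNIV w'" for w w'
    using int[OF that(1)] int[OF that(2)] by (simp add: right_diff_distrib)
  have "1-lipschitz_on UNIV v"
  proof (rule lipschitz_onI)
    fix x y
    have "\<bar>v x - v y\<bar> \<le> dist x y"
      unfolding v diff[OF cU cU]
    proof (rule average)
      show "continuous_on UNIV (\<lambda>z. U (x - z) - U (y - z))" by (intro continuous_intros cU)
      show "\<bar>U (x - z) - U (y - z)\<bar> \<le> dist x y" for z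
        using lipschitz_onD[OF lip, of "x - z" "y - z"] by (simp add: dist_norm)
    qed
    then show "dist (v x) (v y) \<le> 1 * dist x y" by (simp add: dist_real_def)
  qed simp
  moreover have vC: "C_k k v" for k
    unfolding v_def by (rule C_k_convolve[OF C U]) (use ab in blast)
  moreover have "v differentiable (at x)" for x using vC[of 1] by simp
  ultimately have "norm (grad v x) \<le> 1" for x by (intro lipschitz_grad_bound)
  moreover have "\<bar>v x - U x\<bar> \<le> \<epsilon>" for x
  proof -
    have "v x - U x = (LINT z|lborel. \<psi> z * (U (x - z) - U x))"
      using diff[OF cU continuous_on_const] one by (simp add: v)
    also have "\<bar>\<dots>\<bar> \<le> \<epsilon>"
    proof (rule average)
      show "continuous_on UNIV (\<lambda>z. U (x - z) - U x)" by (intro continuous_intros cU)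
      show "\<bar>U (x - z) - U x\<bar> \<le> \<epsilon>" if "norm z \<le> \<epsilon>" for z
        using lipschitz_onD[OF lip, of "x - z" x] that by (simp add: dist_norm)
    qed
    finally show ?thesis .
  qed
  moreover have "v x = c" if "\<forall>y\<in>cball x \<epsilon>. U y = c" for x c
  proof -
    have eq: "\<psi> z * U (x - z) = \<psi> z * c" for z
      using that out[of z] by (cases "norm z \<le> \<epsilon>") (auto simp: dist_norm)
    have "v x = (LINT z|lborel. \<psi> z * c)" unfolding v by (simp only: eq)
    then show ?thesis using one by simp
  qed
  moreover have "v \<in> test_funs"
  proof -
    obtain R where R: "\<And>x. U x \<noteq> 0 \<Longrightarrow> norm x \<le> R" using bdd by (auto simp: bounded_iff)
    have "norm x \<le> R + \<epsilon>" if "v x \<noteq> 0" for x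
    proof (rule ccontr)
      assume far: "\<not> ?thesis"
      have "\<psi> z * U (x - z) = 0" for z
        using out[of z] R[of "x - z"] norm_triangle_ineq2[of x z] far by (cases "norm z \<le> \<epsilon>") force+
      then have "(\<lambda>z. \<psi> z * U (x - z)) = (\<lambda>z. 0)" by blast
      then have "v x = 0" unfolding v by (simp only: integral_zero)
      with that show False ..
    qed
    then have "bounded {x. v x \<noteq> 0}" by (auto simp: bounded_iff)
    then show ?thesis using vC by (simp add: test_funs_def compact_supp_iff)
  qed
  ultimately show ?thesis by blast
qed

text \<open>A supremum of cones of slope one, cut off at height zero, extends \<open>u\<close> up to an additive
  constant and has compact support.\<close>

lemma lipschitz_extension_bounded_support:
  fixes \<Omega> :: "'a::real_normed_vector set" and u :: "'a \<Rightarrow> real"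
  assumes lip: "1-lipschitz_on \<Omega> u" and bdd: "bounded \<Omega>" and B: "\<And>y. y \<in> \<Omega> \<Longrightarrow> \<bar>u y\<bar> \<le> B"
  shows "\<exists>U. 1-lipschitz_on UNIV U \<and> bounded {x. U x \<noteq> 0} \<and> (\<forall>x\<in>\<Omega>. U x = u x + B)"
proof (cases "\<Omega> = {}")
  case True
  then show ?thesis by (intro exI[of _ "\<lambda>x. 0"]) (auto simp: lipschitz_on_def)
next
  case False
  define S where "S = (\<lambda>x. SUP y\<in>\<Omega>. u y + B - dist x y)"
  have bd: "bdd_above ((\<lambda>y. u y + B - dist x y) ` \<Omega>)" for x
  proof (rule bdd_aboveI2)
    fix y assume "y \<in> \<Omega>" then show "u y + B - dist x y \<le> 2 * B"
      using B[of y] zero_le_dist[of x y] by linarith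
  qed
  have Sle: "S x \<le> S y + dist x y" for x y
    unfolding S_def
  proof (rule cSUP_least[OF False])
    fix z assume "z \<in> \<Omega>"
    then have "u z + B - dist y z \<le> (SUP y'\<in>\<Omega>. u y' + B - dist y y')" by (rule cSUP_upper[OF _ bd])
    then show "u z + B - dist x z \<le> (SUP y'\<in>\<Omega>. u y' + B - dist y y') + dist x y"
      using dist_triangle[of y z x] by (simp add: dist_commute)
  qed
  \<comment> \<open>On \<open>\<Omega>\<close> the supremum equals \<open>u + B\<close>, which is
    nonnegative, so the cut-off changes nothing there. Every cone has height at most
    \<open>2 * B\<close>, so \<open>U\<close> vanishes beyond that distance from
    \<open>\<Omega>\<close>.\<close>
  define U where "U = (\<lambda>x. max 0 (S x))"
  have "1-lipschitz_on UNIV U"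
  proof (rule lipschitz_onI)
    fix x y show "dist (U x) (U y) \<le> 1 * dist x y"
      using Sle[of x y] Sle[of y x] zero_le_dist[of x y] unfolding U_def dist_real_def dist_commute[of y x]
      by (auto simp: max_def)
  qed simp
  moreover have "bounded {x. U x \<noteq> 0}"
  proof -
    obtain R where R: "\<And>y. y \<in> \<Omega> \<Longrightarrow> norm y \<le> R" using bdd by (auto simp: bounded_iff)
    have "norm x \<le> R + 2 * B" if "U x \<noteq> 0" for x
    proof (rule ccontr)
      assume far: "\<not> ?thesis"
      have "S x \<le> 0"
        unfolding S_def
      proof (rule cSUP_least[OF False])
        fix y assume "y \<in> \<Omega>"
        then show "u y + B - dist x y \<le> 0"
          using R[of y] B[of y] far norm_triangle_ineq2[of x y] by (simp add: dist_norm)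
      qed
      then show False using that by (simp add: U_def)
    qed
    then show ?thesis by (auto simp: bounded_iff)
  qed
  moreover have "U x = u x + B" if x: "x \<in> \<Omega>" for x
  proof -
    have "S x \<le> u x + B"
      unfolding S_def
    proof (rule cSUP_least[OF False])
      fix y assume "y \<in> \<Omega>"
      then show "u y + B - dist x y \<le> u x + B"
        using lipschitz_onD[OF lip, of y x] x by (simp add: dist_real_def dist_commute)
    qed
    moreover have "u x + B \<le> S x" unfolding S_def using cSUP_upper[OF x bd, of x] by simp
    ultimately show ?thesis using B[OF x] by (simp add: U_def)
  qed
  ultimately show ?thesis by blast
qed

lemma lipschitz_test_fun_sequence:
  fixes \<Omega> :: "(real ^ 'n) set" and u :: "real ^ 'n \<Rightarrow> real"
  assumes "1-lipschitz_on \<Omega> u" and "bounded \<Omega>" and "\<And>y. y \<in> \<Omega> \<Longrightarrow> \<bar>u y\<bar> \<le> c"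
  shows "\<exists>v. range v \<subseteq> test_funs \<and> (\<forall>n x. norm (grad (v n) x) \<le> 1) \<and>
    uniform_limit \<Omega> v (\<lambda>x. u x + c) sequentially"
proof -
  obtain U where U: "1-lipschitz_on UNIV U" "bounded {x. U x \<noteq> 0}" and eq: "\<And>x. x \<in> \<Omega> \<Longrightarrow> U x = u x + c"
    using lipschitz_extension_bounded_support[OF assms] by blast
  have "\<exists>v\<in>test_funs. (\<forall>x. norm (grad v x) \<le> 1) \<and> (\<forall>x. \<bar>v x - U x\<bar> \<le> inverse (real (Suc n)))" for n
    using lipschitz_smooth_approximation[OF U, of "inverse (real (Suc n))"] by auto
  then obtain v where v: "\<And>n. v n \<in> test_funs" "\<And>n x. norm (grad (v n) x) \<le> 1"
    "\<And>n x. \<bar>v n x - U x\<bar> \<le> inverse (real (Suc n))"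
    by metis
  have "uniform_limit \<Omega> v (\<lambda>x. u x + c) sequentially"
  proof (rule uniform_limitI)
    fix e :: real assume "e > 0"
    then obtain N where N: "inverse (real (Suc N)) < e" using reals_Archimedean by blast
    show "\<forall>\<^sub>F n in sequentially. \<forall>x\<in>\<Omega>. dist (v n x) (u x + c) < e"
    proof (intro eventually_sequentiallyI ballI)
      fix n x assume "N \<le> n" "x \<in> \<Omega>"
      have "dist (v n x) (u x + c) \<le> inverse (real (Suc n))"
        using v(3)[of n x] eq[OF \<open>x \<in> \<Omega>\<close>] by (simp add: dist_real_def)
      also have "\<dots> \<le> inverse (real (Suc N))" using \<open>N \<le> n\<close> by simp
      finally show "dist (v n x) (u x + c) < e" using N by linarith
    qed
  qed
  with v show ?thesis by blast
qed

text \<open>Constants are not compactly supported; multiples of a plateau function replace them on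
  \<open>\<Omega>\<close>.\<close>

lemma test_fun_plateau:
  fixes \<Omega> :: "(real ^ 'n) set"
  assumes "bounded \<Omega>"
  shows "\<exists>\<eta>\<in>test_funs. \<forall>x\<in>\<Omega>. \<eta> x = 1"
proof (cases "\<Omega> = {}")
  case True
  then show ?thesis using test_funs_zero by blast
next
  case False
  \<comment> \<open>\<open>U\<close> equals 1 up to distance 1 from \<open>\<Omega>\<close>, which
    is exactly the radius of the mollification below, so the value 1 on \<open>\<Omega>\<close>
    survives.\<close>
  define U where "U = (\<lambda>x :: real ^ 'n. max 0 (min 1 (2 - infdist x \<Omega>)))"
  have "1-lipschitz_on UNIV U"
  proof (rule lipschitz_onI)
    fix x y :: "real ^ 'n"
    show "dist (U x) (U y) \<le> 1 * dist x y"
      using infdist_triangle[of x \<Omega> y] infdist_triangle[of y \<Omega> x] zero_le_dist[of x y]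
      unfolding U_def dist_real_def dist_commute[of y x] by (auto simp: max_def min_def)
  qed simp
  moreover have "bounded {x. U x \<noteq> 0}"
  proof -
    obtain R where R: "\<And>y. y \<in> \<Omega> \<Longrightarrow> norm y \<le> R" using assms by (auto simp: bounded_iff)
    have "norm x \<le> R + 2" if "U x \<noteq> 0" for x
    proof -
      have "infdist x \<Omega> < 2" using that by (auto simp: U_def max_def min_def split: if_splits)
      then obtain y where "y \<in> \<Omega>" "dist x y < 2"
        using False by (auto simp: infdist_def cINF_less_iff)
      then show ?thesis using R[of y] norm_triangle_ineq2[of x y] by (simp add: dist_norm)
    qed
    then show ?thesis by (auto simp: bounded_iff)
  qed
  ultimately obtain v where v: "v \<in> test_funs"
    and const: "\<And>x c. (\<And>y. y \<in> cball x 1 \<Longrightarrow> U y = c) \<Longrightarrow> v x = c"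
    using lipschitz_smooth_approximation[of U 1] by (metis zero_less_one)
  have "v x = 1" if x: "x \<in> \<Omega>" for x
  proof (rule const)
    fix y assume "y \<in> cball x 1"
    then have "infdist y \<Omega> \<le> 1" using infdist_le[OF x, of y] by (simp add: dist_commute)
    then show "U y = 1" by (simp add: U_def)
  qed
  with v show ?thesis by blast
qed

section \<open>The pairing and the Kantorovich potential\<close>

lemma sup_norm_bdd_above: "compact \<Omega> \<Longrightarrow> continuous_on \<Omega> g \<Longrightarrow> bdd_above ((\<lambda>x. norm (g x)) ` \<Omega>)"
  by (intro bounded_imp_bdd_above compact_imp_bounded compact_continuous_image continuous_intros)

lemma sup_norm_upper:
  "compact \<Omega> \<Longrightarrow> continuous_on \<Omega> g \<Longrightarrow> x \<in> \<Omega> \<Longrightarrow> norm (g x) \<le> sup_norm \<Omega> g"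
  unfolding sup_norm_def by (rule cSUP_upper[OF _ sup_norm_bdd_above])

lemma sup_norm_least: "\<Omega> \<noteq> {} \<Longrightarrow> (\<And>x. x \<in> \<Omega> \<Longrightarrow> norm (g x) \<le> b) \<Longrightarrow> sup_norm \<Omega> g \<le> b"
  unfolding sup_norm_def by (rule cSUP_least)

lemma lipschitz_on_grad_bound:
  fixes u :: "real ^ 'n \<Rightarrow> real"
  assumes "convex S" and d: "\<And>x. x \<in> S \<Longrightarrow> u differentiable (at x)"
    and b: "\<And>x. x \<in> S \<Longrightarrow> norm (grad u x) \<le> C" and "0 \<le> C"
  shows "C-lipschitz_on S u"
proof (rule lipschitz_onI)
  fix x y assume xy: "x \<in> S" "y \<in> S"
  have "norm (u x - u y) \<le> C * norm (x - y)"
  proof (rule differentiable_bound[OF \<open>convex S\<close> _ _ xy])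
    fix z assume z: "z \<in> S"
    show "(u has_derivative (\<lambda>h. grad u z \<bullet> h)) (at z within S)"
      by (rule has_derivative_at_withinI[OF has_derivative_grad[OF d[OF z]]])
    show "onorm (\<lambda>h. grad u z \<bullet> h) \<le> C"
    proof (rule onorm_le)
      fix h
      have "\<bar>grad u z \<bullet> h\<bar> \<le> norm (grad u z) * norm h" by (rule Cauchy_Schwarz_ineq2)
      also have "\<dots> \<le> C * norm h" using b[OF z] by (rule mult_right_mono) simp
      finally show "norm (grad u z \<bullet> h) \<le> C * norm h" by simp
    qed
  qed
  then show "dist (u x) (u y) \<le> C * dist x y" by (simp add: dist_norm)
qed (rule \<open>0 \<le> C\<close>)

lemma approximates_uniform_limit: "approximates \<Omega> v u \<Longrightarrow> uniform_limit \<Omega> v u sequentially"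
  by (simp add: approximates_def)

text \<open>With \<open>\<Omega>\<close> nonempty, \<open>sup_norm\<close> is a genuine maximum of a
  continuous function. The empty set is handled separately by \<open>duality_empty\<close>.\<close>

locale sharp_functional =
  fixes \<Omega> :: "(real ^ 'n) set" and f :: "(real ^ 'n \<Rightarrow> real) \<Rightarrow> real"
  assumes compact: "compact \<Omega>" and nonempty: "\<Omega> \<noteq> {}" and f: "f \<in> X0_sharp \<Omega>"
begin

lemma f_add: "\<phi> \<in> test_funs \<Longrightarrow> \<psi> \<in> test_funs \<Longrightarrow> f (\<lambda>x. \<phi> x + \<psi> x) = f \<phi> + f \<psi>"
  using f by (auto simp: X0_sharp_def X0_def distribution_def)

lemma f_scale: "\<phi> \<in> test_funs \<Longrightarrow> f (\<lambda>x. c * \<phi> x) = c * f \<phi>"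
  using f by (auto simp: X0_sharp_def X0_def distribution_def)

lemma f_constant_on: "\<phi> \<in> test_funs \<Longrightarrow> \<phi> constant_on \<Omega> \<Longrightarrow> f \<phi> = 0"
  using f by (auto simp: X0_sharp_def X0_def)

text \<open>Membership in \<open>X0_sharp\<close> is exploited here: the gradient of the difference
  is only bounded, not small, so its coefficient has to be small.\<close>

lemma f_uniformly_continuous:
  assumes "0 < e"
  shows "\<exists>\<delta>>0. \<forall>\<phi>\<in>test_funs. \<forall>\<psi>\<in>test_funs. sup_norm \<Omega> (grad \<phi>) \<le> M \<longrightarrow> sup_norm \<Omega> (grad \<psi>) \<le> M \<longrightarrow>
    (\<forall>x\<in>\<Omega>. \<bar>\<phi> x - \<psi> x\<bar> \<le> \<delta>) \<longrightarrow> \<bar>f \<phi> - f \<psi>\<bar> \<le> e"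
proof -
  \<comment> \<open>The gradient of \<open>\<phi> - \<psi>\<close> is at most \<open>2 * M\<close>,
    so this choice limits its contribution to \<open>e / 2\<close>; distance
    \<open>e / (2 * C)\<close> does the same for the sup-norm term. Using
    \<open>\<bar>M\<bar> + 1\<close> keeps the denominator positive.\<close>
  define \<epsilon> where "\<epsilon> = e / (4 * (\<bar>M\<bar> + 1))"
  have \<epsilon>: "\<epsilon> > 0" using assms by (simp add: \<epsilon>_def)
  then obtain C where C: "C > 0" and est: "\<And>\<phi>. \<phi> \<in> test_funs \<Longrightarrow> \<bar>f \<phi>\<bar> \<le> C * sup_norm \<Omega> \<phi> + \<epsilon> * sup_norm \<Omega> (grad \<phi>)"
    using f unfolding X0_sharp_def by blast
  show ?thesis
  proof (intro exI[of _ "e / (2 * C)"] conjI ballI impI)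
    show "0 < e / (2 * C)" using assms C by simp
    fix \<phi> \<psi> assume \<phi>: "\<phi> \<in> test_funs" and \<psi>: "\<psi> \<in> test_funs"
      and M: "sup_norm \<Omega> (grad \<phi>) \<le> M" "sup_norm \<Omega> (grad \<psi>) \<le> M"
      and close: "\<forall>x\<in>\<Omega>. \<bar>\<phi> x - \<psi> x\<bar> \<le> e / (2 * C)"
    let ?d = "\<lambda>x. \<phi> x + (-1) * \<psi> x"
    have m\<psi>: "(\<lambda>x. (-1) * \<psi> x) \<in> test_funs" by (rule test_funs_scale[OF \<psi>])
    have d: "?d \<in> test_funs" by (rule test_funs_add[OF \<phi> m\<psi>])
    have g: "norm (grad ?d x) \<le> 2 * M" if "x \<in> \<Omega>" for x
    proof -
      have "grad ?d x = grad \<phi> x - grad \<psi> x"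
        by (subst grad_add[OF test_funs_differentiable[OF \<phi>] test_funs_differentiable[OF m\<psi>]],
            subst grad_scale[OF test_funs_differentiable[OF \<psi>]]) simp
      then show ?thesis
        using norm_triangle_ineq4[of "grad \<phi> x" "grad \<psi> x"] M
          sup_norm_upper[OF compact test_funs_grad_continuous[OF \<phi>] that]
          sup_norm_upper[OF compact test_funs_grad_continuous[OF \<psi>] that] by simp
    qed
    have "f \<phi> - f \<psi> = f ?d" using f_add[OF \<phi> m\<psi>] f_scale[OF \<psi>, of "-1"] by simp
    also have "\<bar>\<dots>\<bar> \<le> C * sup_norm \<Omega> ?d + \<epsilon> * sup_norm \<Omega> (grad ?d)" by (rule est[OF d])
    also have "\<dots> \<le> C * (e / (2 * C)) + \<epsilon> * (2 * M)"
      using close C \<epsilon> g by (intro add_mono mult_left_mono sup_norm_least nonempty) auto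
    also have "\<dots> \<le> C * (e / (2 * C)) + \<epsilon> * (2 * (\<bar>M\<bar> + 1))"
      using \<epsilon> by (intro add_left_mono mult_left_mono) auto
    also have "\<dots> = e" using C by (simp add: \<epsilon>_def field_simps)
    finally show "\<bar>f \<phi> - f \<psi>\<bar> \<le> e" .
  qed
qed

text \<open>The independent indices make this serve twice: with \<open>w = v\<close> it is the
  Cauchy property, and with two sequences it shows that the limit does not depend on the
  sequence.\<close>

lemma f_approximations_close:
  assumes v: "approximates \<Omega> v u" and w: "approximates \<Omega> w u" and e: "e > 0"
  shows "\<exists>N. \<forall>m\<ge>N. \<forall>n\<ge>N. \<bar>f (v m) - f (w n)\<bar> \<le> e"
proof -
  obtain A B where A: "\<And>n. sup_norm \<Omega> (grad (v n)) \<le> A" and B: "\<And>n. sup_norm \<Omega> (grad (w n)) \<le> B"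
    using v w by (auto simp: approximates_def bdd_above_def)
  have A': "sup_norm \<Omega> (grad (v n)) \<le> max A B" and B': "sup_norm \<Omega> (grad (w n)) \<le> max A B" for n
    using A[of n] B[of n] by auto
  have test: "v n \<in> test_funs" "w n \<in> test_funs" for n using v w by (auto simp: approximates_def)
  obtain \<delta> where \<delta>: "\<delta> > 0" and unif: "\<And>\<phi> \<psi>. \<phi> \<in> test_funs \<Longrightarrow> \<psi> \<in> test_funs \<Longrightarrow>
      sup_norm \<Omega> (grad \<phi>) \<le> max A B \<Longrightarrow> sup_norm \<Omega> (grad \<psi>) \<le> max A B \<Longrightarrow>
      (\<forall>x\<in>\<Omega>. \<bar>\<phi> x - \<psi> x\<bar> \<le> \<delta>) \<Longrightarrow> \<bar>f \<phi> - f \<psi>\<bar> \<le> e"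
    using f_uniformly_continuous[OF e, of "max A B"] by blast
  have "\<forall>\<^sub>F n in sequentially. \<forall>x\<in>\<Omega>. dist (v n x) (u x) < \<delta> / 2"
    "\<forall>\<^sub>F n in sequentially. \<forall>x\<in>\<Omega>. dist (w n x) (u x) < \<delta> / 2"
    using approximates_uniform_limit[OF v] approximates_uniform_limit[OF w] half_gt_zero[OF \<delta>]
    by (simp_all only: uniform_limitD)
  then obtain N1 N2 where N1: "\<And>n x. n \<ge> N1 \<Longrightarrow> x \<in> \<Omega> \<Longrightarrow> dist (v n x) (u x) < \<delta> / 2"
    and N2: "\<And>n x. n \<ge> N2 \<Longrightarrow> x \<in> \<Omega> \<Longrightarrow> dist (w n x) (u x) < \<delta> / 2"
    unfolding eventually_sequentially by metis
  show ?thesis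
  proof (intro exI[of _ "max N1 N2"] allI impI unif test A' B' ballI)
    fix m n x assume "max N1 N2 \<le> m" "max N1 N2 \<le> n" "x \<in> \<Omega>"
    then have "\<bar>v m x - u x\<bar> < \<delta> / 2" "\<bar>w n x - u x\<bar> < \<delta> / 2"
      using N1[of m x] N2[of n x] by (simp_all add: dist_real_def)
    then show "\<bar>v m x - w n x\<bar> \<le> \<delta>" by linarith
  qed
qed

text \<open>The given sequence also ensures uniqueness in the definition of \<open>pairing\<close>:
  without any approximating sequence, every number would satisfy its condition vacuously.\<close>

lemma pairing_limit:
  assumes v: "approximates \<Omega> v u"
  shows "(\<lambda>n. f (v n)) \<longlonglongrightarrow> pairing \<Omega> f u"
proof -
  have "Cauchy (\<lambda>n. f (v n))"
  proof (rule metric_CauchyI)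
    fix e :: real assume "e > 0"
    then obtain N where "\<forall>m\<ge>N. \<forall>n\<ge>N. \<bar>f (v m) - f (v n)\<bar> \<le> e / 2"
      using f_approximations_close[OF v v, of "e / 2"] by auto
    then show "\<exists>M. \<forall>m\<ge>M. \<forall>n\<ge>M. dist (f (v m)) (f (v n)) < e"
      using \<open>e > 0\<close> by (intro exI[of _ N]) (force simp: dist_real_def)
  qed
  then obtain l where l: "(\<lambda>n. f (v n)) \<longlonglongrightarrow> l" using Cauchy_convergent convergent_def by blast
  have all: "(\<lambda>n. f (w n)) \<longlonglongrightarrow> l" if w: "approximates \<Omega> w u" for w
  proof -
    have "(\<lambda>n. f (w n) - f (v n)) \<longlonglongrightarrow> 0"
    proof (rule LIMSEQ_I)
      fix r :: real assume "0 < r"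
      then obtain N where "\<forall>m\<ge>N. \<forall>n\<ge>N. \<bar>f (w m) - f (v n)\<bar> \<le> r / 2"
        using f_approximations_close[OF w v, of "r / 2"] by auto
      then show "\<exists>no. \<forall>n\<ge>no. norm (f (w n) - f (v n) - 0) < r"
        using \<open>0 < r\<close> by (intro exI[of _ N]) force
    qed
    from tendsto_add[OF this l] show ?thesis by simp
  qed
  have "pairing \<Omega> f u = l"
    unfolding pairing_def
  proof (rule the_equality)
    show "\<forall>v. approximates \<Omega> v u \<longrightarrow> (\<lambda>n. f (v n)) \<longlonglongrightarrow> l" using all by blast
    fix l' assume "\<forall>v. approximates \<Omega> v u \<longrightarrow> (\<lambda>n. f (v n)) \<longlonglongrightarrow> l'"
    then show "l' = l" using v l LIMSEQ_unique by blast
  qed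
  with l show ?thesis by simp
qed

lemma approximatesI:
  assumes "\<And>n. v n \<in> test_funs" "uniform_limit \<Omega> v u sequentially" "\<And>n x. x \<in> \<Omega> \<Longrightarrow> norm (grad (v n) x) \<le> C"
  shows "approximates \<Omega> v u"
  using assms sup_norm_least[OF nonempty, of "grad (v n)" C for n]
  unfolding approximates_def by (auto simp: bdd_above_def)

lemma pairing_test_fun:
  assumes "\<phi> \<in> test_funs"
  shows "pairing \<Omega> f \<phi> = f \<phi>"
proof -
  have "approximates \<Omega> (\<lambda>n. \<phi>) \<phi>"
    using assms by (intro approximatesI[of _ _ "sup_norm \<Omega> (grad \<phi>)"] uniform_limit_const)
      (auto intro!: sup_norm_upper compact test_funs_grad_continuous)
  from pairing_limit[OF this] show ?thesis by (simp add: LIMSEQ_const_iff)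
qed

text \<open>The constant is represented by \<open>c * \<eta>\<close> with a plateau function
  \<open>\<eta>\<close>; it is constant on \<open>\<Omega>\<close>, so \<open>f\<close> vanishes on
  it.\<close>

lemma pairing_add_const:
  assumes v: "approximates \<Omega> v u"
  shows "pairing \<Omega> f (\<lambda>x. u x + c) = pairing \<Omega> f u" "\<exists>w. approximates \<Omega> w (\<lambda>x. u x + c)"
proof -
  obtain \<eta> where \<eta>: "\<eta> \<in> test_funs" "\<And>x. x \<in> \<Omega> \<Longrightarrow> \<eta> x = 1"
    using test_fun_plateau[OF compact_imp_bounded[OF compact]] by blast
  have v_test: "v n \<in> test_funs" for n using v by (auto simp: approximates_def)
  have c\<eta>: "(\<lambda>x. c * \<eta> x) \<in> test_funs" by (rule test_funs_scale[OF \<eta>(1)])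
  obtain A where A: "\<And>n. sup_norm \<Omega> (grad (v n)) \<le> A"
    using v by (auto simp: approximates_def bdd_above_def)
  let ?w = "\<lambda>n x. v n x + c * \<eta> x"
  have w: "approximates \<Omega> ?w (\<lambda>x. u x + c)"
  proof (rule approximatesI)
    show "?w n \<in> test_funs" for n by (rule test_funs_add[OF v_test c\<eta>])
    have "uniform_limit \<Omega> (\<lambda>n x. v n x + c) (\<lambda>x. u x + c) sequentially"
      using v by (intro uniform_limit_add uniform_limit_const) (simp add: approximates_def)
    then show "uniform_limit \<Omega> ?w (\<lambda>x. u x + c) sequentially"
      by (rule uniform_limit_cong'[THEN iffD1, rotated 2]) (auto simp: \<eta>(2))
    show "norm (grad (?w n) x) \<le> A + sup_norm \<Omega> (grad (\<lambda>x. c * \<eta> x))" if "x \<in> \<Omega>" for n x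
    proof -
      have "grad (?w n) x = grad (v n) x + grad (\<lambda>x. c * \<eta> x) x"
        by (rule grad_add[OF test_funs_differentiable[OF v_test] test_funs_differentiable[OF c\<eta>]])
      then show ?thesis
        using norm_triangle_ineq[of "grad (v n) x" "grad (\<lambda>x. c * \<eta> x) x"] A[of n]
          sup_norm_upper[OF compact test_funs_grad_continuous[OF v_test] that]
          sup_norm_upper[OF compact test_funs_grad_continuous[OF c\<eta>] that]
        by (smt (verit))
    qed
  qed
  then show "\<exists>w. approximates \<Omega> w (\<lambda>x. u x + c)" by blast
  have "f (\<lambda>x. c * \<eta> x) = 0" using c\<eta> \<eta>(2) by (intro f_constant_on) (auto simp: constant_on_def)
  then have "f (?w n) = f (v n)" for n using f_add[OF v_test c\<eta>] by simp
  then have "(\<lambda>n. f (v n)) \<longlonglongrightarrow> pairing \<Omega> f (\<lambda>x. u x + c)" using pairing_limit[OF w] by simp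
  then show "pairing \<Omega> f (\<lambda>x. u x + c) = pairing \<Omega> f u"
    using pairing_limit[OF v] LIMSEQ_unique by blast
qed

lemma lipschitz_bounded:
  assumes "1-lipschitz_on \<Omega> u"
  shows "\<exists>c. \<forall>y\<in>\<Omega>. \<bar>u y\<bar> \<le> (c :: real)"
  using compact_imp_bounded[OF compact_continuous_image[OF lipschitz_on_continuous_on[OF assms] compact]]
  by (auto simp: bounded_iff)

text \<open>The sequence approximates the shifted function \<open>u + c\<close>, whose nonnegativity
  on \<open>\<Omega>\<close> permits a compactly supported extension with the same Lipschitz
  constant. Its limit is still the pairing of \<open>u\<close>, since shifts are invisible to
  \<open>f\<close>.\<close>

lemma lipschitz_approximation:
  assumes lip: "1-lipschitz_on \<Omega> u" and c: "\<And>y. y \<in> \<Omega> \<Longrightarrow> \<bar>u y\<bar> \<le> c"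
  shows "\<exists>v. approximates \<Omega> v (\<lambda>x. u x + c) \<and> (\<forall>n x. norm (grad (v n) x) \<le> 1) \<and>
    (\<lambda>n. f (v n)) \<longlonglongrightarrow> pairing \<Omega> f u"
proof -
  obtain v where v: "range v \<subseteq> test_funs" "\<And>n x. norm (grad (v n) x) \<le> 1"
    "uniform_limit \<Omega> v (\<lambda>x. u x + c) sequentially"
    using lipschitz_test_fun_sequence[OF lip compact_imp_bounded[OF compact] c] by blast
  then have ap: "approximates \<Omega> v (\<lambda>x. u x + c)" by (intro approximatesI[of _ _ 1]) auto
  have "pairing \<Omega> f (\<lambda>x. u x + c) = pairing \<Omega> f u"
    using pairing_add_const(1)[OF ap, of "- c"] by simp
  then show ?thesis using pairing_limit[OF ap] ap v(2) by metis
qed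

lemma pairing_shift:
  assumes lip: "1-lipschitz_on \<Omega> u"
  shows "pairing \<Omega> f (\<lambda>x. u x + c) = pairing \<Omega> f u"
proof -
  obtain b where "\<forall>y\<in>\<Omega>. \<bar>u y\<bar> \<le> b" using lipschitz_bounded[OF lip] by blast
  then obtain v where "approximates \<Omega> v (\<lambda>x. u x + b)" using lipschitz_approximation[OF lip] by blast
  from pairing_add_const(2)[OF this, of "- b"] obtain w where "approximates \<Omega> w u" by auto
  then show ?thesis by (rule pairing_add_const(1))
qed

lemma pairing_uniformly_continuous:
  assumes e: "e > 0"
  shows "\<exists>\<delta>>0. \<forall>u u' c. 1-lipschitz_on \<Omega> u \<longrightarrow> 1-lipschitz_on \<Omega> u' \<longrightarrow>
    (\<forall>y\<in>\<Omega>. \<bar>u y\<bar> \<le> c \<and> \<bar>u' y\<bar> \<le> c \<and> \<bar>u y - u' y\<bar> \<le> \<delta>) \<longrightarrow> \<bar>pairing \<Omega> f u - pairing \<Omega> f u'\<bar> \<le> e"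
proof -
  obtain \<delta> where \<delta>: "\<delta> > 0" and unif: "\<And>\<phi> \<psi>. \<phi> \<in> test_funs \<Longrightarrow> \<psi> \<in> test_funs \<Longrightarrow>
      sup_norm \<Omega> (grad \<phi>) \<le> 1 \<Longrightarrow> sup_norm \<Omega> (grad \<psi>) \<le> 1 \<Longrightarrow>
      (\<forall>x\<in>\<Omega>. \<bar>\<phi> x - \<psi> x\<bar> \<le> \<delta>) \<Longrightarrow> \<bar>f \<phi> - f \<psi>\<bar> \<le> e"
    using f_uniformly_continuous[OF e, of 1] by blast
  show ?thesis
  \<comment> \<open>The three thirds are the distance from \<open>v n\<close> to
    \<open>u + c\<close>, from \<open>u\<close> to \<open>u'\<close>, and from \<open>u' + c\<close>
    to \<open>w n\<close>. A common bound \<open>c\<close> makes the two shifts equal, so they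
    cancel.\<close>
  proof (intro exI[of _ "\<delta> / 3"] conjI allI impI)
    show "0 < \<delta> / 3" using \<delta> by simp
    fix u u' c assume u: "1-lipschitz_on \<Omega> u" and u': "1-lipschitz_on \<Omega> u'"
      and c: "\<forall>y\<in>\<Omega>. \<bar>u y\<bar> \<le> c \<and> \<bar>u' y\<bar> \<le> c \<and> \<bar>u y - u' y\<bar> \<le> \<delta> / 3"
    obtain v where v: "approximates \<Omega> v (\<lambda>x. u x + c)" "\<And>n x. norm (grad (v n) x) \<le> 1"
      and lim: "(\<lambda>n. f (v n)) \<longlonglongrightarrow> pairing \<Omega> f u"
      using lipschitz_approximation[OF u] c by blast
    obtain w where w: "approximates \<Omega> w (\<lambda>x. u' x + c)" "\<And>n x. norm (grad (w n) x) \<le> 1"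
      and lim': "(\<lambda>n. f (w n)) \<longlonglongrightarrow> pairing \<Omega> f u'"
      using lipschitz_approximation[OF u'] c by blast
    have "\<delta> / 3 > 0" using \<delta> by simp
    then have "\<forall>\<^sub>F n in sequentially. \<forall>x\<in>\<Omega>. dist (v n x) (u x + c) < \<delta> / 3"
      "\<forall>\<^sub>F n in sequentially. \<forall>x\<in>\<Omega>. dist (w n x) (u' x + c) < \<delta> / 3"
      using approximates_uniform_limit[OF v(1)] approximates_uniform_limit[OF w(1)] by (simp_all only: uniform_limitD)
    then have "\<forall>\<^sub>F n in sequentially. \<bar>f (v n) - f (w n)\<bar> \<le> e"
    proof eventually_elim
      case (elim n)
      show ?case
      proof (rule unif)
        show "v n \<in> test_funs" "w n \<in> test_funs" using v w by (auto simp: approximates_def)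
        show "sup_norm \<Omega> (grad (v n)) \<le> 1" "sup_norm \<Omega> (grad (w n)) \<le> 1"
          by (rule sup_norm_least[OF nonempty v(2)], rule sup_norm_least[OF nonempty w(2)])
        show "\<forall>x\<in>\<Omega>. \<bar>v n x - w n x\<bar> \<le> \<delta>"
        proof
          fix x assume x: "x \<in> \<Omega>"
          then have "\<bar>v n x - (u x + c)\<bar> < \<delta> / 3" "\<bar>w n x - (u' x + c)\<bar> < \<delta> / 3" "\<bar>u x - u' x\<bar> \<le> \<delta> / 3"
            using elim c by (auto simp: dist_real_def)
          then show "\<bar>v n x - w n x\<bar> \<le> \<delta>" by linarith
        qed
      qed
    qed
    moreover have "(\<lambda>n. \<bar>f (v n) - f (w n)\<bar>) \<longlonglongrightarrow> \<bar>pairing \<Omega> f u - pairing \<Omega> f u'\<bar>"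
      by (intro tendsto_intros lim lim')
    ultimately show "\<bar>pairing \<Omega> f u - pairing \<Omega> f u'\<bar> \<le> e"
      by (intro tendsto_upperbound) auto
  qed
qed

text \<open>A maximising sequence may be normalised to vanish at one point, as constants do not
  affect the pairing. It is then uniformly bounded and equicontinuous, and
  \<open>pairing_uniformly_continuous\<close> carries the values to the limit.\<close>

lemma maximizer_exists:
  "\<exists>u. 1-lipschitz_on \<Omega> u \<and> (\<forall>v. 1-lipschitz_on \<Omega> v \<longrightarrow> pairing \<Omega> f v \<le> pairing \<Omega> f u)"
proof -
  obtain x0 where x0: "x0 \<in> \<Omega>" using nonempty by blast
  obtain R where R: "\<And>y. y \<in> \<Omega> \<Longrightarrow> dist x0 y \<le> R"
    using compact_imp_bounded[OF compact] by (auto simp: bounded_any_center[of _ x0])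
  define L where "L = {u. 1-lipschitz_on \<Omega> u \<and> u x0 = (0::real)}"
  have L_bound: "\<bar>u y\<bar> \<le> R" if "u \<in> L" "y \<in> \<Omega>" for u y
    using that lipschitz_onD[of 1 \<Omega> u x0 y] x0 R[of y] by (auto simp: L_def dist_real_def)
  have norm: "\<exists>w\<in>L. pairing \<Omega> f w = pairing \<Omega> f u" if "1-lipschitz_on \<Omega> u" for u
  proof (intro bexI)
    show "pairing \<Omega> f (\<lambda>x. u x + - u x0) = pairing \<Omega> f u" by (rule pairing_shift[OF that])
    show "(\<lambda>x. u x + - u x0) \<in> L" using that by (auto simp: L_def lipschitz_on_def dist_real_def)
  qed
  \<comment> \<open>In \<open>ereal\<close> the supremum exists before any upper bound is known; its
    finiteness results from its equality with the pairing of the limit function.\<close>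
  let ?S = "(\<lambda>u. ereal (pairing \<Omega> f u)) ` L"
  have "(\<lambda>x. 0) \<in> L" by (auto simp: L_def lipschitz_on_def)
  then have "?S \<noteq> {}" by blast
  then obtain s where s: "incseq s" "range s \<subseteq> ?S" "Sup ?S = (SUP i. s i)"
    using Sup_countable_SUP[of ?S] by auto
  have "\<exists>u\<in>L. s n = ereal (pairing \<Omega> f u)" for n using s(2) by blast
  then obtain U where U: "\<And>n. U n \<in> L" and sU: "\<And>n. s n = ereal (pairing \<Omega> f (U n))" by metis
  have lip: "1-lipschitz_on \<Omega> (U n)" for n using U by (auto simp: L_def)
  obtain g k where k: "strict_mono (k :: nat \<Rightarrow> nat)"
    and conv: "\<And>e. 0 < e \<Longrightarrow> \<exists>N. \<forall>n x. n \<ge> N \<and> x \<in> \<Omega> \<longrightarrow> norm (U (k n) x - g x) < e"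
  proof (rule Arzela_Ascoli[OF compact, of U R])
    show "norm (U n x) \<le> R" if "x \<in> \<Omega>" for n x using L_bound[OF U that] by simp
    show "\<exists>d. 0 < d \<and> (\<forall>n y. y \<in> \<Omega> \<and> norm (x - y) < d \<longrightarrow> norm (U n x - U n y) < e)"
      if "x \<in> \<Omega>" "0 < e" for x e
    proof (intro exI[of _ e] conjI allI impI)
      fix n y assume "y \<in> \<Omega> \<and> norm (x - y) < e"
      then show "norm (U n x - U n y) < e"
        using lipschitz_onD[OF lip[of n] \<open>x \<in> \<Omega>\<close>, of y] by (simp add: dist_norm)
    qed (rule that)
  qed blast
  have lim: "(\<lambda>n. U (k n) x) \<longlonglongrightarrow> g x" if "x \<in> \<Omega>" for x
  proof (rule LIMSEQ_I)
    fix r :: real assume "0 < r"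
    then show "\<exists>no. \<forall>n\<ge>no. norm (U (k n) x - g x) < r" using conv[of r] that by blast
  qed
  have g_lip: "1-lipschitz_on \<Omega> g"
  proof (rule lipschitz_onI)
    fix x y assume xy: "x \<in> \<Omega>" "y \<in> \<Omega>"
    have "(\<lambda>n. dist (U (k n) x) (U (k n) y)) \<longlonglongrightarrow> dist (g x) (g y)" by (intro tendsto_dist lim xy)
    then show "dist (g x) (g y) \<le> 1 * dist x y"
      by (rule LIMSEQ_le_const2) (use lipschitz_onD[OF lip xy] in blast)
  qed simp
  have "(\<lambda>n. U (k n) x0) \<longlonglongrightarrow> 0" using U by (simp add: L_def)
  then have "g x0 = 0" using lim[OF x0] LIMSEQ_unique by blast
  with g_lip have gL: "g \<in> L" by (simp add: L_def)
  have "(\<lambda>n. pairing \<Omega> f (U (k n))) \<longlonglongrightarrow> pairing \<Omega> f g"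
  proof (rule LIMSEQ_I)
    fix r :: real assume r: "0 < r"
    then obtain \<delta> where \<delta>: "\<delta> > 0" and close: "\<And>u u' c. 1-lipschitz_on \<Omega> u \<Longrightarrow> 1-lipschitz_on \<Omega> u' \<Longrightarrow>
        (\<forall>y\<in>\<Omega>. \<bar>u y\<bar> \<le> c \<and> \<bar>u' y\<bar> \<le> c \<and> \<bar>u y - u' y\<bar> \<le> \<delta>) \<Longrightarrow> \<bar>pairing \<Omega> f u - pairing \<Omega> f u'\<bar> \<le> r / 2"
      using pairing_uniformly_continuous[OF half_gt_zero[OF r]] by blast
    obtain N where N: "\<And>n x. n \<ge> N \<Longrightarrow> x \<in> \<Omega> \<Longrightarrow> norm (U (k n) x - g x) < \<delta>" using conv[OF \<delta>] by blast
    have "\<bar>pairing \<Omega> f (U (k n)) - pairing \<Omega> f g\<bar> \<le> r / 2" if "n \<ge> N" for n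
      using N[OF that] L_bound[OF U] L_bound[OF gL]
      by (intro close[where c = R] lip g_lip ballI) (auto intro: less_imp_le)
    then show "\<exists>no. \<forall>n\<ge>no. norm (pairing \<Omega> f (U (k n)) - pairing \<Omega> f g) < r"
      using r by (intro exI[of _ N]) force
  qed
  then have "(\<lambda>n. s (k n)) \<longlonglongrightarrow> ereal (pairing \<Omega> f g)" by (simp add: sU)
  moreover have "(\<lambda>n. s (k n)) \<longlonglongrightarrow> Sup ?S"
    using LIMSEQ_subseq_LIMSEQ[OF LIMSEQ_SUP[OF s(1)] k] s(3) by (simp add: o_def)
  ultimately have Sup: "Sup ?S = ereal (pairing \<Omega> f g)" using LIMSEQ_unique by blast
  have "pairing \<Omega> f v \<le> pairing \<Omega> f g" if v: "1-lipschitz_on \<Omega> v" for v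
  proof -
    obtain w where w: "w \<in> L" "pairing \<Omega> f w = pairing \<Omega> f v" using norm[OF v] by blast
    have "ereal (pairing \<Omega> f w) \<le> Sup ?S" using w(1) by (intro Sup_upper) blast
    then show ?thesis using w(2) Sup by simp
  qed
  with g_lip show ?thesis by blast
qed

text \<open>Admissible functions for \<open>W1\<close> are 1-Lipschitz on the convex whole space,
  which gives one inequality. For the other, the test functions approximating a shift of the
  maximiser are themselves admissible.\<close>

lemma W1_eq:
  assumes u: "1-lipschitz_on \<Omega> u" and max: "\<And>v. 1-lipschitz_on \<Omega> v \<Longrightarrow> pairing \<Omega> f v \<le> pairing \<Omega> f u"
  shows "W1 \<Omega> f = ereal (pairing \<Omega> f u)"
  unfolding W1_def
proof (rule antisym)
  show "(SUP u \<in> {u \<in> C1_compact_supp. \<forall>x. norm (grad u x) \<le> 1}. ereal (pairing \<Omega> f u)) \<le> ereal (pairing \<Omega> f u)"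
  proof (rule SUP_least)
    fix v :: "real ^ 'n \<Rightarrow> real" assume "v \<in> {u \<in> C1_compact_supp. \<forall>x. norm (grad u x) \<le> 1}"
    then have "1-lipschitz_on UNIV v"
      by (intro lipschitz_on_grad_bound) (auto simp: C1_compact_supp_def)
    then have "1-lipschitz_on \<Omega> v" by (rule lipschitz_on_subset) simp
    then show "ereal (pairing \<Omega> f v) \<le> ereal (pairing \<Omega> f u)" using max by simp
  qed
  obtain c where "\<forall>y\<in>\<Omega>. \<bar>u y\<bar> \<le> c" using lipschitz_bounded[OF u] by blast
  then obtain v where v: "approximates \<Omega> v (\<lambda>x. u x + c)" "\<And>n x. norm (grad (v n) x) \<le> 1"
    and lim: "(\<lambda>n. f (v n)) \<longlonglongrightarrow> pairing \<Omega> f u"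
    using lipschitz_approximation[OF u, of c] by blast
  show "ereal (pairing \<Omega> f u) \<le> (SUP u \<in> {u \<in> C1_compact_supp. \<forall>x. norm (grad u x) \<le> 1}. ereal (pairing \<Omega> f u))"
  proof (rule LIMSEQ_le_const2)
    show "(\<lambda>n. ereal (f (v n))) \<longlonglongrightarrow> ereal (pairing \<Omega> f u)" using lim by simp
    have "v n \<in> test_funs" for n using v(1) by (auto simp: approximates_def)
    then have vn: "v n \<in> {u \<in> C1_compact_supp. \<forall>x. norm (grad u x) \<le> 1}" "f (v n) = pairing \<Omega> f (v n)" for n
      using v(2) pairing_test_fun[of "v n"] by (auto simp: test_funs_def C1_compact_supp_def simp del: C_k.simps)
    show "\<exists>N. \<forall>n\<ge>N. ereal (f (v n))
        \<le> (SUP u \<in> {u \<in> C1_compact_supp. \<forall>x. norm (grad u x) \<le> 1}. ereal (pairing \<Omega> f u))"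
      unfolding vn(2) using SUP_upper[OF vn(1), of "\<lambda>u. ereal (pairing \<Omega> f u)"] by blast
  qed
qed

text \<open>By convexity the maximum of \<open>norm (grad \<phi>)\<close> on \<open>\<Omega>\<close>
  is a Lipschitz constant of \<open>\<phi>\<close> there; dividing by it produces a competitor in
  the maximisation.\<close>

lemma f_le_grad:
  assumes "convex \<Omega>" and max: "\<And>v. 1-lipschitz_on \<Omega> v \<Longrightarrow> pairing \<Omega> f v \<le> W" and \<phi>: "\<phi> \<in> test_funs"
  shows "f \<phi> \<le> W * sup_norm \<Omega> (grad \<phi>)"
proof -
  let ?s = "sup_norm \<Omega> (grad \<phi>)"
  have b: "norm (grad \<phi> x) \<le> ?s" if "x \<in> \<Omega>" for x
    using that by (intro sup_norm_upper compact test_funs_grad_continuous[OF \<phi>])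
  have s0: "0 \<le> ?s" using b nonempty by (meson equals0I norm_ge_zero order_trans)
  have lip: "?s-lipschitz_on \<Omega> \<phi>"
    by (rule lipschitz_on_grad_bound[OF \<open>convex \<Omega>\<close> test_funs_differentiable[OF \<phi>] b s0])
  show ?thesis
  proof (cases "?s = 0")
    \<comment> \<open>No normalisation is possible here, but a vanishing Lipschitz constant makes
      \<open>\<phi>\<close> constant on \<open>\<Omega>\<close>, where \<open>f\<close> gives
      0.\<close>
    case True
    then have "\<phi> x = \<phi> y" if "x \<in> \<Omega>" "y \<in> \<Omega>" for x y
      using lipschitz_onD[OF lip that] by simp
    then have "\<phi> constant_on \<Omega>" unfolding constant_on_def using nonempty by blast
    then show ?thesis using f_constant_on[OF \<phi>] True by simp
  next
    case False
    then have s: "?s > 0" using s0 by simp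
    let ?\<psi> = "\<lambda>x. inverse ?s * \<phi> x"
    have "1-lipschitz_on \<Omega> ?\<psi>"
    proof (rule lipschitz_onI)
      fix x y assume "x \<in> \<Omega>" "y \<in> \<Omega>"
      then have "inverse ?s * dist (\<phi> x) (\<phi> y) \<le> inverse ?s * (?s * dist x y)"
        using s by (intro mult_left_mono lipschitz_onD[OF lip]) auto
      then show "dist (?\<psi> x) (?\<psi> y) \<le> 1 * dist x y"
        using s by (simp add: dist_real_def abs_mult field_simps flip: right_diff_distrib)
    qed simp
    then have "pairing \<Omega> f ?\<psi> \<le> W" by (rule max)
    moreover have "pairing \<Omega> f ?\<psi> = inverse ?s * f \<phi>"
      by (simp add: pairing_test_fun[OF test_funs_scale[OF \<phi>]] f_scale[OF \<phi>])
    ultimately have "inverse ?s * f \<phi> \<le> W" by simp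
    then show ?thesis using s by (simp add: field_simps)
  qed
qed

end

section \<open>Integration against vector measures\<close>

definition bounded_signed :: "((real ^ 'n) set \<Rightarrow> real) \<Rightarrow> real \<Rightarrow> bool" where
  "bounded_signed s b \<longleftrightarrow>
     (\<forall>A. range A \<subseteq> sets borel \<and> disjoint_family A \<longrightarrow> (\<lambda>n::nat. s (A n)) sums s (\<Union>n. A n)) \<and>
     (\<forall>A\<in>sets borel. \<bar>s A\<bar> \<le> b)"

lemma bounded_signed_sums:
  "bounded_signed s b \<Longrightarrow> range A \<subseteq> sets borel \<Longrightarrow> disjoint_family A \<Longrightarrow>
    (\<lambda>n::nat. s (A n)) sums s (\<Union>n. A n)"
  unfolding bounded_signed_def by blast

lemma bounded_signed_uminus: "bounded_signed s b \<Longrightarrow> bounded_signed (\<lambda>A. - s A) b"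
  unfolding bounded_signed_def by (auto intro: sums_minus)

lemma countably_additive_empty:
  fixes s :: "'a set \<Rightarrow> 'b::real_normed_vector"
  assumes "\<And>A. range A \<subseteq> M \<and> disjoint_family A \<Longrightarrow> (\<lambda>n::nat. s (A n)) sums s (\<Union>n. A n)" and "{} \<in> M"
  shows "s {} = 0"
proof -
  have "(\<lambda>n::nat. s {}) sums s (\<Union>n::nat. {})"
    using assms(1)[of "\<lambda>n. {}"] assms(2) by (simp add: disjoint_family_on_def image_subset_iff)
  then show ?thesis using sums_summable summable_const_iff by blast
qed

lemma bounded_signed_empty: "bounded_signed s b \<Longrightarrow> s {} = 0"
  using countably_additive_empty[of "sets borel" s] unfolding bounded_signed_def by blast

lemma bounded_signed_Un:
  assumes s: "bounded_signed s b" and "A \<in> sets borel" "B \<in> sets borel" "A \<inter> B = {}"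
  shows "s (A \<union> B) = s A + s B"
proof -
  have "disjoint_family (binaryset A B)"
    using assms(4) by (auto simp: disjoint_family_on_def binaryset_def)
  then have "(\<lambda>n. s (binaryset A B n)) sums s (\<Union>n. binaryset A B n)"
    using assms(2,3) by (intro bounded_signed_sums[OF s]) (auto simp: range_binaryset_eq)
  moreover have "(\<lambda>n. s (binaryset A B n)) sums (s A + s B)"
    unfolding sums_def by (rule LIMSEQ_binaryset) (rule bounded_signed_empty[OF s])
  ultimately show ?thesis using sums_unique2 by (metis UN_binaryset_eq)
qed

definition upper_variation :: "((real ^ 'n) set \<Rightarrow> real) \<Rightarrow> (real ^ 'n) set \<Rightarrow> ennreal" where
  "upper_variation s A = (SUP B \<in> {B \<in> sets borel. B \<subseteq> A}. ennreal (s B))"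

lemma upper_variation_upper: "B \<in> sets borel \<Longrightarrow> B \<subseteq> A \<Longrightarrow> ennreal (s B) \<le> upper_variation s A"
  unfolding upper_variation_def by (intro SUP_upper) simp

lemma upper_variation_mono: "A \<subseteq> B \<Longrightarrow> upper_variation s A \<le> upper_variation s B"
  unfolding upper_variation_def by (intro SUP_subset_mono) auto

text \<open>Competitors inside \<open>A\<close> and \<open>B\<close> unite to a competitor inside
  \<open>A \<union> B\<close>. If one of them has a negative value, \<open>ennreal\<close> counts it
  as 0 and the other one alone is used.\<close>

lemma upper_variation_superadditive:
  assumes s: "bounded_signed s b" and "A \<inter> B = {}"
  shows "upper_variation s A + upper_variation s B \<le> upper_variation s (A \<union> B)"
proof -
  have le: "ennreal (s C) + ennreal (s D) \<le> upper_variation s (A \<union> B)"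
    if C: "C \<in> sets borel" "C \<subseteq> A" and D: "D \<in> sets borel" "D \<subseteq> B" for C D
  proof -
    consider "s C \<le> 0" | "s D \<le> 0" | "0 \<le> s C" "0 \<le> s D" by linarith
    then show ?thesis
    proof cases
      case 1
      then show ?thesis using upper_variation_upper[of D "A \<union> B" s] D by (auto simp: ennreal_neg)
    next
      case 2
      then show ?thesis using upper_variation_upper[of C "A \<union> B" s] C by (auto simp: ennreal_neg)
    next
      case 3
      have "s (C \<union> D) = s C + s D" using assms C D by (intro bounded_signed_Un[OF s]) auto
      then have "ennreal (s C) + ennreal (s D) = ennreal (s (C \<union> D))" using 3 by simp
      also have "\<dots> \<le> upper_variation s (A \<union> B)" using C D by (intro upper_variation_upper) auto
      finally show ?thesis .
    qed
  qed
  have ne: "{B \<in> sets borel. B \<subseteq> A} \<noteq> {}" for A :: "(real ^ 'n) set" by blast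
  have "upper_variation s A + ennreal (s D) \<le> upper_variation s (A \<union> B)"
    if "D \<in> sets borel" "D \<subseteq> B" for D
    unfolding upper_variation_def[of s A] ennreal_SUP_add_left[OF ne, symmetric]
    using that by (intro SUP_least le) auto
  then show ?thesis
    unfolding upper_variation_def[of s B] ennreal_SUP_add_right[OF ne] by (intro SUP_least) auto
qed

text \<open>Finite superadditivity bounds the partial sums from above. Conversely, any competitor
  \<open>B\<close> is cut along the \<open>A i\<close>, and its value is the limit of the sums over
  these pieces.\<close>

lemma upper_variation_countably_additive:
  fixes s :: "(real ^ 'n) set \<Rightarrow> real"
  assumes s: "bounded_signed s b"
  shows "countably_additive (sets borel) (upper_variation s)"
  unfolding countably_additive_def
proof (intro allI impI antisym)
  fix A :: "nat \<Rightarrow> (real ^ 'n) set"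
  assume A: "range A \<subseteq> sets borel" and disj: "disjoint_family A"
  show "(\<Sum>i. upper_variation s (A i)) \<le> upper_variation s (\<Union>i. A i)"
  proof (rule suminf_le_const[OF summableI])
    fix n
    have "(\<Sum>i<n. upper_variation s (A i)) \<le> upper_variation s (\<Union>i<n. A i)"
    proof (induction n)
      case (Suc n)
      have "(\<Sum>i<Suc n. upper_variation s (A i)) \<le> upper_variation s (\<Union>i<n. A i) + upper_variation s (A n)"
        using Suc by (simp add: add_right_mono)
      also have "\<dots> \<le> upper_variation s ((\<Union>i<n. A i) \<union> A n)"
        using disj by (intro upper_variation_superadditive[OF s])
          (auto simp: disjoint_family_on_def, metis IntI empty_iff less_irrefl)
      also have "\<dots> = upper_variation s (\<Union>i<Suc n. A i)" by (simp add: lessThan_Suc Un_commute)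
      finally show ?case .
    qed simp
    also have "\<dots> \<le> upper_variation s (\<Union>i. A i)" by (rule upper_variation_mono) auto
    finally show "(\<Sum>i<n. upper_variation s (A i)) \<le> upper_variation s (\<Union>i. A i)" .
  qed
  show "upper_variation s (\<Union>i. A i) \<le> (\<Sum>i. upper_variation s (A i))"
    unfolding upper_variation_def[of s "\<Union>i. A i"]
  proof (rule SUP_least, clarify)
    fix B :: "(real ^ 'n) set" assume B: "B \<in> sets borel" "B \<subseteq> (\<Union>i. A i)"
    have "(\<lambda>n. s (B \<inter> A n)) sums s (\<Union>n. B \<inter> A n)"
    proof (rule bounded_signed_sums[OF s])
      show "disjoint_family (\<lambda>n. B \<inter> A n)" using disj by (rule disjoint_family_on_bisimulation) auto
    qed (use A B in auto)
    moreover have "(\<Union>n. B \<inter> A n) = B" using B by blast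
    ultimately have "(\<lambda>n. ennreal (\<Sum>i<n. s (B \<inter> A i))) \<longlonglongrightarrow> ennreal (s B)"
      by (intro tendsto_ennrealI) (simp add: sums_def)
    moreover have "ennreal (\<Sum>i<n. s (B \<inter> A i)) \<le> (\<Sum>i. upper_variation s (A i))" for n
    proof -
      have "ennreal (\<Sum>i<n. s (B \<inter> A i)) \<le> ennreal (\<Sum>i<n. max 0 (s (B \<inter> A i)))"
        by (intro ennreal_leI sum_mono) simp
      also have "\<dots> = (\<Sum>i<n. ennreal (max 0 (s (B \<inter> A i))))" by simp
      also have "\<dots> \<le> (\<Sum>i<n. upper_variation s (A i))"
      proof (rule sum_mono)
        fix i show "ennreal (max 0 (s (B \<inter> A i))) \<le> upper_variation s (A i)"
          using upper_variation_upper[of "B \<inter> A i" "A i" s] A B by (auto simp: max_def image_subset_iff)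
      qed
      also have "\<dots> \<le> (\<Sum>i. upper_variation s (A i))" by (intro sum_le_suminf) auto
      finally show ?thesis .
    qed
    ultimately show "ennreal (s B) \<le> (\<Sum>i. upper_variation s (A i))" by (intro LIMSEQ_le_const2) auto
  qed
qed

lemma sets_pos_part [simp, measurable_cong]: "sets (pos_part s) = sets borel"
  by (simp add: pos_part_def sigma_algebra.sigma_sets_eq[OF sets.sigma_algebra_axioms[of borel, simplified]])

lemma space_pos_part [simp]: "space (pos_part s) = UNIV"
  by (simp add: pos_part_def)

lemma emeasure_pos_part:
  assumes s: "bounded_signed s b" and A: "A \<in> sets borel"
  shows "emeasure (pos_part s) A = upper_variation s A"
proof -
  have "sigma_algebra UNIV (sets (borel :: (real ^ 'n) measure))"
    using sets.sigma_algebra_axioms[of "borel :: (real ^ 'n) measure"] by simp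
  moreover have "upper_variation s {} = 0"
    unfolding upper_variation_def using bounded_signed_empty[OF s] by (simp add: Collect_conv_if cong: conj_cong)
  then have "positive (sets borel) (upper_variation s)" by (simp add: positive_def)
  ultimately show ?thesis
    using emeasure_measure_of_sigma[OF _ _ upper_variation_countably_additive[OF s] A]
    unfolding pos_part_def upper_variation_def[abs_def] by blast
qed

lemma upper_variation_le: "bounded_signed s b \<Longrightarrow> upper_variation s A \<le> ennreal b"
  unfolding upper_variation_def by (intro SUP_least ennreal_leI) (auto simp: bounded_signed_def abs_le_iff)

lemma finite_measure_pos_part:
  assumes "bounded_signed s b"
  shows "finite_measure (pos_part s)"
  using upper_variation_le[OF assms, of UNIV]
  by (intro finite_measureI) (auto simp: emeasure_pos_part[OF assms] top_unique)

lemma measure_pos_part: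
  assumes s: "bounded_signed s b" and A: "A \<in> sets borel"
  shows "ennreal (measure (pos_part s) A) = upper_variation s A"
  using finite_measure.emeasure_eq_measure[OF finite_measure_pos_part[OF s], of A] emeasure_pos_part[OF s A] by simp

lemma measure_pos_part_le:
  assumes s: "bounded_signed s b"
  shows "measure (pos_part s) UNIV \<le> b"
proof -
  have "0 \<le> b" using s unfolding bounded_signed_def by (metis abs_ge_zero order_trans sets.empty_sets)
  then show ?thesis using measure_pos_part[OF s, of UNIV] upper_variation_le[OF s, of UNIV]
    by (metis ennreal_le_iff sets.top space_borel)
qed

lemma pos_part_outside:
  assumes s: "bounded_signed s b" and "closed \<Omega>" and "\<And>A. A \<in> sets borel \<Longrightarrow> A \<inter> \<Omega> = {} \<Longrightarrow> s A = 0"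
  shows "emeasure (pos_part s) (- \<Omega>) = 0"
proof -
  have "upper_variation s (- \<Omega>) \<le> 0"
    unfolding upper_variation_def
  proof (rule SUP_least, clarify)
    fix B assume "B \<in> sets borel" "B \<subseteq> - \<Omega>"
    then have "s B = 0" by (intro assms(3)) auto
    then show "ennreal (s B) \<le> 0" by simp
  qed
  then show ?thesis using emeasure_pos_part[OF s, of "- \<Omega>"] \<open>closed \<Omega>\<close> by simp
qed

text \<open>For \<open>B \<subseteq> A\<close>, \<open>r B = r A - r (A - B)\<close> is at most
  \<open>r A\<close> plus the negative part of \<open>A\<close>. The supremum over \<open>B\<close>
  gives one inequality, and the same argument for \<open>- s\<close> gives the other.\<close>

lemma jordan_decomposition:
  assumes s: "bounded_signed s b" and A: "A \<in> sets borel"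
  shows "measure (pos_part s) A - measure (pos_part (\<lambda>A. - s A)) A = s A"
proof -
  have le: "measure (pos_part r) A \<le> r A + measure (pos_part (\<lambda>A. - r A)) A" if r: "bounded_signed r b" for r
  proof -
    note r' = bounded_signed_uminus[OF r]
    have Q: "- r B \<le> measure (pos_part (\<lambda>A. - r A)) A" if "B \<in> sets borel" "B \<subseteq> A" for B
    proof -
      have "ennreal (- r B) \<le> ennreal (measure (pos_part (\<lambda>A. - r A)) A)"
        using upper_variation_upper[OF that, of "\<lambda>A. - r A"] measure_pos_part[OF r' A] by simp
      then show ?thesis by (simp only: ennreal_le_iff[OF measure_nonneg])
    qed
    have "upper_variation r A \<le> ennreal (r A + measure (pos_part (\<lambda>A. - r A)) A)"
      unfolding upper_variation_def
    proof (rule SUP_least, clarify, rule ennreal_leI)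
      fix B assume B: "B \<in> sets borel" "B \<subseteq> A"
      have "r (B \<union> (A - B)) = r B + r (A - B)" using A B by (intro bounded_signed_Un[OF r]) auto
      moreover have "B \<union> (A - B) = A" using B by blast
      ultimately show "r B \<le> r A + measure (pos_part (\<lambda>A. - r A)) A"
        using Q[of "A - B"] A B by auto
    qed
    then have "ennreal (measure (pos_part r) A) \<le> ennreal (r A + measure (pos_part (\<lambda>A. - r A)) A)"
      using measure_pos_part[OF r A] by simp
    moreover have "0 \<le> r A + measure (pos_part (\<lambda>A. - r A)) A" using Q[OF A] by simp
    ultimately show ?thesis by (simp only: ennreal_le_iff)
  qed
  show ?thesis using le[OF s] le[OF bounded_signed_uminus[OF s]] by simp
qed

section \<open>Riemann sums over fine partitions\<close>

definition tagged_partition :: "(real ^ 'n) set \<Rightarrow> (real ^ 'n \<Rightarrow> 'b::real_normed_vector) \<Rightarrow> real \<Rightarrow>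
    nat \<Rightarrow> (nat \<Rightarrow> (real ^ 'n) set) \<Rightarrow> (nat \<Rightarrow> real ^ 'n) \<Rightarrow> bool" where
  "tagged_partition \<Omega> g \<delta> m A x \<longleftrightarrow>
     (\<forall>i<m. A i \<in> sets borel \<and> x i \<in> \<Omega> \<and> (\<forall>y\<in>A i. norm (g y - g (x i)) \<le> \<delta>)) \<and>
     disjoint_family_on A {..<m} \<and> (\<Union>i<m. A i) = \<Omega>"

text \<open>Compactness of the image gives finitely many balls, whose preimages in
  \<open>\<Omega>\<close> are made disjoint. A tag may thereby fall outside its own cell; what
  matters is that it lies in \<open>\<Omega>\<close>, where bounds on \<open>g\<close> hold, and
  that \<open>g\<close> on the cell is close to its value at the tag.\<close>

lemma tagged_partition_exists:
  fixes g :: "real ^ 'n \<Rightarrow> 'b::real_normed_vector"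
  assumes "compact \<Omega>" and g: "continuous_on UNIV g" and "\<delta> > 0"
  shows "\<exists>m A x. tagged_partition \<Omega> g \<delta> m A x"
proof -
  have "compact (g ` \<Omega>)" by (rule compact_continuous_image[OF continuous_on_subset[OF g] \<open>compact \<Omega>\<close>]) simp
  then obtain T where T: "finite T" "T \<subseteq> g ` \<Omega>" "g ` \<Omega> \<subseteq> (\<Union>c\<in>T. ball c \<delta>)"
    using compactE_image[of "g ` \<Omega>" "g ` \<Omega>" "\<lambda>c. ball c \<delta>"] \<open>\<delta> > 0\<close> by force
  obtain X where X: "X \<subseteq> \<Omega>" "finite X" "T = g ` X" using finite_subset_image[OF T(1,2)] by blast
  obtain x where x: "bij_betw x {0..<card X} X" using ex_bij_betw_nat_finite[OF X(2)] by blast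
  define m where "m = card X"
  define B where "B = (\<lambda>i. \<Omega> \<inter> {y. dist (g y) (g (x i)) < \<delta>})"
  have B: "range B \<subseteq> sets borel"
  proof -
    have "open {y. dist (g y) (g (x i)) < \<delta>}" for i by (intro open_Collect_less continuous_intros g)
    then show ?thesis using compact_imp_closed[OF \<open>compact \<Omega>\<close>] by (auto simp: B_def)
  qed
  have x_in: "x i \<in> \<Omega>" if "i < m" for i using x X(1) that by (auto simp: bij_betw_def m_def)
  have "tagged_partition \<Omega> g \<delta> m (disjointed B) x"
    unfolding tagged_partition_def
  proof (intro conjI allI impI ballI)
    fix i assume "i < m"
    show "disjointed B i \<in> sets borel" using sets.range_disjointed_sets[OF B] by blast
    show "x i \<in> \<Omega>" using x_in[OF \<open>i < m\<close>] .
    show "norm (g y - g (x i)) \<le> \<delta>" if "y \<in> disjointed B i" for y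
      using that disjointed_subset[of B i] by (auto simp: B_def dist_norm)
  next
    show "disjoint_family_on (disjointed B) {..<m}"
      using disjoint_family_disjointed[of B] by (rule disjoint_family_on_mono[rotated]) simp
    have "(\<Union>i<m. disjointed B i) = (\<Union>i<m. B i)"
      using finite_UN_disjointed_eq[of B m] by (simp add: atLeast0LessThan)
    also have "\<dots> = \<Omega>"
    proof (intro equalityI subsetI)
      fix y assume y: "y \<in> \<Omega>"
      then obtain z where z: "z \<in> X" "dist (g z) (g y) < \<delta>" using T(3) X(3) by auto
      then have "z \<in> x ` {0..<m}" using x by (simp add: bij_betw_def m_def)
      then obtain i where "i < m" "z = x i" by auto
      then show "y \<in> (\<Union>i<m. B i)" using y z by (auto simp: B_def dist_commute)
    qed (auto simp: B_def)
    finally show "(\<Union>i<m. disjointed B i) = \<Omega>" .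
  qed
  then show ?thesis by blast
qed

lemma integral_riemann_sum:
  fixes g :: "real ^ 'n \<Rightarrow> real" and m :: nat
  assumes \<mu>: "finite_measure \<mu>" "sets \<mu> = sets borel" "emeasure \<mu> (- \<Omega>) = 0" and "closed \<Omega>"
    and g: "continuous_on UNIV g"
    and A: "\<And>i. i < m \<Longrightarrow> A i \<in> sets borel" "disjoint_family_on A {..<m}" "(\<Union>i<m. A i) = \<Omega>"
    and c: "\<And>i y. i < m \<Longrightarrow> y \<in> A i \<Longrightarrow> \<bar>g y - c i\<bar> \<le> \<delta>"
  shows "\<bar>(LINT y|\<mu>. g y) - (\<Sum>i<m. c i * measure \<mu> (A i))\<bar> \<le> \<delta> * measure \<mu> UNIV"
proof -
  interpret finite_measure \<mu> by fact
  have space: "space \<mu> = UNIV" using sets_eq_imp_space_eq[OF \<mu>(2)] by simp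
  have [measurable]: "g \<in> borel_measurable \<mu>"
    using borel_measurable_continuous_onI[OF g] measurable_cong_sets[OF \<mu>(2) refl] by blast
  have A_sets: "A i \<in> sets \<mu>" if "i < m" for i using A(1)[OF that] \<mu>(2) by simp
  define h where "h = (\<lambda>y. \<Sum>i<m. c i * indicator (A i) y)"
  have h_int: "integrable \<mu> h"
    unfolding h_def using A_sets by (intro Bochner_Integration.integrable_sum integrable_mult_right integrable_real_indicator) (auto simp: emeasure_eq_measure)
  have h_val: "h y = c i" if "i < m" "y \<in> A i" for i y
  proof -
    have "indicator (A j) y = (if j = i then 1 else 0 :: real)" if "j < m" for j
      using A(2) that \<open>i < m\<close> \<open>y \<in> A i\<close> by (auto simp: disjoint_family_on_def indicator_def)
    then have "h y = (\<Sum>j<m. if j = i then c j else 0)" unfolding h_def by (intro sum.cong) auto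
    also have "\<dots> = c i" using that by (subst sum.delta) auto
    finally show ?thesis .
  qed
  have "AE y in \<mu>. y \<in> \<Omega>"
    using \<mu>(2,3) \<open>closed \<Omega>\<close> space by (intro AE_I[of _ _ "- \<Omega>"]) auto
  then have close: "AE y in \<mu>. norm (g y - h y) \<le> \<delta>"
  proof eventually_elim
    case (elim y)
    then obtain i where "i < m" "y \<in> A i" using A(3) by blast
    then show ?case using c[of i y] h_val[of i y] by simp
  qed
  have d_int: "integrable \<mu> (\<lambda>y. g y - h y)"
    using h_int by (intro integrable_const_bound[OF close]) auto
  then have g_int: "integrable \<mu> g" using Bochner_Integration.integrable_add[OF d_int h_int] by simp
  have "(LINT y|\<mu>. h y) = (\<Sum>i<m. c i * measure \<mu> (A i))"
    unfolding h_def using A_sets by (subst Bochner_Integration.integral_sum)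
      (auto intro!: integrable_mult_right integrable_real_indicator simp: emeasure_eq_measure space)
  then have "\<bar>(LINT y|\<mu>. g y) - (\<Sum>i<m. c i * measure \<mu> (A i))\<bar> = norm (LINT y|\<mu>. g y - h y)"
    using g_int h_int by simp
  also have "\<dots> \<le> (LINT y|\<mu>. norm (g y - h y))" by (rule integral_norm_bound)
  also have "\<dots> \<le> (LINT y|\<mu>. \<delta>)"
    using close d_int by (intro integral_mono_AE integrable_norm) auto
  also have "\<dots> = \<delta> * measure \<mu> UNIV" by (simp add: space)
  finally show ?thesis .
qed

text \<open>In each coordinate the sums for the two Jordan parts combine to a sum in the values of
  \<open>l\<close> itself. The error is \<open>b * \<delta>\<close> per Jordan part, hence the
  factor 2, summed over all coordinates.\<close>

lemma vector_integral_riemann_sum: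
  fixes l :: "(real ^ 'n) set \<Rightarrow> real ^ 'n"
  assumes l: "l \<in> vector_measures \<Omega>" and b: "\<And>A. A \<in> sets borel \<Longrightarrow> norm (l A) \<le> b" and "compact \<Omega>"
    and g: "continuous_on UNIV g" and part: "tagged_partition \<Omega> g \<delta> m A x" and "0 \<le> \<delta>"
  shows "\<bar>vector_integral l g - (\<Sum>j<m. g (x j) \<bullet> l (A j))\<bar> \<le> 2 * b * \<delta> * real CARD('n)"
proof -
  have closed: "closed \<Omega>" using \<open>compact \<Omega>\<close> by (rule compact_imp_closed)
  have comp: "\<bar>signed_integral (\<lambda>A. l A $ i) (\<lambda>y. g y $ i) - (\<Sum>j<m. g (x j) $ i * l (A j) $ i)\<bar> \<le> 2 * b * \<delta>" for i
  proof -
    let ?s = "\<lambda>A. l A $ i"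
    have s: "bounded_signed ?s b"
      unfolding bounded_signed_def
    proof (intro conjI allI impI ballI)
      fix A :: "nat \<Rightarrow> (real ^ 'n) set" assume "range A \<subseteq> sets borel \<and> disjoint_family A"
      then have "(\<lambda>n. l (A n)) sums l (\<Union>n. A n)" using l by (simp add: vector_measures_def)
      then show "(\<lambda>n. l (A n) $ i) sums (l (\<Union>n. A n) $ i)"
        by (rule bounded_linear.sums[OF bounded_linear_vec_nth])
    next
      fix A :: "(real ^ 'n) set" assume "A \<in> sets borel"
      then show "\<bar>l A $ i\<bar> \<le> b" using b[of A] component_le_norm_cart[of "l A" i] by linarith
    qed
    have out: "l A $ i = 0" if "A \<in> sets borel" "A \<inter> \<Omega> = {}" for A
      using l that by (simp add: vector_measures_def)
    note s' = bounded_signed_uminus[OF s]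
    have gi: "continuous_on UNIV (\<lambda>y. g y $ i)" by (intro continuous_intros g)
    have A: "\<And>j. j < m \<Longrightarrow> A j \<in> sets borel" "disjoint_family_on A {..<m}" "(\<Union>j<m. A j) = \<Omega>"
      and close: "\<And>j y. j < m \<Longrightarrow> y \<in> A j \<Longrightarrow> norm (g y - g (x j)) \<le> \<delta>"
      using part by (auto simp: tagged_partition_def)
    have close': "\<bar>g y $ i - g (x j) $ i\<bar> \<le> \<delta>" if "j < m" "y \<in> A j" for j y
      using close[OF that] component_le_norm_cart[of "g y - g (x j)" i] by simp
    have rs: "\<bar>(LINT y|pos_part r. g y $ i) - (\<Sum>j<m. g (x j) $ i * measure (pos_part r) (A j))\<bar> \<le> \<delta> * b"
      if r: "bounded_signed r b" and "\<And>A. A \<in> sets borel \<Longrightarrow> A \<inter> \<Omega> = {} \<Longrightarrow> r A = 0" for r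
    proof -
      have "\<bar>(LINT y|pos_part r. g y $ i) - (\<Sum>j<m. g (x j) $ i * measure (pos_part r) (A j))\<bar>
          \<le> \<delta> * measure (pos_part r) UNIV"
        by (rule integral_riemann_sum[OF finite_measure_pos_part[OF r] sets_pos_part
              pos_part_outside[OF r closed that(2)] closed gi A close'])
      also have "\<dots> \<le> \<delta> * b" using measure_pos_part_le[OF r] \<open>0 \<le> \<delta>\<close> by (rule mult_left_mono)
      finally show ?thesis .
    qed
    have "(\<Sum>j<m. g (x j) $ i * measure (pos_part ?s) (A j)) - (\<Sum>j<m. g (x j) $ i * measure (pos_part (\<lambda>A. - ?s A)) (A j))
        = (\<Sum>j<m. g (x j) $ i * l (A j) $ i)"
      unfolding sum_subtractf[symmetric] right_diff_distrib[symmetric]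
      using jordan_decomposition[OF s A(1)] by (intro sum.cong) auto
    then show ?thesis
      using rs[OF s out] rs[OF s'] out unfolding signed_integral_def by (simp add: abs_le_iff algebra_simps)
  qed
  have "vector_integral l g - (\<Sum>j<m. g (x j) \<bullet> l (A j))
      = (\<Sum>i\<in>UNIV. signed_integral (\<lambda>A. l A $ i) (\<lambda>y. g y $ i) - (\<Sum>j<m. g (x j) $ i * l (A j) $ i))"
    unfolding vector_integral_def inner_vec_def by (subst sum.swap) (simp add: sum_subtractf)
  also have "\<bar>\<dots>\<bar> \<le> (\<Sum>i\<in>(UNIV :: 'n set). 2 * b * \<delta>)"
    by (rule order_trans[OF sum_abs sum_mono]) (rule comp)
  finally show ?thesis by (simp add: mult.commute mult.left_commute)
qed

section \<open>Integrals bounded by the Euclidean total variation\<close>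

lemma total_variation_upper:
  assumes "finite P" "P \<subseteq> sets borel" "disjoint P"
  shows "ereal (\<Sum>A\<in>P. norm (l A)) \<le> total_variation l"
proof -
  have "(\<Sum>A\<in>P. ereal (norm (l A))) \<le> total_variation l"
    unfolding total_variation_def using assms by (intro SUP_upper) simp
  then show ?thesis by simp
qed

text \<open>Distinct indices can share a cell only if it is empty, and then \<open>l {} = 0\<close>
  makes the repetition harmless when the family is regarded as a set.\<close>

lemma total_variation_family_upper:
  assumes "finite I" and A: "\<And>i. i \<in> I \<Longrightarrow> A i \<in> sets borel" and disj: "disjoint_family_on A I" and "l {} = 0"
  shows "ereal (\<Sum>i\<in>I. norm (l (A i))) \<le> total_variation l"
proof -
  have "(\<Sum>B\<in>A ` I. norm (l B)) = (\<Sum>i\<in>I. norm (l (A i)))"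
  proof (rule sum.reindex_nontrivial[unfolded o_def])
    fix i j assume "i \<in> I" "j \<in> I" "i \<noteq> j" "A i = A j"
    then have "A i = {}" using disj by (auto simp: disjoint_family_on_def)
    then show "norm (l (A i)) = 0" using \<open>l {} = 0\<close> by simp
  qed fact
  moreover have "disjoint (A ` I)"
    using disj by (rule disjoint_family_on_disjoint_image)
  ultimately show ?thesis
    using total_variation_upper[of "A ` I" l] \<open>finite I\<close> A by auto
qed

lemma vector_measures_empty: "l \<in> vector_measures \<Omega> \<Longrightarrow> l {} = 0"
  by (simp add: vector_measures_def)

text \<open>Cauchy-Schwarz is applied cell by cell to \<open>g (x j) \<bullet> l (A j)\<close>,
  which gives the constant 1. The dimension enters only through the Riemann error, which tends to 0
  with \<open>\<delta>\<close>.\<close>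

theorem vector_integral_le_total_variation:
  fixes l :: "(real ^ 'n) set \<Rightarrow> real ^ 'n"
  assumes l: "l \<in> vector_measures \<Omega>" and t: "total_variation l = ereal t" and "compact \<Omega>"
    and g: "continuous_on UNIV g" and c: "\<And>x. x \<in> \<Omega> \<Longrightarrow> norm (g x) \<le> c" and "0 \<le> c"
  shows "vector_integral l g \<le> t * c"
proof -
  have b: "norm (l A) \<le> t" if "A \<in> sets borel" for A
    using total_variation_upper[of "{A}" l] that t by (simp add: disjoint_def)
  have t0: "0 \<le> t" using b[of "{}"] norm_ge_zero order_trans by blast
  define k where "k = 2 * t * real CARD('n)"
  have "vector_integral l g \<le> t * c + \<delta> * k" if \<delta>: "\<delta> > 0" for \<delta>
  proof -
    obtain m A x where part: "tagged_partition \<Omega> g \<delta> m A x"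
      using tagged_partition_exists[OF \<open>compact \<Omega>\<close> g \<delta>] by blast
    have "vector_integral l g \<le> (\<Sum>j<m. g (x j) \<bullet> l (A j)) + 2 * t * \<delta> * real CARD('n)"
      using vector_integral_riemann_sum[OF l b \<open>compact \<Omega>\<close> g part] \<delta> by linarith
    moreover have "(\<Sum>j<m. g (x j) \<bullet> l (A j)) \<le> (\<Sum>j<m. norm (l (A j)) * c)"
    proof (rule sum_mono)
      fix j assume "j \<in> {..<m}"
      then have "norm (g (x j)) \<le> c" using part c by (auto simp: tagged_partition_def)
      then have "norm (g (x j)) * norm (l (A j)) \<le> c * norm (l (A j))" by (rule mult_right_mono) simp
      then show "g (x j) \<bullet> l (A j) \<le> norm (l (A j)) * c"
        using norm_cauchy_schwarz[of "g (x j)" "l (A j)"] by (simp add: mult.commute)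
    qed
    moreover have "(\<Sum>j<m. norm (l (A j))) \<le> t"
      using total_variation_family_upper[of "{..<m}" A l] part t vector_measures_empty[OF l]
      by (auto simp: tagged_partition_def)
    then have "(\<Sum>j<m. norm (l (A j)) * c) \<le> t * c"
      using \<open>0 \<le> c\<close> by (simp add: mult_right_mono flip: sum_distrib_right)
    ultimately show ?thesis by (simp add: k_def mult_ac)
  qed
  note le = this
  show ?thesis
  proof (rule field_le_epsilon)
    fix e :: real assume "e > 0"
    have k0: "0 \<le> k" using t0 by (simp add: k_def)
    have "vector_integral l g \<le> t * c + e / (k + 1) * k" using \<open>e > 0\<close> k0 by (intro le) simp
    also have "e / (k + 1) * k \<le> e" using \<open>e > 0\<close> k0 by (simp add: field_simps)
    finally show "vector_integral l g \<le> t * c + e" by simp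
  qed
qed

section \<open>The optimal measure and duality\<close>

lemma sup_norm_grad_nonneg:
  assumes "compact \<Omega>" "\<Omega> \<noteq> {}" "\<phi> \<in> test_funs"
  shows "0 \<le> sup_norm \<Omega> (grad \<phi>)"
  using sup_norm_upper[OF assms(1) test_funs_grad_continuous[OF assms(3)]] assms(2)
  by (meson equals0I norm_ge_zero order_trans)

text \<open>On \<open>\<Omega> \<times> cball 0 1\<close> a gradient becomes the scalar function \<open>(x, \<theta>) \<mapsto> grad \<phi> x \<bullet> \<theta>\<close>, whose
  positive part has the maximum \<open>sup_norm \<Omega> (grad \<phi>)\<close>. A linear functional dominated by the maximum
  of the positive part is positive, so the Hahn-Banach extension is a positive measure, and no
  Jordan decomposition of a functional is needed. The projections only extend the function
  continuously and boundedly to the whole space.\<close>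

theorem polar_measure_exists:
  fixes f :: "(real ^ 'n \<Rightarrow> real) \<Rightarrow> real"
  assumes "convex \<Omega>" "compact \<Omega>" "\<Omega> \<noteq> {}" and W: "0 \<le> W"
    and f_add: "\<And>\<phi> \<psi>. \<phi> \<in> test_funs \<Longrightarrow> \<psi> \<in> test_funs \<Longrightarrow> f (\<lambda>x. \<phi> x + \<psi> x) = f \<phi> + f \<psi>"
    and f_scale: "\<And>\<phi> c. \<phi> \<in> test_funs \<Longrightarrow> f (\<lambda>x. c * \<phi> x) = c * f \<phi>"
    and f_le: "\<And>\<phi>. \<phi> \<in> test_funs \<Longrightarrow> f \<phi> \<le> W * sup_norm \<Omega> (grad \<phi>)"
  shows "\<exists>\<mu> :: ((real ^ 'n) \<times> (real ^ 'n)) measure. finite_measure \<mu> \<and> sets \<mu> = sets borel \<and>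
    emeasure \<mu> (- (\<Omega> \<times> cball 0 1)) = 0 \<and> measure \<mu> UNIV \<le> W \<and>
    (\<forall>\<phi>\<in>test_funs. f \<phi> = (LINT z|\<mu>. grad \<phi> (fst z) \<bullet> snd z))"
proof -
  let ?K = "\<Omega> \<times> cball (0 :: real ^ 'n) 1"
  have K: "compact ?K" "?K \<noteq> {}" using assms by (auto intro: compact_Times)
  have closed: "closed \<Omega>" using assms by (simp add: compact_imp_closed)
  define G where "G = (\<lambda>\<phi> z. grad \<phi> (closest_point \<Omega> (fst z)) \<bullet> closest_point (cball (0 :: real ^ 'n) 1) (snd z))"
  have clos: "closest_point \<Omega> x \<in> \<Omega>" for x using closed \<open>\<Omega> \<noteq> {}\<close> by (rule closest_point_in_set)
  have clos1: "norm (closest_point (cball (0 :: real ^ 'n) 1) x) \<le> 1" for x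
    using closest_point_in_set[of "cball (0 :: real ^ 'n) 1" x] by simp
  have G_K: "G \<phi> z = grad \<phi> (fst z) \<bullet> snd z" if "z \<in> ?K" for \<phi> z
    using that unfolding G_def by (auto simp: closest_point_self)
  have G_b: "G \<phi> \<in> bcontfun" if \<phi>: "\<phi> \<in> test_funs" for \<phi>
  proof (rule bcontfunI)
    show "continuous_on UNIV (G \<phi>)"
      unfolding G_def using assms closed
      by (intro continuous_intros continuous_on_compose2[OF test_funs_grad_continuous[OF \<phi>, of UNIV]]
          continuous_on_compose2[OF continuous_on_closest_point, of _ UNIV]) auto
    fix z :: "(real ^ 'n) \<times> (real ^ 'n)"
    have "norm (G \<phi> z) \<le> norm (grad \<phi> (closest_point \<Omega> (fst z))) * norm (closest_point (cball (0 :: real ^ 'n) 1) (snd z))"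
      unfolding G_def real_norm_def by (rule Cauchy_Schwarz_ineq2)
    also have "\<dots> \<le> sup_norm \<Omega> (grad \<phi>) * 1"
      using assms \<phi> clos clos1 test_funs_grad_continuous[OF \<phi>]
      by (intro mult_mono sup_norm_upper sup_norm_grad_nonneg) auto
    finally show "norm (G \<phi> z) \<le> sup_norm \<Omega> (grad \<phi>) * 1" .
  qed
  define p where "p = (\<lambda>g :: ((real ^ 'n) \<times> (real ^ 'n)) \<Rightarrow>\<^sub>C real. W * (SUP z\<in>?K. max 0 (apply_bcontfun g z)))"
  have bdd: "bdd_above ((\<lambda>z. max 0 (apply_bcontfun g z)) ` ?K)" for g :: "((real ^ 'n) \<times> (real ^ 'n)) \<Rightarrow>\<^sub>C real"
    by (intro bounded_imp_bdd_above compact_imp_bounded compact_continuous_image K continuous_intros) simp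
  have up: "max 0 (apply_bcontfun g z) \<le> (SUP z\<in>?K. max 0 (apply_bcontfun g z))" if "z \<in> ?K"
    for g :: "((real ^ 'n) \<times> (real ^ 'n)) \<Rightarrow>\<^sub>C real" and z
    using that by (rule cSUP_upper[OF _ bdd])
  have p: "sublinear p"
    unfolding sublinear_def
  proof (intro conjI allI impI)
    fix g h :: "((real ^ 'n) \<times> (real ^ 'n)) \<Rightarrow>\<^sub>C real"
    have "(SUP z\<in>?K. max 0 (apply_bcontfun (g + h) z))
        \<le> (SUP z\<in>?K. max 0 (apply_bcontfun g z)) + (SUP z\<in>?K. max 0 (apply_bcontfun h z))"
    proof (rule cSUP_least[OF K(2)])
      fix z assume "z \<in> ?K"
      then show "max 0 (apply_bcontfun (g + h) z)
          \<le> (SUP z\<in>?K. max 0 (apply_bcontfun g z)) + (SUP z\<in>?K. max 0 (apply_bcontfun h z))"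
        using up[of z g] up[of z h] by (simp add: plus_bcontfun.rep_eq)
    qed
    then show "p (g + h) \<le> p g + p h"
      unfolding p_def distrib_left[symmetric] using W by (rule mult_left_mono)
  next
    fix c :: real and g :: "((real ^ 'n) \<times> (real ^ 'n)) \<Rightarrow>\<^sub>C real"
    assume c: "0 \<le> c"
    have "(SUP z\<in>?K. max 0 (apply_bcontfun (c *\<^sub>R g) z)) = (SUP z\<in>?K. c * max 0 (apply_bcontfun g z))"
      using c by (intro SUP_cong) (auto simp: scaleR_bcontfun.rep_eq max_mult_distrib_left)
    also have "\<dots> = c * (SUP z\<in>?K. max 0 (apply_bcontfun g z))"
    proof (cases "c = 0")
      case True
      then show ?thesis using K(2) by (simp add: cSUP_const)
    next
      case False
      have "(*) c (Sup ((\<lambda>z. max 0 (apply_bcontfun g z)) ` ?K)) = (SUP s\<in>(\<lambda>z. max 0 (apply_bcontfun g z)) ` ?K. c * s)"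
        using c K(2) by (intro continuous_at_Sup_mono bdd) (auto intro!: monoI mult_left_mono continuous_intros)
      then show ?thesis by (simp add: image_comp o_def)
    qed
    finally show "p (c *\<^sub>R g) = c * p g" by (simp add: p_def)
  qed
  define R where "R = (\<lambda>\<phi>. (Bcontfun (G \<phi>), f \<phi>)) ` test_funs"
  have GB: "apply_bcontfun (Bcontfun (G \<phi>)) = G \<phi>" if "\<phi> \<in> test_funs" for \<phi>
    by (rule Bcontfun_inverse[OF G_b[OF that]])
  have G_add: "G (\<lambda>x. \<phi> x + \<psi> x) z = G \<phi> z + G \<psi> z" if "\<phi> \<in> test_funs" "\<psi> \<in> test_funs" for \<phi> \<psi> z
    unfolding G_def grad_add[OF that[THEN test_funs_differentiable]] by (rule inner_add_left)
  have G_scale: "G (\<lambda>x. c * \<phi> x) z = c * G \<phi> z" if "\<phi> \<in> test_funs" for \<phi> c z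
    unfolding G_def grad_scale[OF test_funs_differentiable[OF that]] by simp
  have "subspace R"
    unfolding subspace_def
  proof (intro conjI ballI allI)
    have scale: "c *\<^sub>R r \<in> R" if "r \<in> R" for c r
    proof -
      obtain \<phi> where \<phi>: "\<phi> \<in> test_funs" "r = (Bcontfun (G \<phi>), f \<phi>)" using \<open>r \<in> R\<close> by (auto simp: R_def)
      have "c *\<^sub>R Bcontfun (G \<phi>) = Bcontfun (G (\<lambda>x. c * \<phi> x))"
        by (rule bcontfun_eqI) (simp add: scaleR_bcontfun.rep_eq GB \<phi> test_funs_scale G_scale)
      then show ?thesis using \<phi> f_scale unfolding R_def by (intro image_eqI[of _ _ "\<lambda>x. c * \<phi> x"]) (auto intro: test_funs_scale)
    qed
    then show "c *\<^sub>R r \<in> R" if "r \<in> R" for c r using that .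
    have "(Bcontfun (G (\<lambda>x. 0)), f (\<lambda>x. 0)) \<in> R" using test_funs_zero by (auto simp: R_def)
    from scale[OF this, of 0] show "0 \<in> R" by (simp add: zero_prod_def)
    show "r + s \<in> R" if rs: "r \<in> R" "s \<in> R" for r s
    proof -
      obtain \<phi> \<psi> where \<phi>: "\<phi> \<in> test_funs" "r = (Bcontfun (G \<phi>), f \<phi>)"
        and \<psi>: "\<psi> \<in> test_funs" "s = (Bcontfun (G \<psi>), f \<psi>)" using rs by (auto simp: R_def)
      have "Bcontfun (G \<phi>) + Bcontfun (G \<psi>) = Bcontfun (G (\<lambda>x. \<phi> x + \<psi> x))"
        by (rule bcontfun_eqI) (simp add: plus_bcontfun.rep_eq GB \<phi> \<psi> test_funs_add G_add)
      then show ?thesis using \<phi> \<psi> f_add unfolding R_def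
        by (intro image_eqI[of _ _ "\<lambda>x. \<phi> x + \<psi> x"]) (auto intro: test_funs_add)
    qed
  qed
  moreover have "r \<le> p s" if "(s, r) \<in> R" for s r
  proof -
    obtain \<phi> where \<phi>: "\<phi> \<in> test_funs" and s: "s = Bcontfun (G \<phi>)" and r: "r = f \<phi>"
      using \<open>(s, r) \<in> R\<close> by (auto simp: R_def)
    have "sup_norm \<Omega> (grad \<phi>) \<le> (SUP z\<in>?K. max 0 (apply_bcontfun s z))"
    proof (rule sup_norm_least[OF \<open>\<Omega> \<noteq> {}\<close>])
      fix x assume x: "x \<in> \<Omega>"
      \<comment> \<open>The normalised gradient is the direction that attains the norm; where the
        gradient vanishes, \<open>sgn\<close> returns 0, which also lies in the ball.\<close>
      have in_K: "(x, sgn (grad \<phi> x)) \<in> ?K" using x by (auto simp: norm_sgn)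
      have "norm (grad \<phi> x) = grad \<phi> x \<bullet> sgn (grad \<phi> x)"
        by (cases "grad \<phi> x = 0") (simp_all add: sgn_div_norm power2_norm_eq_inner[symmetric] power2_eq_square)
      also have "\<dots> = apply_bcontfun s (x, sgn (grad \<phi> x))" using G_K[OF in_K] by (simp add: s GB[OF \<phi>])
      also have "\<dots> \<le> (SUP z\<in>?K. max 0 (apply_bcontfun s z))" using up[OF in_K, of s] by simp
      finally show "norm (grad \<phi> x) \<le> (SUP z\<in>?K. max 0 (apply_bcontfun s z))" .
    qed
    then show ?thesis using f_le[OF \<phi>] mult_left_mono[OF _ W] unfolding r p_def by (meson order_trans)
  qed
  ultimately have "\<exists>L. linear L \<and> L \<le> p \<and> (\<forall>s r. (s, r) \<in> R \<longrightarrow> L s = r)" by (rule Hahn_Banach[OF p])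
  then obtain L where L: "linear L" "L \<le> p" and LR: "\<And>s r. (s, r) \<in> R \<Longrightarrow> L s = r"
    by blast
  interpret P: positive_functional ?K "\<lambda>g. L (Bcontfun g)"
  proof
    show "compact ?K" by (rule K)
    show "L (Bcontfun (\<lambda>x. g x + h x)) = L (Bcontfun g) + L (Bcontfun h)"
      if "g \<in> bcontfun" "h \<in> bcontfun" for g h :: "(real ^ 'n) \<times> (real ^ 'n) \<Rightarrow> real"
    proof -
      have "Bcontfun (\<lambda>x. g x + h x) = Bcontfun g + Bcontfun h"
        using that by (intro bcontfun_eqI) (simp add: plus_bcontfun.rep_eq Bcontfun_inverse bcontfun_add)
      then show ?thesis by (simp add: linear_add[OF L(1)])
    qed
    show "L (Bcontfun (\<lambda>x. c * g x)) = c * L (Bcontfun g)" if "g \<in> bcontfun"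
      for g :: "(real ^ 'n) \<times> (real ^ 'n) \<Rightarrow> real" and c
    proof -
      have "Bcontfun (\<lambda>x. c * g x) = c *\<^sub>R Bcontfun g"
        using that by (intro bcontfun_eqI) (simp add: scaleR_bcontfun.rep_eq Bcontfun_inverse bcontfun_mult const_bcontfun)
      then show ?thesis by (simp add: linear_scale[OF L(1)])
    qed
    show "0 \<le> L (Bcontfun g)" if g: "g \<in> bcontfun" and pos: "\<And>z. z \<in> ?K \<Longrightarrow> 0 \<le> g z"
      for g :: "(real ^ 'n) \<times> (real ^ 'n) \<Rightarrow> real"
    proof -
      \<comment> \<open>For \<open>g\<close> nonnegative on \<open>?K\<close> the positive part of
        \<open>- g\<close> vanishes there, so domination by \<open>p\<close> forces
        \<open>L (- g) \<le> 0\<close>.\<close>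
      have "L (- Bcontfun g) \<le> p (- Bcontfun g)" using L(2) by (simp add: le_fun_def)
      also have "(SUP z\<in>?K. max 0 (apply_bcontfun (- Bcontfun g) z)) = (SUP z\<in>?K. 0)"
        using pos by (intro SUP_cong) (auto simp: uminus_bcontfun.rep_eq Bcontfun_inverse[OF g])
      then have "p (- Bcontfun g) = 0" using K(2) by (simp add: p_def cSUP_const)
      finally show ?thesis by (simp add: linear_neg[OF L(1)])
    qed
  qed
  let ?\<mu> = P.riesz_measure
  have mass: "measure ?\<mu> UNIV \<le> W"
  proof -
    have one: "(\<lambda>z :: (real ^ 'n) \<times> (real ^ 'n). 1 :: real) \<in> bcontfun" by (rule const_bcontfun)
    have "measure ?\<mu> UNIV = (LINT z|?\<mu>. 1)" by simp
    also have "\<dots> = L (Bcontfun (\<lambda>z. 1))" by (rule P.integral_riesz_measure[OF one])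
    also have "\<dots> \<le> p (Bcontfun (\<lambda>z. 1))" using L(2) by (simp add: le_fun_def)
    also have "\<dots> = W" using K(2) by (simp add: p_def Bcontfun_inverse[OF one] cSUP_const)
    finally show ?thesis .
  qed
  have rep: "f \<phi> = (LINT z|?\<mu>. grad \<phi> (fst z) \<bullet> snd z)" if \<phi>: "\<phi> \<in> test_funs" for \<phi>
  proof -
    have "f \<phi> = L (Bcontfun (G \<phi>))" using \<phi> by (intro LR[symmetric]) (auto simp: R_def)
    also have "\<dots> = (LINT z|?\<mu>. G \<phi> z)" by (rule P.integral_riesz_measure(2)[OF G_b[OF \<phi>], symmetric])
    also have "\<dots> = (LINT z|?\<mu>. grad \<phi> (fst z) \<bullet> snd z)"
    proof (rule integral_cong_AE)
      have c: "continuous_on UNIV (\<lambda>z :: (real ^ 'n) \<times> (real ^ 'n). grad \<phi> (fst z) \<bullet> snd z)"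
        by (intro continuous_intros continuous_on_compose2[OF test_funs_grad_continuous[OF \<phi>, of UNIV]]) auto
      show "(\<lambda>z. grad \<phi> (fst z) \<bullet> snd z) \<in> borel_measurable ?\<mu>"
        using borel_measurable_continuous_onI[OF c] by simp
      show "G \<phi> \<in> borel_measurable ?\<mu>"
        using borel_measurable_continuous_onI[OF bcontfun_cont[OF G_b[OF \<phi>]]] by simp
      have "AE z in ?\<mu>. z \<in> ?K"
        using P.emeasure_riesz_measure_outside compact_imp_closed[OF K(1)]
        by (intro AE_I[of _ _ "- ?K"]) auto
      then show "AE z in ?\<mu>. G \<phi> z = grad \<phi> (fst z) \<bullet> snd z"
        by eventually_elim (rule G_K)
    qed
    finally show ?thesis .
  qed
  show ?thesis
    using P.finite_riesz_measure P.sets_riesz_measure P.emeasure_riesz_measure_outside mass rep by blast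
qed

section \<open>The vector measure of averaged directions\<close>

locale polar_measure = finite_measure \<mu>
  for \<mu> :: "((real ^ 'n) \<times> (real ^ 'n)) measure" and \<Omega> :: "(real ^ 'n) set" +
  assumes sets_polar [measurable_cong]: "sets \<mu> = sets borel" and compact_base: "compact \<Omega>"
    and outside: "emeasure \<mu> (- (\<Omega> \<times> cball 0 1)) = 0"
begin

definition moment :: "(real ^ 'n) set \<Rightarrow> real ^ 'n" where
  "moment A = (LINT z|\<mu>. indicator A (fst z) *\<^sub>R snd z)"

lemma space_polar: "space \<mu> = UNIV"
  using sets_eq_imp_space_eq[OF sets_polar] by simp

lemma AE_polar: "AE z in \<mu>. fst z \<in> \<Omega> \<and> norm (snd z) \<le> 1"
proof -
  have "closed (\<Omega> \<times> cball (0 :: real ^ 'n) 1)"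
    using compact_base by (intro closed_Times compact_imp_closed) auto
  then have "AE z in \<mu>. z \<in> \<Omega> \<times> cball 0 1"
    using outside sets_polar by (intro AE_I[of _ _ "- (\<Omega> \<times> cball 0 1)"]) (auto simp: space_polar)
  then show ?thesis by eventually_elim auto
qed

lemma fst_polar_measurable [measurable]: "fst \<in> \<mu> \<rightarrow>\<^sub>M borel"
  and snd_polar_measurable [measurable]: "snd \<in> \<mu> \<rightarrow>\<^sub>M borel"
  using borel_measurable_continuous_onI[OF continuous_on_fst[OF continuous_on_id]]
    borel_measurable_continuous_onI[OF continuous_on_snd[OF continuous_on_id]]
    measurable_cong_sets[OF sets_polar refl] by auto

lemma integrable_moment:
  assumes [measurable]: "A \<in> sets borel"
  shows "integrable \<mu> (\<lambda>z. indicator A (fst z) *\<^sub>R snd z)"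
proof (rule integrable_const_bound)
  show "AE z in \<mu>. norm (indicator A (fst z) *\<^sub>R snd z) \<le> 1"
    using AE_polar by eventually_elim (auto simp: indicator_def)
qed measurable

lemma moment_UN:
  assumes "finite I" "disjoint_family_on A I" "\<And>i. i \<in> I \<Longrightarrow> A i \<in> sets borel"
  shows "(\<Sum>i\<in>I. moment (A i)) = moment (\<Union>i\<in>I. A i)"
proof -
  have "(\<Sum>i\<in>I. moment (A i)) = (LINT z|\<mu>. (\<Sum>i\<in>I. indicator (A i) (fst z) *\<^sub>R snd z))"
    unfolding moment_def using assms by (intro Bochner_Integration.integral_sum[symmetric] integrable_moment)
  also have "\<dots> = moment (\<Union>i\<in>I. A i)"
    unfolding moment_def using assms
    by (simp add: indicator_UN_disjoint scaleR_sum_left)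
  finally show ?thesis .
qed

text \<open>Countable additivity is dominated convergence along the finite unions; the constant 1
  dominates because \<open>\<mu>\<close> is finite and the directions have norm at most 1 almost
  everywhere.\<close>

lemma moment_vector_measure: "moment \<in> vector_measures \<Omega>"
  unfolding vector_measures_def
proof (intro CollectI conjI allI impI ballI)
  fix A :: "nat \<Rightarrow> (real ^ 'n) set" assume A: "range A \<subseteq> sets borel \<and> disjoint_family A"
  have A_sets [measurable]: "A i \<in> sets borel" for i using A by auto
  have "(\<Sum>i<n. moment (A i)) = moment (\<Union>i<n. A i)" for n
    using A by (intro moment_UN) (auto intro: disjoint_family_on_mono)
  moreover have "(\<lambda>n. moment (\<Union>i<n. A i)) \<longlonglongrightarrow> moment (\<Union>i. A i)"
    unfolding moment_def
  proof (rule integral_dominated_convergence[where w = "\<lambda>_. 1"])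
    show "AE z in \<mu>. (\<lambda>n. indicator (\<Union>i<n. A i) (fst z) *\<^sub>R snd z) \<longlonglongrightarrow> indicator (\<Union>i. A i) (fst z) *\<^sub>R snd z"
      by (intro AE_I2 tendsto_scaleR LIMSEQ_indicator_UN tendsto_const)
    show "AE z in \<mu>. norm (indicator (\<Union>i<n. A i) (fst z) *\<^sub>R snd z) \<le> 1" for n
      using AE_polar by eventually_elim (auto simp: indicator_def)
  next
    show "(\<lambda>z. indicator (\<Union>i<n. A i) (fst z) *\<^sub>R snd z) \<in> borel_measurable \<mu>" for n
      by (intro borel_measurable_integrable integrable_moment) auto
    show "(\<lambda>z. indicator (\<Union>i. A i) (fst z) *\<^sub>R snd z) \<in> borel_measurable \<mu>"
      by (intro borel_measurable_integrable integrable_moment) auto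
  qed simp
  ultimately show "(\<lambda>n. moment (A n)) sums moment (\<Union>n. A n)" by (simp add: sums_def)
next
  fix A :: "(real ^ 'n) set" assume "A \<in> sets borel" and disj: "A \<inter> \<Omega> = {}"
  have "AE z in \<mu>. indicator A (fst z) *\<^sub>R snd z = 0"
    using AE_polar by eventually_elim (use disj in \<open>auto simp: indicator_def\<close>)
  then show "moment A = 0" unfolding moment_def by (rule integral_eq_zero_AE)
qed

lemma norm_moment_le:
  assumes A [measurable]: "A \<in> sets borel"
  shows "norm (moment A) \<le> measure \<mu> (fst -` A)"
proof -
  have "fst -` A \<in> sets \<mu>" using measurable_sets[OF fst_polar_measurable A] by (simp add: space_polar)
  then have int: "integrable \<mu> (indicator (fst -` A) :: _ \<Rightarrow> real)"
    by (intro integrable_real_indicator) (auto simp: emeasure_eq_measure)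
  have "norm (moment A) \<le> (LINT z|\<mu>. norm (indicator A (fst z) *\<^sub>R snd z))"
    unfolding moment_def by (rule integral_norm_bound)
  also have "\<dots> \<le> (LINT z|\<mu>. indicator (fst -` A) z)"
  proof (rule integral_mono_AE)
    show "AE z in \<mu>. norm (indicator A (fst z) *\<^sub>R snd z) \<le> indicator (fst -` A) z"
      using AE_polar by eventually_elim (auto simp: indicator_def)
  qed (intro integrable_norm integrable_moment A int)+
  also have "\<dots> = measure \<mu> (fst -` A)" by (simp add: space_polar)
  finally show ?thesis .
qed

text \<open>By \<open>norm_moment_le\<close> each value is bounded by the first marginal of
  \<open>\<mu>\<close>. Preimages of disjoint sets under \<open>fst\<close> are disjoint, so these
  bounds add up to at most the total mass.\<close>

lemma total_variation_moment_le: "total_variation moment \<le> ereal (measure \<mu> UNIV)"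
  unfolding total_variation_def
proof (rule SUP_least)
  fix P assume "P \<in> {P. finite P \<and> P \<subseteq> sets (borel :: (real ^ 'n) measure) \<and> disjoint P}"
  then have P: "finite P" "P \<subseteq> sets borel" "disjoint P" by auto
  have meas: "fst -` A \<in> sets \<mu>" if "A \<in> P" for A
    using measurable_sets[OF fst_polar_measurable, of A] that P(2) by (auto simp: space_polar)
  have "(\<Sum>A\<in>P. norm (moment A)) \<le> (\<Sum>A\<in>P. measure \<mu> (fst -` A))"
    using P(2) by (intro sum_mono norm_moment_le) auto
  also have "\<dots> = measure \<mu> (\<Union>A\<in>P. fst -` A)"
    using P(1,3) meas by (intro finite_measure_finite_Union[symmetric])
      (auto simp: disjoint_family_on_def disjoint_def)
  also have "\<dots> \<le> measure \<mu> UNIV"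
    using bounded_measure[of "\<Union>A\<in>P. fst -` A"] by (simp add: space_polar)
  finally show "(\<Sum>A\<in>P. ereal (norm (moment A))) \<le> ereal (measure \<mu> UNIV)" by simp
qed

text \<open>The left side is built from Jordan parts and the right side from \<open>\<mu>\<close>.
  Both are within a multiple of \<open>\<delta>\<close> of the same Riemann sum, on the right
  because that sum is the integral of a step function in \<open>fst z\<close> paired with
  \<open>snd z\<close>.\<close>

lemma vector_integral_moment:
  assumes g: "continuous_on UNIV g"
  shows "vector_integral moment g = (LINT z|\<mu>. g (fst z) \<bullet> snd z)"
proof -
  let ?M = "measure \<mu> UNIV"
  have "\<bar>vector_integral moment g - (LINT z|\<mu>. g (fst z) \<bullet> snd z)\<bar> \<le> (2 * ?M * real CARD('n) + ?M) * \<delta>"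
    if \<delta>: "\<delta> > 0" for \<delta>
  proof -
    obtain m A x where part: "tagged_partition \<Omega> g \<delta> m A x"
      using tagged_partition_exists[OF compact_base g \<delta>] by blast
    then have A: "\<And>i. i < m \<Longrightarrow> A i \<in> sets borel" "disjoint_family_on A {..<m}" "(\<Union>i<m. A i) = \<Omega>"
      and close: "\<And>i y. i < m \<Longrightarrow> y \<in> A i \<Longrightarrow> norm (g y - g (x i)) \<le> \<delta>"
      by (auto simp: tagged_partition_def)
    have b: "norm (moment A) \<le> ?M" if "A \<in> sets borel" for A
      using norm_moment_le[OF that] bounded_measure[of "fst -` A"] by (simp add: space_polar)
    let ?S = "\<Sum>j<m. g (x j) \<bullet> moment (A j)"
    let ?h = "\<lambda>z. \<Sum>j<m. g (x j) \<bullet> (indicator (A j) (fst z) *\<^sub>R snd z)"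
    have h_int: "integrable \<mu> ?h"
      using A(1) by (intro Bochner_Integration.integrable_sum integrable_inner_right integrable_moment) auto
    have "?S = (\<Sum>j<m. LINT z|\<mu>. g (x j) \<bullet> (indicator (A j) (fst z) *\<^sub>R snd z))"
      unfolding moment_def using A(1)
      by (intro sum.cong refl integral_inner_right[symmetric] integrable_moment) auto
    also have "\<dots> = (LINT z|\<mu>. ?h z)"
      using A(1) by (intro Bochner_Integration.integral_sum[symmetric] integrable_inner_right integrable_moment) auto
    finally have S: "?S = (LINT z|\<mu>. ?h z)" .
    have meas: "(\<lambda>z. g (fst z) \<bullet> snd z) \<in> borel_measurable \<mu>"
      using borel_measurable_continuous_onI[OF g] by measurable
    have close_AE: "AE z in \<mu>. norm (g (fst z) \<bullet> snd z - ?h z) \<le> \<delta>"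
      using AE_polar
    proof eventually_elim
      case (elim z)
      then obtain i where i: "i < m" "fst z \<in> A i" using A(3) by blast
      have "indicator (A j) (fst z) = (if j = i then 1 else 0 :: real)" if "j < m" for j
        using A(2) that i by (auto simp: disjoint_family_on_def indicator_def)
      then have "?h z = (\<Sum>j<m. if j = i then g (x j) \<bullet> snd z else 0)" by (intro sum.cong) auto
      also have "\<dots> = g (x i) \<bullet> snd z" using i by (subst sum.delta) auto
      finally have "norm (g (fst z) \<bullet> snd z - ?h z) = \<bar>(g (fst z) - g (x i)) \<bullet> snd z\<bar>"
        by (simp add: inner_diff_left)
      also have "\<dots> \<le> norm (g (fst z) - g (x i)) * norm (snd z)" by (rule Cauchy_Schwarz_ineq2)
      also have "\<dots> \<le> \<delta> * 1" using close[OF i] elim \<delta> by (intro mult_mono) auto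
      finally show ?case by simp
    qed
    have d_int: "integrable \<mu> (\<lambda>z. g (fst z) \<bullet> snd z - ?h z)"
      by (rule integrable_const_bound[OF close_AE])
        (intro borel_measurable_diff meas borel_measurable_integrable h_int)
    then have "integrable \<mu> (\<lambda>z. g (fst z) \<bullet> snd z)" using Bochner_Integration.integrable_add[OF d_int h_int] by simp
    then have "\<bar>(LINT z|\<mu>. g (fst z) \<bullet> snd z) - ?S\<bar> = norm (LINT z|\<mu>. g (fst z) \<bullet> snd z - ?h z)"
      unfolding S using h_int by simp
    also have "\<dots> \<le> (LINT z|\<mu>. norm (g (fst z) \<bullet> snd z - ?h z))" by (rule integral_norm_bound)
    also have "\<dots> \<le> (LINT z|\<mu>. \<delta>)"
      using close_AE d_int by (intro integral_mono_AE integrable_norm) auto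
    also have "\<dots> = \<delta> * ?M" by (simp add: space_polar)
    finally have "\<bar>(LINT z|\<mu>. g (fst z) \<bullet> snd z) - ?S\<bar> \<le> \<delta> * ?M" .
    moreover have "\<bar>vector_integral moment g - ?S\<bar> \<le> 2 * ?M * \<delta> * real CARD('n)"
      using vector_integral_riemann_sum[OF moment_vector_measure b compact_base g part] \<delta> by simp
    ultimately show ?thesis by (simp add: algebra_simps abs_le_iff)
  qed
  note le = this
  define k where "k = 2 * ?M * real CARD('n) + ?M"
  have k0: "0 \<le> k" by (simp add: k_def)
  have "\<bar>vector_integral moment g - (LINT z|\<mu>. g (fst z) \<bullet> snd z)\<bar> \<le> 0"
  proof (rule field_le_epsilon)
    fix e :: real assume "e > 0"
    have "e / (k + 1) > 0" using \<open>e > 0\<close> k0 by simp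
    from le[OF this]
    have "\<bar>vector_integral moment g - (LINT z|\<mu>. g (fst z) \<bullet> snd z)\<bar> \<le> k * (e / (k + 1))"
      unfolding k_def[symmetric] .
    also have "\<dots> \<le> e" using \<open>e > 0\<close> k0 by (simp add: field_simps)
    finally show "\<bar>vector_integral moment g - (LINT z|\<mu>. g (fst z) \<bullet> snd z)\<bar> \<le> 0 + e" by simp
  qed
  then show ?thesis by simp
qed

end

section \<open>Weak duality, the empty domain and the conclusion\<close>

lemma total_variation_nonneg: "0 \<le> total_variation l"
  using total_variation_upper[of "{}" l] by (simp add: disjoint_def zero_ereal_def)

text \<open>The divergence equation can be tested only with test functions, so \<open>u\<close> is
  replaced by approximants of a shift whose gradients are bounded by 1 everywhere; each of them
  obeys the bound, and so does the limit.\<close>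

lemma (in sharp_functional) pairing_le_total_variation:
  assumes u: "1-lipschitz_on \<Omega> u" and l: "l \<in> vector_measures \<Omega>" "neg_div_eq l f"
  shows "ereal (pairing \<Omega> f u) \<le> total_variation l"
proof (cases "total_variation l")
  case (real t)
  obtain c where "\<forall>y\<in>\<Omega>. \<bar>u y\<bar> \<le> c" using lipschitz_bounded[OF u] by blast
  then obtain v where v: "approximates \<Omega> v (\<lambda>x. u x + c)" "\<And>n x. norm (grad (v n) x) \<le> 1"
    and lim: "(\<lambda>n. f (v n)) \<longlonglongrightarrow> pairing \<Omega> f u"
    using lipschitz_approximation[OF u, of c] by blast
  have "f (v n) \<le> t" for n
  proof -
    have vn: "v n \<in> test_funs" using v(1) by (auto simp: approximates_def)
    then have "f (v n) = vector_integral l (grad (v n))" using l(2) by (simp add: neg_div_eq_def)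
    also have "\<dots> \<le> t * 1"
      by (rule vector_integral_le_total_variation[OF l(1) real compact test_funs_grad_continuous[OF vn]])
        (use v(2) in auto)
    finally show ?thesis by simp
  qed
  then have "pairing \<Omega> f u \<le> t" by (intro LIMSEQ_le_const2[OF lim]) auto
  then show ?thesis using real by simp
next
  case MInf
  then show ?thesis using total_variation_nonneg[of l] by simp
qed simp

text \<open>Every function is constant on the empty set, so \<open>f\<close> vanishes on all test
  functions, whatever the value of \<open>sup_norm\<close>.\<close>

lemma pairing_empty:
  assumes "f \<in> X0_sharp {}"
  shows "pairing {} f u = 0"
proof -
  have zero: "f \<phi> = 0" if "\<phi> \<in> test_funs" for \<phi>
    using assms that by (auto simp: X0_sharp_def X0_def constant_on_def)
  have "approximates {} (\<lambda>n x. 0) u"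
    using test_funs_zero by (auto simp: approximates_def)
  moreover have "(\<lambda>n. f (v n)) \<longlonglongrightarrow> 0" if "approximates {} v u" for v
  proof -
    have "f (v n) = 0" for n using that by (intro zero) (auto simp: approximates_def)
    then show ?thesis by simp
  qed
  ultimately show ?thesis
    unfolding pairing_def using LIMSEQ_unique by (intro the_equality) blast+
qed

lemma duality_empty:
  fixes f :: "(real ^ 'n \<Rightarrow> real) \<Rightarrow> real"
  assumes f: "f \<in> X0_sharp {}"
  shows "W1 {} f = 0" and "(\<lambda>A. 0) \<in> vector_measures {}" and "neg_div_eq (\<lambda>A. 0) f"
    and "total_variation (\<lambda>A. 0 :: real ^ 'n) = 0"
proof -
  have "(\<lambda>x :: real ^ 'n. 0 :: real) \<in> {u \<in> C1_compact_supp. \<forall>x. norm (grad u x) \<le> 1}"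
    using test_funs_zero grad_eqI[of "\<lambda>x :: real ^ 'n. 0" 0]
    by (auto simp: test_funs_def C1_compact_supp_def simp del: C_k.simps)
  then show "W1 {} f = 0" unfolding W1_def pairing_empty[OF f] by (subst SUP_const) (auto simp: zero_ereal_def)
  show "(\<lambda>A. 0) \<in> vector_measures {}" by (simp add: vector_measures_def)
  have "f \<phi> = 0" if "\<phi> \<in> test_funs" for \<phi>
    using f that by (auto simp: X0_sharp_def X0_def constant_on_def)
  then show "neg_div_eq (\<lambda>A. 0) f" by (simp add: neg_div_eq_def vector_integral_def signed_integral_def)
  show "total_variation (\<lambda>A. 0 :: real ^ 'n) = 0"
    unfolding total_variation_def by (intro antisym SUP_least SUP_upper2[of "{}"]) (auto simp: disjoint_def)
qed

theorem theorem3p3: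
  fixes \<Omega> :: "(real ^ 'n) set" and f :: "(real ^ 'n \<Rightarrow> real) \<Rightarrow> real"
  assumes "convex \<Omega>" and "compact \<Omega>" and "f \<in> X0_sharp \<Omega>"
  shows "(\<exists>u. 1-lipschitz_on \<Omega> u \<and>
            (\<forall>v. 1-lipschitz_on \<Omega> v \<longrightarrow> pairing \<Omega> f v \<le> pairing \<Omega> f u) \<and>
            W1 \<Omega> f = ereal (pairing \<Omega> f u)) \<and>
         (\<exists>l. is_arg_min total_variation (\<lambda>l. l \<in> vector_measures \<Omega> \<and> neg_div_eq l f) l) \<and>
         W1 \<Omega> f = (INF l \<in> {l \<in> vector_measures \<Omega>. neg_div_eq l f}. total_variation l)"
proof -
  \<comment> \<open>All claims follow from these facts: a measure with total variation at most
    \<open>W1\<close> exists, no admissible measure lies below \<open>W1\<close>, and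
    \<open>u\<close> realises \<open>W1\<close>.\<close>
  obtain u l where u: "1-lipschitz_on \<Omega> u" "\<And>v. 1-lipschitz_on \<Omega> v \<Longrightarrow> pairing \<Omega> f v \<le> pairing \<Omega> f u"
    and W1: "W1 \<Omega> f = ereal (pairing \<Omega> f u)"
    and l: "l \<in> vector_measures \<Omega>" "neg_div_eq l f" "total_variation l \<le> W1 \<Omega> f"
    and lower: "\<And>k. k \<in> vector_measures \<Omega> \<Longrightarrow> neg_div_eq k f \<Longrightarrow> W1 \<Omega> f \<le> total_variation k"
  proof (cases "\<Omega> = {}")
    case True
    then have f: "f \<in> X0_sharp {}" using assms(3) by simp
    show ?thesis
      by (rule that[of "\<lambda>x. 0" "\<lambda>A. 0"])
        (use True duality_empty[OF f] pairing_empty[OF f] total_variation_nonneg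
          in \<open>auto simp: zero_ereal_def\<close>)
  next
    case False
    interpret sharp_functional \<Omega> f using assms False by unfold_locales
    obtain u where u: "1-lipschitz_on \<Omega> u" "\<And>v. 1-lipschitz_on \<Omega> v \<Longrightarrow> pairing \<Omega> f v \<le> pairing \<Omega> f u"
      using maximizer_exists by blast
    define W where "W = pairing \<Omega> f u"
    have W1: "W1 \<Omega> f = ereal W" unfolding W_def by (rule W1_eq[OF u])
    have "f (\<lambda>x. 0) = 0" by (intro f_constant_on test_funs_zero) (auto simp: constant_on_def)
    moreover have "1-lipschitz_on \<Omega> (\<lambda>x. 0 :: real)" by (simp add: lipschitz_on_def)
    \<comment> \<open>Testing with the zero function gives the sign of \<open>W\<close>, which
      sublinearity of the dominating functional in \<open>polar_measure_exists\<close>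
      requires.\<close>
    ultimately have "0 \<le> W" using u(2) pairing_test_fun[OF test_funs_zero] unfolding W_def by metis
    have "f \<phi> \<le> W * sup_norm \<Omega> (grad \<phi>)" if "\<phi> \<in> test_funs" for \<phi>
      unfolding W_def by (rule f_le_grad[OF \<open>convex \<Omega>\<close> u(2) that])
    from polar_measure_exists[OF \<open>convex \<Omega>\<close> \<open>compact \<Omega>\<close> False \<open>0 \<le> W\<close> f_add f_scale this]
    obtain \<mu> :: "((real ^ 'n) \<times> (real ^ 'n)) measure" where \<mu>: "finite_measure \<mu>" "sets \<mu> = sets borel"
      "emeasure \<mu> (- (\<Omega> \<times> cball 0 1)) = 0" "measure \<mu> UNIV \<le> W"
      and rep: "\<And>\<phi>. \<phi> \<in> test_funs \<Longrightarrow> f \<phi> = (LINT z|\<mu>. grad \<phi> (fst z) \<bullet> snd z)"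
      by blast
    interpret finite_measure \<mu> by (rule \<mu>)
    interpret polar_measure \<mu> \<Omega> using \<mu> \<open>compact \<Omega>\<close> by unfold_locales
    show ?thesis
    proof (rule that[OF u])
      show "W1 \<Omega> f = ereal (pairing \<Omega> f u)" using W1 by (simp add: W_def)
      show "moment \<in> vector_measures \<Omega>" by (rule moment_vector_measure)
      show "neg_div_eq moment f"
        unfolding neg_div_eq_def using rep vector_integral_moment[OF test_funs_grad_continuous] by simp
      show "total_variation moment \<le> W1 \<Omega> f"
        using total_variation_moment_le \<mu>(4) unfolding W1 by (meson ereal_less_eq(3) order_trans)
      show "W1 \<Omega> f \<le> total_variation k" if "k \<in> vector_measures \<Omega>" "neg_div_eq k f" for k
        using pairing_le_total_variation[OF u(1) that] W1 by (simp add: W_def)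
    qed
  qed
  have "is_arg_min total_variation (\<lambda>l. l \<in> vector_measures \<Omega> \<and> neg_div_eq l f) l"
    unfolding is_arg_min_def using l lower by (meson leD order_trans not_le)
  moreover have "W1 \<Omega> f = (INF l \<in> {l \<in> vector_measures \<Omega>. neg_div_eq l f}. total_variation l)"
    using l lower by (intro antisym INF_greatest INF_lower2[of l]) auto
  ultimately show ?thesis using u W1 by blast
qed

end
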